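(* Let $n>2$, and let $\Sigma_n$ be the symmetric group on $\{1,\dots,n\}$. Let $N_1=\mathbb{T}^2\#\mathbb{T}^2$ and $N_2=\mathbb{RP}^2\#\mathbb{T}^2$, and let $$\theta_1\colon\pi_1(N_1)=\langle a_1,b_1,a_2,b_2\mid[a_1,b_1][a_2,b_2]=1\rangle\to\Sigma_n,\qquad \theta_2\colon\pi_1(N_2)=\langle c,a_1,b_1\mid c^2[a_1,b_1]=1\rangle\to\Sigma_n$$ be the surjective homomorphisms given by $\theta_1(a_1)=\theta_1(b_1)=(1,2)$, $\theta_1(a_2)=\theta_1(b_2)=(1,n,\dots,2)$, and $\theta_2(c)=(1,2)$, $\theta_2(a_1)=\theta_2(b_1)=(1,n,\dots,2)$. For $i=1,2$, let $M_i$ and $\tau_i\colon\Sigma_n\times M_i\to M_i$ be the compact surface without boundary and the free action arising from $\theta_i$. Then: (a) The quadruple $(M_1,\Sigma_n,\tau_1;\mathbb{R}^2)$ does not have the Borsuk-Ulam property. (b) For the quadruple $(M_2,\Sigma_n,\tau_2;\mathbb{R}^2)$, there does not exist a homomorphism $\psi\colon\pi_1((M_2)_{\tau_2})=\pi_1(N_2)\to B_n(\mathbb{R}^2)$ such that $\pi\circ\psi=\theta_{\tau_2}=\theta_2$, where $\pi\colon B_n(\mathbb{R}^2)\to\Sigma_n$ is the permutation homomorphism. (c) The quadruple $(M_2,\mathbb{Z}_n,\tau_{\mathbb{Z}_n};\mathbb{R}^2)$ does not have the Borsuk-Ulam property, where $\tau_{\mathbb{Z}_n}$ is the action of $\mathbb{Z}_n$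 on $M_2$ obtained by restricting $\tau_2$ to the cyclic subgroup $\langle(1,n,\dots,2)\rangle\cong\mathbb{Z}_n$ of $\Sigma_n$.
   Context: Borsuk-Ulam property: for a free action $\tau\colon G\times M\to M$ of a non-trivial group $G$, a free homotopy class $\beta\in[M,N]$ has the Borsuk-Ulam property with respect to $(G,\tau)$ if for every map $f\colon M\to N$ representing $\beta$ there exist $g_1\ne g_2$ in $G$ and $x\in M$ with $f(\tau(g_1,x))=f(\tau(g_2,x))$. The quadruple $(M,G,\tau;N)$ has the Borsuk-Ulam property if every class in $[M,N]$ does. For a free action $\tau\colon G\times M\to M$ of a non-trivial finite group $G$ on a compact connected surface $M$ without boundary, $M_\tau$ is the orbit space, $p_\tau\colon M\to M_\tau$ the quotient covering, and $\theta_\tau\colon\pi_1(M_\tau)\to G$ the natural projection in the exact sequence $1\to\pi_1(M)\xrightarrow{(p_\tau)_\#}\pi_1(M_\tau)\xrightarrow{\theta_\tau}G\to1$. Arising: if $N$ is a compact surface without boundary, $G$ a non-trivial finite group and $\theta\colon\pi_1(N)\to G$ a surjective homomorphism, the surface $M$ and the action $\tau$ arising from $\theta$ are the connected regular covering $M\to N$ with $\pi_1(M)=\ker\theta$, together with the free action $\tau\colon G\times M\to M$ by deck transformations for which $M_\tau=N$, $(p_\tau)_\#$ is the inclusion $\ker\theta\hookrightarrow\pi_1(N)$, and $\theta_\tau=\theta$. $\mathbb{T}^2$ is the torus, $\#$ denotes connected sum, and $[a,b]=aba^{-1}b^{-1}$. Products of permutations are read from left to right. $B_n(\mathbb{R}^2)$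 is the $n$-string Artin braid group with standard generators $\sigma_1,\dots,\sigma_{n-1}$, and the permutation homomorphism sends $\sigma_i$ to $(i,i+1)$. *)

theory Defs
  imports
    "HOL-Analysis.Analysis"
    "HOL-Algebra.Group_Action"
    "HOL-Algebra.Elementary_Groups"
    "HOL-Algebra.Sym_Groups"
    "HOL-Combinatorics.Cycles"
begin

section \<open>Group presentations\<close>

text \<open>A letter \<open>(x, True)\<close> stands for the generator \<open>x\<close>, and \<open>(x, False)\<close> for its inverse.\<close>

type_synonym 'g word = "('g \<times> bool) list"

definition inverse_word :: "'g word \<Rightarrow> 'g word" where
  "inverse_word w = rev (map (\<lambda>(x, b). (x, \<not> b)) w)"

text \<open>The convention is \<open>[x, y] = x y x\<^sup>-\<^sup>1 y\<^sup>-\<^sup>1\<close>.\<close>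

definition commutator_word :: "'g \<Rightarrow> 'g \<Rightarrow> 'g word" where
  "commutator_word x y = [(x, True), (y, True), (x, False), (y, False)]"

definition words :: "'g set \<Rightarrow> 'g word set" where
  "words S = lists (S \<times> UNIV)"

inductive word_eq :: "'g set \<Rightarrow> 'g word set \<Rightarrow> 'g word \<Rightarrow> 'g word \<Rightarrow> bool"
  for S :: "'g set" and R :: "'g word set" where
  refl: "w \<in> words S \<Longrightarrow> word_eq S R w w"
| sym: "word_eq S R v w \<Longrightarrow> word_eq S R w v"
| trans: "word_eq S R u v \<Longrightarrow> word_eq S R v w \<Longrightarrow> word_eq S R u w"
| cancel: "u \<in> words S \<Longrightarrow> v \<in> words S \<Longrightarrow> x \<in> S
    \<Longrightarrow> word_eq S R (u @ [(x, b), (x, \<not> b)] @ v) (u @ v)"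
| relator: "u \<in> words S \<Longrightarrow> v \<in> words S \<Longrightarrow> r \<in> R \<Longrightarrow> r \<in> words S
    \<Longrightarrow> word_eq S R (u @ r @ v) (u @ v)"

definition word_class :: "'g set \<Rightarrow> 'g word set \<Rightarrow> 'g word \<Rightarrow> 'g word set" where
  "word_class S R w = {v. word_eq S R w v}"

definition presented_group :: "'g set \<Rightarrow> 'g word set \<Rightarrow> 'g word set monoid" where
  "presented_group S R =
    \<lparr>carrier = word_class S R ` words S,
     mult = \<lambda>A B. {w. \<exists>u\<in>A. \<exists>v\<in>B. word_eq S R (u @ v) w},
     one = word_class S R []\<rparr>"

text \<open>\<open>presents S R G e\<close>: the group \<open>G\<close> has the presentation \<open>\<langle>S | R\<rangle>\<close>, where the
  generator \<open>x \<in> S\<close> corresponds to \<open>e x \<in> G\<close>.\<close>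

definition presents :: "'g set \<Rightarrow> 'g word set \<Rightarrow> ('a, 'b) monoid_scheme \<Rightarrow> ('g \<Rightarrow> 'a) \<Rightarrow> bool" where
  "presents S R G e \<longleftrightarrow>
    (\<exists>\<phi> \<in> iso (presented_group S R) G. \<forall>x\<in>S. \<phi> (word_class S R [(x, True)]) = e x)"

fun eval_word :: "('a, 'b) monoid_scheme \<Rightarrow> ('g \<Rightarrow> 'a) \<Rightarrow> 'g word \<Rightarrow> 'a" where
  "eval_word G h [] = \<one>\<^bsub>G\<^esub>"
| "eval_word G h ((x, b) # w) = (if b then h x else inv\<^bsub>G\<^esub> (h x)) \<otimes>\<^bsub>G\<^esub> eval_word G h w"

text \<open>The homomorphism out of a presented group with prescribed values on the generators;
  it is meaningful when these values satisfy the relators.\<close>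

definition presented_hom :: "('a, 'b) monoid_scheme \<Rightarrow> ('g \<Rightarrow> 'a) \<Rightarrow> 'g word set \<Rightarrow> 'a" where
  "presented_hom G h A = the_elem (eval_word G h ` A)"

lemma words_simps [simp]:
  "[] \<in> words S"
  "(a # w) \<in> words S \<longleftrightarrow> fst a \<in> S \<and> w \<in> words S"
  "(v @ w) \<in> words S \<longleftrightarrow> v \<in> words S \<and> w \<in> words S"
  by (auto simp: words_def mem_Times_iff)

lemma inverse_word_in_words [simp]: "inverse_word w \<in> words S \<longleftrightarrow> w \<in> words S"
  by (induction w) (auto simp: inverse_word_def split: prod.splits)

lemma word_eq_words: "word_eq S R v w \<Longrightarrow> v \<in> words S \<and> w \<in> words S"
  by (induction rule: word_eq.induct) auto

lemma word_eq_context: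
  assumes "word_eq S R v w" "a \<in> words S" "b \<in> words S"
  shows "word_eq S R (a @ v @ b) (a @ w @ b)"
  using assms
proof (induction rule: word_eq.induct)
  case (cancel u v x c)
  then show ?case
    using word_eq.cancel[of "a @ u" S "v @ b" x R c] by simp
next
  case (relator u v r)
  then show ?case
    using word_eq.relator[of "a @ u" S "v @ b" r R] by simp
qed (auto intro: word_eq.intros)

lemma word_eq_append:
  assumes "word_eq S R v v'" "word_eq S R w w'"
  shows "word_eq S R (v @ w) (v' @ w')"
proof -
  have "word_eq S R (v @ w) (v' @ w)"
    using word_eq_context[OF assms(1), of "[]" w] word_eq_words[OF assms(2)] by simp
  moreover have "word_eq S R (v' @ w) (v' @ w')"
    using word_eq_context[OF assms(2), of v' "[]"] word_eq_words[OF assms(1)] by simp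
  ultimately show ?thesis
    by (rule word_eq.trans)
qed

lemma word_class_mult:
  assumes "v \<in> words S" "w \<in> words S"
  shows "word_class S R v \<otimes>\<^bsub>presented_group S R\<^esub> word_class S R w = word_class S R (v @ w)"
proof -
  have "word_eq S R (v @ w) u" if "word_eq S R v v'" "word_eq S R w w'" "word_eq S R (v' @ w') u" for u v' w'
    using word_eq_append[OF that(1,2)] that(3) by (rule word_eq.trans)
  moreover have "word_eq S R v v" "word_eq S R w w"
    using assms by (auto intro: word_eq.refl)
  ultimately show ?thesis
    unfolding presented_group_def word_class_def by auto
qed

lemma word_class_eq:
  assumes "word_eq S R v w" shows "word_class S R v = word_class S R w"
  using assms unfolding word_class_def by (auto intro: word_eq.sym word_eq.trans)

lemma inverse_word_cancel: "w \<in> words S \<Longrightarrow> word_eq S R (inverse_word w @ w) []"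
proof (induction w)
  case Nil
  then show ?case by (auto simp: inverse_word_def intro: word_eq.refl)
next
  case (Cons a w)
  obtain x b where a: "a = (x, b)" by force
  have "word_eq S R (inverse_word w @ [(x, \<not> b), (x, \<not> \<not> b)] @ w) (inverse_word w @ w)"
    using Cons.prems a by (intro word_eq.cancel) auto
  then show ?case
    using Cons a by (auto simp: inverse_word_def intro: word_eq.trans)
qed

lemma group_presented_group: "group (presented_group S R)"
proof (rule groupI)
  let ?G = "presented_group S R"
  have car: "carrier ?G = word_class S R ` words S" and one: "\<one>\<^bsub>?G\<^esub> = word_class S R []"
    by (simp_all add: presented_group_def)
  show "\<And>x y. x \<in> carrier ?G \<Longrightarrow> y \<in> carrier ?G \<Longrightarrow> x \<otimes>\<^bsub>?G\<^esub> y \<in> carrier ?G"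
    unfolding car by (auto simp: word_class_mult)
  show "\<one>\<^bsub>?G\<^esub> \<in> carrier ?G"
    unfolding car one by simp
  show "\<And>x y z. x \<in> carrier ?G \<Longrightarrow> y \<in> carrier ?G \<Longrightarrow> z \<in> carrier ?G \<Longrightarrow>
      x \<otimes>\<^bsub>?G\<^esub> y \<otimes>\<^bsub>?G\<^esub> z = x \<otimes>\<^bsub>?G\<^esub> (y \<otimes>\<^bsub>?G\<^esub> z)"
    unfolding car by (auto simp: word_class_mult)
  show "\<And>x. x \<in> carrier ?G \<Longrightarrow> \<one>\<^bsub>?G\<^esub> \<otimes>\<^bsub>?G\<^esub> x = x"
    unfolding car one by (auto simp: word_class_mult)
  show "\<exists>y\<in>carrier ?G. y \<otimes>\<^bsub>?G\<^esub> x = \<one>\<^bsub>?G\<^esub>" if x: "x \<in> carrier ?G" for x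
  proof -
    from x obtain w where w: "w \<in> words S" "x = word_class S R w"
      unfolding car by auto
    have "word_class S R (inverse_word w) \<otimes>\<^bsub>?G\<^esub> x = \<one>\<^bsub>?G\<^esub>"
      using w word_class_eq[OF inverse_word_cancel[OF w(1)]] by (simp add: word_class_mult one)
    with w(1) show ?thesis
      unfolding car by (intro bexI[of _ "word_class S R (inverse_word w)"]) auto
  qed
qed

context
  fixes G :: "('a, 'b) monoid_scheme" and S :: "'g set" and R :: "'g word set" and h :: "'g \<Rightarrow> 'a"
  assumes G: "group G" and h: "h \<in> S \<rightarrow> carrier G"
    and R: "\<And>r. r \<in> R \<Longrightarrow> eval_word G h r = \<one>\<^bsub>G\<^esub>"
begin

interpretation group G by (rule G)

lemma h_closed: "x \<in> S \<Longrightarrow> h x \<in> carrier G"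
  using h by auto

lemma eval_word_closed: "w \<in> words S \<Longrightarrow> eval_word G h w \<in> carrier G"
  by (induction w) (auto simp: h_closed)

lemma eval_word_append:
  "v \<in> words S \<Longrightarrow> w \<in> words S \<Longrightarrow>
    eval_word G h (v @ w) = eval_word G h v \<otimes>\<^bsub>G\<^esub> eval_word G h w"
proof (induction v)
  case Nil
  then show ?case by (simp add: eval_word_closed)
next
  case (Cons a v)
  then show ?case
    by (cases a) (auto simp: eval_word_closed h_closed m_assoc)
qed

lemma eval_word_cong: "word_eq S R v w \<Longrightarrow> eval_word G h v = eval_word G h w"
proof (induction rule: word_eq.induct)
  case (cancel u v x b)
  then have "h x \<in> carrier G" by (simp add: h_closed)
  then have "eval_word G h [(x, b), (x, \<not> b)] = \<one>\<^bsub>G\<^esub>" by simp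
  with cancel show ?case
    by (simp add: eval_word_append eval_word_closed del: eval_word.simps
        flip: append_Cons append.simps)
next
  case (relator u v r)
  then show ?case
    by (simp add: eval_word_append eval_word_closed R)
qed simp_all

lemma presented_hom_class:
  assumes "w \<in> words S"
  shows "presented_hom G h (word_class S R w) = eval_word G h w"
proof -
  have "eval_word G h ` word_class S R w = {eval_word G h w}"
    using eval_word_cong word_eq.refl[OF assms] unfolding word_class_def by force
  then show ?thesis
    by (simp add: presented_hom_def)
qed

lemma presented_hom_hom: "presented_hom G h \<in> hom (presented_group S R) G"
proof (rule homI)
  have car: "carrier (presented_group S R) = word_class S R ` words S"
    by (simp add: presented_group_def)
  show "\<And>x. x \<in> carrier (presented_group S R) \<Longrightarrow> presented_hom G h x \<in> carrier G"
    unfolding car by (auto simp: presented_hom_class eval_word_closed)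
  show "\<And>x y. x \<in> carrier (presented_group S R) \<Longrightarrow> y \<in> carrier (presented_group S R) \<Longrightarrow>
      presented_hom G h (x \<otimes>\<^bsub>presented_group S R\<^esub> y) = presented_hom G h x \<otimes>\<^bsub>G\<^esub> presented_hom G h y"
    unfolding car by (auto simp: presented_hom_class word_class_mult eval_word_append)
qed

end

section \<open>Symmetric groups and braid groups\<close>

text \<open>Products of permutations are read from left to right, whereas the multiplication of
  \<^const>\<open>sym_group\<close> is composition of functions. The list \<open>[x\<^sub>1, \<dots>, x\<^sub>k]\<close> passed
  to \<^const>\<open>cycle_of_list\<close> denotes the cycle \<open>x\<^sub>1 \<mapsto> x\<^sub>2 \<mapsto> \<dots> \<mapsto> x\<^sub>k \<mapsto> x\<^sub>1\<close>.\<close>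

definition symmetric_group :: "nat \<Rightarrow> (nat \<Rightarrow> nat) monoid" where
  "symmetric_group n = (sym_group n)\<lparr>mult := \<lambda>p q. q \<circ> p\<rparr>"

text \<open>The cycle \<open>(1, n, n - 1, \<dots>, 2)\<close>.\<close>

definition long_cycle :: "nat \<Rightarrow> nat \<Rightarrow> nat" where
  "long_cycle n = cycle_of_list (1 # rev [2..<Suc n])"

definition braid_relators :: "nat \<Rightarrow> nat word set" where
  "braid_relators n =
    {commutator_word i j | i j. i \<in> {1..<n} \<and> j \<in> {1..<n} \<and> (i + 1 < j \<or> j + 1 < i)} \<union>
    {[(i, True), (i + 1, True), (i, True)] @
       inverse_word [(i + 1, True), (i, True), (i + 1, True)] | i. i \<in> {1..<n} \<and> i + 1 \<in> {1..<n}}"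

text \<open>The Artin braid group on \<open>n\<close> strings; the generator \<open>i \<in> {1..<n}\<close> is \<open>\<sigma>\<^sub>i\<close>.\<close>

definition braid_group :: "nat \<Rightarrow> nat word set monoid" where
  "braid_group n = presented_group {1..<n} (braid_relators n)"

definition braid_generator :: "nat \<Rightarrow> nat \<Rightarrow> nat word set" where
  "braid_generator n i = word_class {1..<n} (braid_relators n) [(i, True)]"

definition braid_permutation :: "nat \<Rightarrow> nat word set \<Rightarrow> (nat \<Rightarrow> nat)" where
  "braid_permutation n = presented_hom (symmetric_group n) (\<lambda>i. cycle_of_list [i, i + 1])"

lemma group_symmetric_group: "group (symmetric_group n)"
  unfolding symmetric_group_def sym_group_def
  by (rule groupI)
    (auto simp: permutes_compose permutes_id o_assoc intro: permutes_inv permutes_inv_o)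

lemma braid_permutation_wd:
  shows "(\<lambda>i. cycle_of_list [i, i + 1]) \<in> {1..<n} \<rightarrow> carrier (symmetric_group n)"
    and "r \<in> braid_relators n \<Longrightarrow>
      eval_word (symmetric_group n) (\<lambda>i. cycle_of_list [i, i + 1]) r = \<one>\<^bsub>symmetric_group n\<^esub>"
proof -
  let ?t = "\<lambda>i::nat. cycle_of_list [i, i + 1]"
  interpret group "symmetric_group n" by (rule group_symmetric_group)
  show t: "?t \<in> {1..<n} \<rightarrow> carrier (symmetric_group n)"
    by (auto simp: symmetric_group_def sym_group_def intro!: permutes_swap_id)
  have inv: "inv\<^bsub>symmetric_group n\<^esub> (Transposition.transpose i (Suc i)) = Transposition.transpose i (Suc i)"
    if "i \<in> {1..<n}" for i
    using t that by (intro inv_equality) (auto simp: symmetric_group_def sym_group_def)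
  show "eval_word (symmetric_group n) ?t r = \<one>\<^bsub>symmetric_group n\<^esub>" if "r \<in> braid_relators n"
    using that inv
    by (auto simp: braid_relators_def commutator_word_def inverse_word_def)
      (auto simp: symmetric_group_def sym_group_def fun_eq_iff Transposition.transpose_def)
qed

lemma braid_permutation_hom: "braid_permutation n \<in> hom (braid_group n) (symmetric_group n)"
  unfolding braid_permutation_def braid_group_def
  by (rule presented_hom_hom) (use group_symmetric_group braid_permutation_wd in blast)+

lemma braid_permutation_generator:
  assumes "i \<in> {1..<n}"
  shows "braid_permutation n (braid_generator n i) = cycle_of_list [i, i + 1]"
proof -
  have "braid_permutation n (braid_generator n i)
      = eval_word (symmetric_group n) (\<lambda>i. cycle_of_list [i, i + 1]) [(i, True)]"
    unfolding braid_permutation_def braid_generator_def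
    by (rule presented_hom_class)
      (use assms group_symmetric_group braid_permutation_wd in \<open>auto simp del: cycle_of_list.simps\<close>)
  then show ?thesis
    by (simp add: symmetric_group_def sym_group_def)
qed

section \<open>Surfaces\<close>

text \<open>The pieces from which surfaces are assembled are abstract topologies. The surfaces
  themselves are subsets of arbitrary real normed vector spaces, the setting of the library's
  covering space theory; this is no restriction, because every metrizable space embeds
  into a real normed vector space.\<close>

definition quotient_topology :: "'a topology \<Rightarrow> ('a \<Rightarrow> 'b) \<Rightarrow> 'b topology" where
  "quotient_topology X q =
    topology (\<lambda>U. U \<subseteq> q ` topspace X \<and> openin X {x \<in> topspace X. q x \<in> U})"

lemma openin_quotient_topology:
  "openin (quotient_topology X q) U \<longleftrightarrow>
    U \<subseteq> q ` topspace X \<and> openin X {x \<in> topspace X. q x \<in> U}"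
proof -
  have "istopology (\<lambda>U. U \<subseteq> q ` topspace X \<and> openin X {x \<in> topspace X. q x \<in> U})"
    unfolding istopology_def
  proof (intro conjI allI impI)
    fix S T
    assume "S \<subseteq> q ` topspace X \<and> openin X {x \<in> topspace X. q x \<in> S}"
      and "T \<subseteq> q ` topspace X \<and> openin X {x \<in> topspace X. q x \<in> T}"
    moreover have "{x \<in> topspace X. q x \<in> S \<inter> T}
        = {x \<in> topspace X. q x \<in> S} \<inter> {x \<in> topspace X. q x \<in> T}"
      by auto
    ultimately show "S \<inter> T \<subseteq> q ` topspace X" "openin X {x \<in> topspace X. q x \<in> S \<inter> T}"
      by auto
  next
    fix K
    assume K: "\<forall>S\<in>K. S \<subseteq> q ` topspace X \<and> openin X {x \<in> topspace X. q x \<in> S}"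
    then show "\<Union> K \<subseteq> q ` topspace X"
      by auto
    have "{x \<in> topspace X. q x \<in> \<Union> K} = (\<Union>S\<in>K. {x \<in> topspace X. q x \<in> S})"
      by auto
    with K show "openin X {x \<in> topspace X. q x \<in> \<Union> K}"
      by auto
  qed
  then show ?thesis
    by (simp add: quotient_topology_def topology_inverse')
qed

lemma quotient_map_quotient_topology: "quotient_map X (quotient_topology X q) q"
proof -
  have eq: "{x \<in> topspace X. q x \<in> q ` topspace X} = topspace X"
    by auto
  have "topspace (quotient_topology X q) = q ` topspace X"
    unfolding topspace_def[of "quotient_topology X q"] openin_quotient_topology
    using eq openin_topspace[of X] by (auto intro!: exI[of _ "q ` topspace X"])
  then show ?thesis
    by (auto simp: quotient_map_def openin_quotient_topology)
qed

definition torus :: "(complex \<times> complex) topology" where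
  "torus = top_of_set (sphere 0 1 \<times> sphere 0 1)"

definition projective_plane :: "(complex \<times> real) set topology" where
  "projective_plane = quotient_topology (top_of_set (sphere 0 1)) (\<lambda>v. {v, - v})"

text \<open>Parametrised closed discs (the images of the closed unit disc), used for forming
  connected sums; both maps remain embeddings on a larger concentric disc.\<close>

definition torus_disc :: "complex \<Rightarrow> complex \<times> complex" where
  "torus_disc z = (cis (Re z), cis (Im z))"

definition projective_disc :: "complex \<Rightarrow> (complex \<times> real) set" where
  "projective_disc z =
    (let v = (z / 2, sqrt (1 - (cmod z / 2)\<^sup>2)) in {v, - v})"

text \<open>\<open>N\<close> is obtained from \<open>X\<close> and \<open>Y\<close> by removing the interiors of the discs \<open>d\<close> and \<open>e\<close>
  and gluing along the boundary circles via \<open>d z \<sim> e z\<close>. Since the two pieces are embedded as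
  closed sets that cover \<open>N\<close>, the topology of \<open>N\<close> is the quotient topology, so \<open>N\<close> is determined
  up to homeomorphism. For the surfaces used here the sense in which the
  circles are identified is irrelevant: \<open>(u, v) \<mapsto> (u, cnj v)\<close> is a homeomorphism of the torus
  that reflects \<^const>\<open>torus_disc\<close>.\<close>

definition connected_sum ::
  "'a topology \<Rightarrow> (complex \<Rightarrow> 'a) \<Rightarrow> 'b topology \<Rightarrow> (complex \<Rightarrow> 'b) \<Rightarrow> 'c topology \<Rightarrow> bool" where
  "connected_sum X d Y e N \<longleftrightarrow>
    (let X' = topspace X - d ` ball 0 1; Y' = topspace Y - e ` ball 0 1 in
      \<exists>i j. embedding_map (subtopology X X') N i \<and> closedin N (i ` X') \<and>
            embedding_map (subtopology Y Y') N j \<and> closedin N (j ` Y') \<and>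
            i ` X' \<union> j ` Y' = topspace N \<and>
            (\<forall>x\<in>X'. \<forall>y\<in>Y'. i x = j y \<longleftrightarrow> (\<exists>z\<in>sphere 0 1. x = d z \<and> y = e z)))"

datatype surface_generator = Agen nat | Bgen nat | Cgen

section \<open>The fundamental group\<close>

definition path_class :: "'a::topological_space set \<Rightarrow> (real \<Rightarrow> 'a) \<Rightarrow> (real \<Rightarrow> 'a) set" where
  "path_class S \<gamma> = {\<delta>. homotopic_paths S \<gamma> \<delta>}"

definition loops :: "'a::topological_space set \<Rightarrow> 'a \<Rightarrow> (real \<Rightarrow> 'a) set" where
  "loops S x = {\<gamma>. path \<gamma> \<and> path_image \<gamma> \<subseteq> S \<and> pathstart \<gamma> = x \<and> pathfinish \<gamma> = x}"

definition fundamental_group ::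
  "'a::topological_space set \<Rightarrow> 'a \<Rightarrow> (real \<Rightarrow> 'a) set monoid" where
  "fundamental_group S x =
    \<lparr>carrier = path_class S ` loops S x,
     mult = \<lambda>A B. {\<epsilon>. \<exists>\<gamma>\<in>A. \<exists>\<delta>\<in>B. homotopic_paths S (\<gamma> +++ \<delta>) \<epsilon>},
     one = path_class S (\<lambda>_. x)\<rparr>"

definition induced_map ::
  "('a::topological_space \<Rightarrow> 'b::topological_space) \<Rightarrow> 'b set \<Rightarrow> (real \<Rightarrow> 'a) set \<Rightarrow> (real \<Rightarrow> 'b) set"
  where "induced_map f T A = {\<delta>. \<exists>\<gamma>\<in>A. homotopic_paths T (f \<circ> \<gamma>) \<delta>}"

section \<open>Free actions and the Borsuk-Ulam property\<close>

definition free_action ::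
  "('g, 'b) monoid_scheme \<Rightarrow> 'm::topological_space set \<Rightarrow> ('g \<Rightarrow> 'm \<Rightarrow> 'm) \<Rightarrow> bool" where
  "free_action G M \<tau> \<longleftrightarrow>
    group_action G M \<tau> \<and> (\<forall>g\<in>carrier G. continuous_on M (\<tau> g)) \<and>
    (\<forall>g\<in>carrier G. \<forall>x\<in>M. \<tau> g x = x \<longrightarrow> g = \<one>\<^bsub>G\<^esub>)"

text \<open>The natural projection \<open>\<theta>\<^sub>\<tau>\<close> from the fundamental group of the orbit space to \<open>G\<close>: if the
  lift at \<open>m\<close> of a loop representing \<open>\<alpha>\<close> ends at \<open>\<tau> g m\<close>, then \<open>\<alpha>\<close> is sent to \<open>g\<close>.\<close>

definition action_projection ::
  "('g, 'b) monoid_scheme \<Rightarrow> 'm::topological_space set \<Rightarrow> ('g \<Rightarrow> 'm \<Rightarrow> 'm) \<Rightarrow> ('m \<Rightarrow> 'n) \<Rightarrow> 'm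
    \<Rightarrow> (real \<Rightarrow> 'n) set \<Rightarrow> 'g" where
  "action_projection G M \<tau> p m \<alpha> =
    (THE g. g \<in> carrier G \<and>
      (\<exists>\<gamma>. path \<gamma> \<and> path_image \<gamma> \<subseteq> M \<and> pathstart \<gamma> = m \<and> pathfinish \<gamma> = \<tau> g m \<and> p \<circ> \<gamma> \<in> \<alpha>))"

text \<open>\<open>M\<close> and the free action \<open>\<tau>\<close> of \<open>G\<close> on \<open>M\<close> arise from
  \<open>\<theta> : \<pi>\<^sub>1(N, x) \<rightarrow> G\<close>; here \<open>p : M \<rightarrow> N\<close> is the covering map, whose
  fibres are the orbits (so that \<open>N\<close> is the orbit space), and \<open>p m = x\<close>.\<close>

definition arises_from ::
  "'m::topological_space set \<Rightarrow> ('g \<Rightarrow> 'm \<Rightarrow> 'm) \<Rightarrow> ('m \<Rightarrow> 'n::topological_space) \<Rightarrow> 'm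
    \<Rightarrow> 'n set \<Rightarrow> 'n \<Rightarrow> ('g, 'b) monoid_scheme \<Rightarrow> ((real \<Rightarrow> 'n) set \<Rightarrow> 'g) \<Rightarrow> bool" where
  "arises_from M \<tau> p m N x G \<theta> \<longleftrightarrow>
    connected M \<and> covering_space M p N \<and> m \<in> M \<and> p m = x \<and>
    free_action G M \<tau> \<and>
    (\<forall>y\<in>M. \<forall>z\<in>M. p y = p z \<longleftrightarrow> (\<exists>g\<in>carrier G. z = \<tau> g y)) \<and>
    induced_map p N ` carrier (fundamental_group M m) = kernel (fundamental_group N x) G \<theta> \<and>
    (\<forall>\<alpha>\<in>carrier (fundamental_group N x). action_projection G M \<tau> p m \<alpha> = \<theta> \<alpha>)"

definition homotopy_classes ::
  "'m::topological_space set \<Rightarrow> 'y::topological_space set \<Rightarrow> ('m \<Rightarrow> 'y) set set" where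
  "homotopy_classes M Y =
    {{g. homotopic_with_canon (\<lambda>_. True) M Y f g} | f. continuous_on M f \<and> f ` M \<subseteq> Y}"

definition borsuk_ulam_class ::
  "'m set \<Rightarrow> ('g, 'b) monoid_scheme \<Rightarrow> ('g \<Rightarrow> 'm \<Rightarrow> 'm) \<Rightarrow> ('m \<Rightarrow> 'y) set \<Rightarrow> bool" where
  "borsuk_ulam_class M G \<tau> \<beta> \<longleftrightarrow>
    (\<forall>f\<in>\<beta>. \<exists>g\<^sub>1\<in>carrier G. \<exists>g\<^sub>2\<in>carrier G. \<exists>x\<in>M. g\<^sub>1 \<noteq> g\<^sub>2 \<and> f (\<tau> g\<^sub>1 x) = f (\<tau> g\<^sub>2 x))"

definition borsuk_ulam ::
  "'m::topological_space set \<Rightarrow> ('g, 'b) monoid_scheme \<Rightarrow> ('g \<Rightarrow> 'm \<Rightarrow> 'm)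
    \<Rightarrow> 'y::topological_space set \<Rightarrow> bool" where
  "borsuk_ulam M G \<tau> Y \<longleftrightarrow> (\<forall>\<beta>\<in>homotopy_classes M Y. borsuk_ulam_class M G \<tau> \<beta>)"

end

theory Submission
  imports Defs
begin

text \<open>The failure of the Borsuk-Ulam property for a subgroup \<open>K\<close> of a finite group \<open>G\<close> acting freely
  on \<open>M\<close> is witnessed by a map \<open>f\<close> from \<open>M\<close> to the plane that is injective on the \<open>K\<close>-orbits. Let
  \<open>Z\<close> be the space of those labellings of the elements of \<open>G\<close> by complex numbers which are
  injective on every right coset of \<open>K\<close>. The group \<open>G\<close> acts on \<open>Z\<close> by right translation of the
  argument, and if \<open>F\<close> is an equivariant map from \<open>M\<close> to \<open>Z\<close>, then \<open>f y = F y \<one>\<close> has the desired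
  property, since the value of \<open>f\<close> at the translate of \<open>y\<close> by \<open>k\<close> is \<open>F y k\<close>
  (\<open>not_borsuk_ulam_of_orbifold_lift\<close>).

  Equivariant maps are found by obstruction theory in its simplest case. The pairs of an element
  \<open>g\<close> of \<open>G\<close> and a homotopy class of paths in \<open>Z\<close> from a base point \<open>z\<close> to its translate by \<open>g\<close>
  form a group, the orbifold fundamental group, which projects to \<open>G\<close>; a configuration space of
  the plane with its permutations gives a braid group in this way. A homomorphism \<open>\<psi>\<close> from the
  fundamental group of \<open>N = M / G\<close> to this group that covers \<open>\<theta>\<close> is induced by an equivariant map:
  \<open>\<psi>\<close> prescribes the map along the edges of a cell structure of \<open>N\<close>, and the boundary of the
  2-cell is sent to a contractible loop because \<open>\<psi>\<close> is a homomorphism (\<open>equivariant_path_functor\<close>,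
  \<open>equivariant_map_of_square_model\<close>). As \<open>N\<close> is a surface, there are no further cells. The cell
  structure with a single 2-cell is read off from the connected sum: a torus or a projective plane
  without a disc is a cylinder one of whose ends is folded up (\<open>square_model_of_connected_sum\<close>).
  Since \<open>\<psi>\<close> is defined on the whole fundamental group, the generators of the given presentation
  may be unrelated to these edges.

  It remains to choose \<open>\<psi>\<close> on the generators, subject to the relator. A commutator of two
  generators with equal images is trivial. So for (a), with \<open>K = G\<close>, any lifts of the two
  permutations will do, and lifts exist because distinct points in the plane can be permuted by
  moving them. For (c), with \<open>K\<close> generated by the long cycle, one needs in addition a lift of the
  transposition \<open>(1, 2)\<close> whose square is trivial. If the base point \<open>z\<close> is invariant under the
  transposition, the constant path is one. An invariant labelling identifies \<open>h\<close> with
  \<open>h \<otimes> (1, 2)\<close>, and it can still be injective on the cosets of \<open>K\<close> because for \<open>n > 2\<close> no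
  conjugate of \<open>(1, 2)\<close> is a power of the long cycle (\<open>conjugate_transposition_notin_generate\<close>).

  For (b), the relator shows that the image of the generator \<open>c\<close> in a braid group has exponent sum
  \<open>0\<close>, so its permutation is even, but \<open>(1, 2)\<close> is odd.\<close>

section \<open>Paths and their homotopy classes\<close>

definition connects ::
  "'a::topological_space set \<Rightarrow> 'a \<Rightarrow> 'a \<Rightarrow> (real \<Rightarrow> 'a) \<Rightarrow> bool" where
  "connects S a b \<gamma> \<longleftrightarrow>
    path \<gamma> \<and> path_image \<gamma> \<subseteq> S \<and> pathstart \<gamma> = a \<and> pathfinish \<gamma> = b"

lemma connectsI:
  assumes "continuous_on {0..1} \<gamma>" "\<And>t. t \<in> {0..1} \<Longrightarrow> \<gamma> t \<in> S" "\<gamma> 0 = a" "\<gamma> 1 = b"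
  shows "connects S a b \<gamma>"
  using assms by (auto simp: connects_def path_def path_image_def pathstart_def pathfinish_def)

lemma connectsD:
  assumes "connects S a b \<gamma>"
  shows "continuous_on {0..1} \<gamma>" "\<And>t. t \<in> {0..1} \<Longrightarrow> \<gamma> t \<in> S" "\<gamma> 0 = a" "\<gamma> 1 = b"
  using assms by (auto simp: connects_def path_def path_image_def pathstart_def pathfinish_def)

lemma connects_join:
  "connects S a b \<gamma> \<Longrightarrow> connects S b c \<delta> \<Longrightarrow> connects S a c (\<gamma> +++ \<delta>)"
  by (auto simp: connects_def path_image_join)

lemma connects_reverse: "connects S a b \<gamma> \<Longrightarrow> connects S b a (reversepath \<gamma>)"
  by (auto simp: connects_def)

lemma connects_const: "a \<in> S \<Longrightarrow> connects S a a (\<lambda>_. a)"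
  by (auto intro: connectsI)

lemma connects_compose:
  assumes "connects S a b \<gamma>" "continuous_on S f" "f ` S \<subseteq> T"
  shows "connects T (f a) (f b) (f \<circ> \<gamma>)"
  using assms by (auto simp: connects_def pathstart_compose pathfinish_compose path_image_compose
      intro!: path_continuous_image intro: continuous_on_subset)

lemma connects_ends: "connects S a b \<gamma> \<Longrightarrow> a \<in> S \<and> b \<in> S"
  using connectsD(2)[of S a b \<gamma> 0] connectsD(2)[of S a b \<gamma> 1] connectsD(3,4)[of S a b \<gamma>]
  by simp

lemma connects_homotopic:
  "connects S a b \<gamma> \<Longrightarrow> homotopic_paths S \<gamma> \<delta> \<Longrightarrow> connects S a b \<delta>"
  by (metis homotopic_paths_imp_path homotopic_paths_imp_pathfinish homotopic_paths_imp_pathstart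
      homotopic_paths_imp_subset connects_def)

lemma homotopic_refl: "connects S a b \<gamma> \<Longrightarrow> homotopic_paths S \<gamma> \<gamma>"
  by (simp add: connects_def)

lemma homotopic_cong:
  assumes "connects S a b \<gamma>" "\<And>t. t \<in> {0..1} \<Longrightarrow> \<gamma> t = \<delta> t"
  shows "homotopic_paths S \<gamma> \<delta>"
  using assms by (auto simp: connects_def intro: homotopic_paths_eq)

lemma homotopic_join:
  assumes "homotopic_paths S p p'" "homotopic_paths S q q'" "connects S a b p" "connects S b c q"
  shows "homotopic_paths S (p +++ q) (p' +++ q')"
  using assms by (intro homotopic_paths_join) (auto simp: connects_def)

lemma homotopic_assoc:
  assumes "connects S a b p" "connects S b c q" "connects S c d r"
  shows "homotopic_paths S (p +++ (q +++ r)) ((p +++ q) +++ r)"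
  using assms by (intro homotopic_paths_assoc) (auto simp: connects_def)

text \<open>Two paths with common endpoints in a convex set are homotopic, hence so are their images under
  any map. The unit and inverse laws for the concatenation of paths in an arbitrary space are the
  case of the unit interval.\<close>

lemma homotopic_paths_convex_image:
  fixes C :: "'a::real_normed_vector set" and f :: "'a \<Rightarrow> 'b::topological_space"
  assumes "convex C" "continuous_on C f" "f ` C \<subseteq> S" "connects C a b \<gamma>" "connects C a b \<delta>"
  shows "homotopic_paths S (f \<circ> \<gamma>) (f \<circ> \<delta>)"
proof -
  have "closed_segment (\<gamma> t) (\<delta> t) \<subseteq> C" if "t \<in> {0..1}" for t
    using connectsD(2)[OF assms(4) that] connectsD(2)[OF assms(5) that] assms(1)
    by (simp add: closed_segment_subset)
  then have "homotopic_paths C \<gamma> \<delta>"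
    using assms(4,5) by (intro homotopic_paths_linear) (auto simp: connects_def)
  then show ?thesis
    using assms(2,3) by (intro homotopic_paths_continuous_image) auto
qed

lemma connects_identity: "connects {0..1} 0 1 (\<lambda>t::real. t)"
  by (auto intro!: connectsI)

lemma homotopic_reparametrization:
  assumes "connects S a b \<gamma>" "connects {0..1} u v f" "connects {0..1} u v g"
  shows "homotopic_paths S (\<gamma> \<circ> f) (\<gamma> \<circ> g)"
  using connectsD[OF assms(1)] assms(2,3)
  by (intro homotopic_paths_convex_image[where C = "{0..1}"]) auto

lemma homotopic_paths_join_const:
  assumes "connects S a b \<gamma>"
  shows "homotopic_paths S (\<gamma> +++ (\<lambda>_. b)) \<gamma>"
proof -
  have "homotopic_paths S (\<gamma> \<circ> ((\<lambda>t. t) +++ (\<lambda>_. 1))) (\<gamma> \<circ> (\<lambda>t. t))"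
    by (rule homotopic_reparametrization[OF assms connects_join[OF connects_identity connects_const] connects_identity]) auto
  moreover have "\<gamma> \<circ> ((\<lambda>t. t) +++ (\<lambda>_. 1)) = \<gamma> +++ (\<lambda>_. b)"
    using connectsD(4)[OF assms] by (auto simp: joinpaths_def)
  ultimately show ?thesis by (simp add: comp_def)
qed

lemma homotopic_paths_const_join:
  assumes "connects S a b \<gamma>"
  shows "homotopic_paths S ((\<lambda>_. a) +++ \<gamma>) \<gamma>"
proof -
  have "homotopic_paths S (\<gamma> \<circ> ((\<lambda>_. 0) +++ (\<lambda>t. t))) (\<gamma> \<circ> (\<lambda>t. t))"
    by (rule homotopic_reparametrization[OF assms connects_join[OF connects_const connects_identity] connects_identity]) auto
  moreover have "\<gamma> \<circ> ((\<lambda>_. 0) +++ (\<lambda>t. t)) = (\<lambda>_. a) +++ \<gamma>"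
    using connectsD(3)[OF assms] by (auto simp: joinpaths_def)
  ultimately show ?thesis by (simp add: comp_def)
qed

lemma homotopic_paths_join_reverse:
  assumes "connects S a b \<gamma>"
  shows "homotopic_paths S (\<gamma> +++ reversepath \<gamma>) (\<lambda>_. a)"
proof -
  have "homotopic_paths S (\<gamma> \<circ> ((\<lambda>t. t) +++ reversepath (\<lambda>t. t))) (\<gamma> \<circ> (\<lambda>_. 0))"
    by (rule homotopic_reparametrization[OF assms])
      (auto intro: connects_join connects_identity connects_reverse connects_const)
  moreover have "\<gamma> \<circ> ((\<lambda>t. t) +++ reversepath (\<lambda>t. t)) = \<gamma> +++ reversepath \<gamma>"
    by (auto simp: joinpaths_def reversepath_def)
  moreover have "\<gamma> \<circ> (\<lambda>_::real. 0) = (\<lambda>_. a)"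
    using connectsD(3)[OF assms] by (simp add: comp_def)
  ultimately show ?thesis by simp
qed

lemma homotopic_paths_reverse_join:
  assumes "connects S a b \<gamma>"
  shows "homotopic_paths S (reversepath \<gamma> +++ \<gamma>) (\<lambda>_. b)"
  using homotopic_paths_join_reverse[OF connects_reverse[OF assms]] by simp

lemma homotopic_paths_insert_cancel:
  assumes "connects S a b p" "connects S c b q" "connects S b d r"
  shows "homotopic_paths S ((p +++ reversepath q) +++ (q +++ r)) (p +++ r)"
proof -
  note b = assms connects_reverse[OF assms(2)] connects_join
  have c: "connects S b b (\<lambda>_. b)"
    using assms connects_ends connects_const by metis
  have "homotopic_paths S ((p +++ reversepath q) +++ (q +++ r)) (p +++ (reversepath q +++ (q +++ r)))"
    by (rule homotopic_paths_sym, rule homotopic_assoc) (use b in blast)+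
  also have "homotopic_paths S \<dots> (p +++ ((reversepath q +++ q) +++ r))"
    by (rule homotopic_join[OF homotopic_refl homotopic_assoc])
      (use b in blast)+
  also have "homotopic_paths S \<dots> (p +++ ((\<lambda>_. b) +++ r))"
    by (rule homotopic_join[OF homotopic_refl
          homotopic_join[OF homotopic_paths_reverse_join homotopic_refl]])
      (use b in blast)+
  also have "homotopic_paths S \<dots> (p +++ r)"
    by (rule homotopic_join[OF homotopic_refl homotopic_paths_const_join])
      (use b c in blast)+
  finally show ?thesis .
qed

lemma path_class_eq_iff:
  assumes "connects S a b \<gamma>"
  shows "path_class S \<gamma> = path_class S \<delta> \<longleftrightarrow> homotopic_paths S \<gamma> \<delta>"
proof
  assume "path_class S \<gamma> = path_class S \<delta>"
  moreover have "\<gamma> \<in> path_class S \<gamma>"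
    using assms by (simp add: path_class_def connects_def)
  ultimately show "homotopic_paths S \<gamma> \<delta>"
    by (simp add: path_class_def homotopic_paths_sym)
next
  assume "homotopic_paths S \<gamma> \<delta>"
  then show "path_class S \<gamma> = path_class S \<delta>"
    by (auto simp: path_class_def intro: homotopic_paths_trans homotopic_paths_sym)
qed

lemma fundamental_group_carrier:
  "carrier (fundamental_group S x) = path_class S ` {\<gamma>. connects S x x \<gamma>}"
  by (simp add: fundamental_group_def loops_def connects_def)

lemma fundamental_group_mult:
  assumes "connects S x x \<gamma>" "connects S x x \<delta>"
  shows "path_class S \<gamma> \<otimes>\<^bsub>fundamental_group S x\<^esub> path_class S \<delta> = path_class S (\<gamma> +++ \<delta>)"
proof -
  have "homotopic_paths S (\<gamma> +++ \<delta>) \<epsilon>"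
    if "homotopic_paths S \<gamma> \<gamma>'" "homotopic_paths S \<delta> \<delta>'" "homotopic_paths S (\<gamma>' +++ \<delta>') \<epsilon>" for \<gamma>' \<delta>' \<epsilon>
    using homotopic_join[OF that(1,2) assms] that(3) by (rule homotopic_paths_trans)
  moreover have "homotopic_paths S \<gamma> \<gamma>" "homotopic_paths S \<delta> \<delta>"
    using assms by (auto simp: connects_def)
  ultimately have "(\<exists>\<gamma>'\<in>path_class S \<gamma>. \<exists>\<delta>'\<in>path_class S \<delta>. homotopic_paths S (\<gamma>' +++ \<delta>') \<epsilon>)
      \<longleftrightarrow> homotopic_paths S (\<gamma> +++ \<delta>) \<epsilon>" for \<epsilon>
    unfolding path_class_def by blast
  then show ?thesis
    by (simp add: fundamental_group_def path_class_def[of S "\<gamma> +++ \<delta>"])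
qed

section \<open>The orbifold fundamental group of a group action\<close>

locale topological_action = group G for G (structure) +
  fixes Z :: "'z::topological_space set" and act :: "'a \<Rightarrow> 'z \<Rightarrow> 'z"
  assumes act_continuous: "g \<in> carrier G \<Longrightarrow> continuous_on Z (act g)"
    and act_closed: "g \<in> carrier G \<Longrightarrow> z \<in> Z \<Longrightarrow> act g z \<in> Z"
    and act_one: "z \<in> Z \<Longrightarrow> act \<one> z = z"
    and act_mult: "g \<in> carrier G \<Longrightarrow> h \<in> carrier G \<Longrightarrow> z \<in> Z \<Longrightarrow> act (g \<otimes> h) z = act g (act h z)"
begin

lemma act_path:
  "g \<in> carrier G \<Longrightarrow> connects Z a b \<gamma> \<Longrightarrow> connects Z (act g a) (act g b) (act g \<circ> \<gamma>)"
  by (rule connects_compose) (auto simp: act_continuous act_closed)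

lemma act_homotopic:
  "g \<in> carrier G \<Longrightarrow> homotopic_paths Z \<gamma> \<delta> \<Longrightarrow> homotopic_paths Z (act g \<circ> \<gamma>) (act g \<circ> \<delta>)"
  by (rule homotopic_paths_continuous_image) (auto simp: act_continuous act_closed)

lemma act_inv: "g \<in> carrier G \<Longrightarrow> z \<in> Z \<Longrightarrow> act (inv g) (act g z) = z"
  by (metis act_mult act_one inv_closed l_inv)

lemma act_inv': "g \<in> carrier G \<Longrightarrow> z \<in> Z \<Longrightarrow> act g (act (inv g) z) = z"
  by (metis act_mult act_one inv_closed r_inv)

text \<open>For a connected space \<open>Z\<close> with a universal covering, this is the group of all lifts of the
  elements of \<open>G\<close> to the universal covering, described by paths: an element over \<open>g\<close> is a homotopy
  class of paths from the base point \<open>z\<close> to its translate by \<open>g\<close>, and the second factor of a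
  product has to be translated before the paths can be joined. For the symmetric group acting on
  the ordered configurations of points in the plane it is the braid group.\<close>

definition orbifold_group :: "'z \<Rightarrow> ('a \<times> (real \<Rightarrow> 'z) set) monoid" where
  "orbifold_group z =
    \<lparr>carrier = {(g, path_class Z \<gamma>) | g \<gamma>. g \<in> carrier G \<and> connects Z z (act g z) \<gamma>},
     mult = \<lambda>(g, A) (h, B). (g \<otimes> h, {\<epsilon>. \<exists>\<gamma>\<in>A. \<exists>\<delta>\<in>B. homotopic_paths Z (\<gamma> +++ (act g \<circ> \<delta>)) \<epsilon>}),
     one = (\<one>, path_class Z (\<lambda>_. z))\<rparr>"

lemma orbifold_group_mem:
  "g \<in> carrier G \<Longrightarrow> connects Z z (act g z) \<gamma> \<Longrightarrow> (g, path_class Z \<gamma>) \<in> carrier (orbifold_group z)"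
  by (auto simp: orbifold_group_def)

lemma orbifold_group_cases:
  assumes "a \<in> carrier (orbifold_group z)"
  obtains g \<gamma> where "a = (g, path_class Z \<gamma>)" "g \<in> carrier G" "connects Z z (act g z) \<gamma>"
  using assms by (auto simp: orbifold_group_def)

lemma orbifold_group_one: "\<one>\<^bsub>orbifold_group z\<^esub> = (\<one>, path_class Z (\<lambda>_. z))"
  by (simp add: orbifold_group_def)

lemma twisted_join:
  assumes "z \<in> Z" "g \<in> carrier G" "h \<in> carrier G"
    and "connects Z z (act g z) \<gamma>" "connects Z z (act h z) \<delta>"
  shows "connects Z z (act (g \<otimes> h) z) (\<gamma> +++ (act g \<circ> \<delta>))"
  using connects_join[OF assms(4) act_path[OF assms(2,5)]] assms(1-3) by (simp add: act_mult)

lemma orbifold_group_mult: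
  assumes "g \<in> carrier G" "h \<in> carrier G"
    and "connects Z z (act g z) \<gamma>" "connects Z z (act h z) \<delta>"
  shows "(g, path_class Z \<gamma>) \<otimes>\<^bsub>orbifold_group z\<^esub> (h, path_class Z \<delta>)
    = (g \<otimes> h, path_class Z (\<gamma> +++ (act g \<circ> \<delta>)))"
proof -
  have "homotopic_paths Z (\<gamma> +++ (act g \<circ> \<delta>)) \<epsilon>"
    if "homotopic_paths Z \<gamma> \<gamma>'" "homotopic_paths Z \<delta> \<delta>'"
      "homotopic_paths Z (\<gamma>' +++ (act g \<circ> \<delta>')) \<epsilon>" for \<gamma>' \<delta>' \<epsilon>
    using homotopic_join[OF that(1) act_homotopic[OF assms(1) that(2)] assms(3)
        act_path[OF assms(1,4)]] that(3)
    by (rule homotopic_paths_trans)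
  moreover have "homotopic_paths Z \<gamma> \<gamma>" "homotopic_paths Z \<delta> \<delta>"
    using assms by (auto simp: connects_def)
  ultimately have "(\<exists>\<gamma>'\<in>path_class Z \<gamma>. \<exists>\<delta>'\<in>path_class Z \<delta>. homotopic_paths Z (\<gamma>' +++ (act g \<circ> \<delta>')) \<epsilon>)
      \<longleftrightarrow> homotopic_paths Z (\<gamma> +++ (act g \<circ> \<delta>)) \<epsilon>" for \<epsilon>
    unfolding path_class_def by blast
  then show ?thesis
    by (simp add: orbifold_group_def path_class_def[of Z "\<gamma> +++ (act g \<circ> \<delta>)"])
qed

lemma orbifold_group_eqI:
  assumes "homotopic_paths Z \<gamma> \<delta>" "g = h"
  shows "(g, path_class Z \<gamma>) = (h, path_class Z \<delta>)"
  using assms path_class_eq_iff[of Z "pathstart \<gamma>" "pathfinish \<gamma>" \<gamma> \<delta>] homotopic_paths_imp_path[OF assms(1)]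
    homotopic_paths_imp_subset[OF assms(1)]
  by (auto simp: connects_def)

lemma group_orbifold_group:
  assumes z: "z \<in> Z"
  shows "group (orbifold_group z)"
proof (rule groupI)
  let ?\<Gamma> = "orbifold_group z"
  have c: "connects Z z (act \<one> z) (\<lambda>_. z)"
    using z by (auto simp: act_one intro: connects_const)
  show "\<one>\<^bsub>?\<Gamma>\<^esub> \<in> carrier ?\<Gamma>"
    unfolding orbifold_group_one by (rule orbifold_group_mem[OF one_closed c])
  show "a \<otimes>\<^bsub>?\<Gamma>\<^esub> b \<in> carrier ?\<Gamma>" if ab: "a \<in> carrier ?\<Gamma>" "b \<in> carrier ?\<Gamma>" for a b
    using ab by (auto elim!: orbifold_group_cases simp: orbifold_group_mult
        intro!: orbifold_group_mem twisted_join z)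
  show "a \<otimes>\<^bsub>?\<Gamma>\<^esub> b \<otimes>\<^bsub>?\<Gamma>\<^esub> d = a \<otimes>\<^bsub>?\<Gamma>\<^esub> (b \<otimes>\<^bsub>?\<Gamma>\<^esub> d)"
    if abd: "a \<in> carrier ?\<Gamma>" "b \<in> carrier ?\<Gamma>" "d \<in> carrier ?\<Gamma>" for a b d
  proof -
    obtain g \<gamma> where a: "a = (g, path_class Z \<gamma>)" "g \<in> carrier G" "connects Z z (act g z) \<gamma>"
      using abd(1) by (rule orbifold_group_cases)
    obtain h \<delta> where b: "b = (h, path_class Z \<delta>)" "h \<in> carrier G" "connects Z z (act h z) \<delta>"
      using abd(2) by (rule orbifold_group_cases)
    obtain k \<epsilon> where d: "d = (k, path_class Z \<epsilon>)" "k \<in> carrier G" "connects Z z (act k z) \<epsilon>"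
      using abd(3) by (rule orbifold_group_cases)
    have gd: "connects Z (act g z) (act (g \<otimes> h) z) (act g \<circ> \<delta>)"
      using act_path[OF a(2) b(3)] a b z by (simp add: act_mult)
    have ghe: "connects Z (act (g \<otimes> h) z) (act (g \<otimes> h \<otimes> k) z) (act (g \<otimes> h) \<circ> \<epsilon>)"
      using act_path[OF _ d(3), of "g \<otimes> h"] a b d z by (simp add: act_mult m_closed)
    have eq: "act (g \<otimes> h) (\<epsilon> t) = act g (act h (\<epsilon> t))" if "t \<in> {0..1}" for t
      using connectsD(2)[OF d(3) that] a b by (simp add: act_mult)
    have "homotopic_paths Z ((\<gamma> +++ (act g \<circ> \<delta>)) +++ (act (g \<otimes> h) \<circ> \<epsilon>))
        (\<gamma> +++ ((act g \<circ> \<delta>) +++ (act (g \<otimes> h) \<circ> \<epsilon>)))"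
      by (rule homotopic_paths_sym, rule homotopic_assoc[OF a(3) gd ghe])
    also have "homotopic_paths Z \<dots> (\<gamma> +++ (act g \<circ> (\<delta> +++ (act h \<circ> \<epsilon>))))"
      using connects_join[OF a(3) connects_join[OF gd ghe]] eq
      by (intro homotopic_cong) (auto simp: joinpaths_def)
    finally have *: "homotopic_paths Z ((\<gamma> +++ (act g \<circ> \<delta>)) +++ (act (g \<otimes> h) \<circ> \<epsilon>))
        (\<gamma> +++ (act g \<circ> (\<delta> +++ (act h \<circ> \<epsilon>))))" .
    show ?thesis
      using a b d z twisted_join orbifold_group_eqI[OF *] by (simp add: orbifold_group_mult m_assoc)
  qed
  show "\<one>\<^bsub>?\<Gamma>\<^esub> \<otimes>\<^bsub>?\<Gamma>\<^esub> a = a" if a: "a \<in> carrier ?\<Gamma>" for a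
  proof -
    obtain g \<gamma> where a: "a = (g, path_class Z \<gamma>)" "g \<in> carrier G" "connects Z z (act g z) \<gamma>"
      using a by (rule orbifold_group_cases)
    have "homotopic_paths Z ((\<lambda>_. z) +++ (act \<one> \<circ> \<gamma>)) ((\<lambda>_. z) +++ \<gamma>)"
      using connects_join[OF c act_path[OF one_closed a(3)]]
        connectsD(2)[OF a(3)] z
      by (intro homotopic_cong) (auto simp: joinpaths_def act_one)
    also have "homotopic_paths Z \<dots> \<gamma>"
      by (rule homotopic_paths_const_join[OF a(3)])
    finally have *: "homotopic_paths Z ((\<lambda>_. z) +++ (act \<one> \<circ> \<gamma>)) \<gamma>" .
    show ?thesis
      using a c orbifold_group_eqI[OF *] by (simp add: orbifold_group_one orbifold_group_mult)
  qed
  show "\<exists>b\<in>carrier ?\<Gamma>. b \<otimes>\<^bsub>?\<Gamma>\<^esub> a = \<one>\<^bsub>?\<Gamma>\<^esub>" if a: "a \<in> carrier ?\<Gamma>" for a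
  proof -
    obtain g \<gamma> where a: "a = (g, path_class Z \<gamma>)" "g \<in> carrier G" "connects Z z (act g z) \<gamma>"
      using a by (rule orbifold_group_cases)
    have i: "connects Z (act (inv g) z) z (act (inv g) \<circ> \<gamma>)"
      using act_path[OF _ a(3), of "inv g"] a z by (simp add: act_inv)
    have *: "homotopic_paths Z (reversepath (act (inv g) \<circ> \<gamma>) +++ (act (inv g) \<circ> \<gamma>)) (\<lambda>_. z)"
      by (rule homotopic_paths_reverse_join[OF i])
    then have "(inv g, path_class Z (reversepath (act (inv g) \<circ> \<gamma>))) \<otimes>\<^bsub>?\<Gamma>\<^esub> a = \<one>\<^bsub>?\<Gamma>\<^esub>"
      using a connects_reverse[OF i] orbifold_group_eqI[OF *]
      by (simp add: orbifold_group_one orbifold_group_mult)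
    then show ?thesis
      using orbifold_group_mem[OF _ connects_reverse[OF i]] a(2) by blast
  qed
qed

lemma fst_orbifold_group_hom: "fst \<in> hom (orbifold_group z) G"
  by (rule homI) (auto elim!: orbifold_group_cases simp: orbifold_group_mult)

end

section \<open>Homomorphisms out of a group given by a presentation\<close>

lemma presented_group_generator:
  "x \<in> S \<Longrightarrow> word_class S R [(x, b)] \<in> carrier (presented_group S R)"
  by (auto simp: presented_group_def)

lemma hom_presented_group_eval:
  assumes f: "f \<in> hom (presented_group S R) K" and K: "group K" and w: "w \<in> words S"
  shows "f (word_class S R w) = eval_word K (\<lambda>x. f (word_class S R [(x, True)])) w"
  using w
proof (induction w)
  interpret group_hom "presented_group S R" K f
    using f K group_presented_group by (simp add: group_hom_def group_hom_axioms_def)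
  case Nil
  show ?case
    using hom_one by (simp add: presented_group_def)
next
  interpret group_hom "presented_group S R" K f
    using f K group_presented_group by (simp add: group_hom_def group_hom_axioms_def)
  case (Cons a w)
  obtain x b where a: "a = (x, b)" by force
  have x: "x \<in> S" and w: "w \<in> words S"
    using Cons.prems a by auto
  have "word_eq S R ([] @ [(x, False), (x, \<not> False)] @ []) ([] @ [])"
    using x by (intro word_eq.cancel) auto
  then have "word_class S R [(x, False), (x, True)] = word_class S R []"
    using word_class_eq by fastforce
  then have "word_class S R [(x, False)] \<otimes>\<^bsub>presented_group S R\<^esub> word_class S R [(x, True)]
      = \<one>\<^bsub>presented_group S R\<^esub>"
    using x by (simp add: word_class_mult) (simp add: presented_group_def)
  then have "word_class S R [(x, False)] = inv\<^bsub>presented_group S R\<^esub> word_class S R [(x, True)]"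
    using x by (simp add: G.inv_equality presented_group_generator)
  then have "f (word_class S R [(x, b)])
      = (if b then f (word_class S R [(x, True)]) else inv\<^bsub>K\<^esub> f (word_class S R [(x, True)]))"
    using x by (simp add: presented_group_generator hom_inv)
  moreover have "f (word_class S R (a # w)) = f (word_class S R [(x, b)]) \<otimes>\<^bsub>K\<^esub> f (word_class S R w)"
  proof -
    have "word_class S R w \<in> carrier (presented_group S R)"
      using w by (auto simp: presented_group_def)
    moreover have "word_class S R (a # w)
        = word_class S R [(x, b)] \<otimes>\<^bsub>presented_group S R\<^esub> word_class S R w"
      using x w a by (simp add: word_class_mult)
    ultimately show ?thesis
      using x by (simp add: presented_group_generator)
  qed
  ultimately show ?case
    using Cons.IH[OF w] a by simp
qed

lemma eval_word_cong_generators: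
  assumes "w \<in> words S" "\<And>x. x \<in> S \<Longrightarrow> h x = k x"
  shows "eval_word K h w = eval_word K k w"
  using assms by (induction w) (auto simp: split: prod.splits)

lemma presents_generator:
  assumes "presents S R P e" "x \<in> S"
  shows "e x \<in> carrier P"
proof -
  obtain \<phi> where \<phi>: "\<phi> \<in> iso (presented_group S R) P" "\<phi> (word_class S R [(x, True)]) = e x"
    using assms by (auto simp: presents_def)
  then have "\<phi> \<in> carrier (presented_group S R) \<rightarrow> carrier P"
    by (simp add: iso_def hom_def)
  then show ?thesis
    using \<phi>(2) presented_group_generator[OF assms(2)] by (metis funcset_mem)
qed

lemma hom_presents_eval:
  assumes "presents S R P e" "f \<in> hom P K" "group K"
  obtains \<phi> where "\<phi> \<in> iso (presented_group S R) P"
    "\<And>w. w \<in> words S \<Longrightarrow> f (\<phi> (word_class S R w)) = eval_word K (\<lambda>x. f (e x)) w"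
proof -
  obtain \<phi> where \<phi>: "\<phi> \<in> iso (presented_group S R) P" "\<And>x. x \<in> S \<Longrightarrow> \<phi> (word_class S R [(x, True)]) = e x"
    using assms(1) by (auto simp: presents_def)
  have "f \<circ> \<phi> \<in> hom (presented_group S R) K"
    using \<phi>(1) assms(2) by (auto simp: iso_def intro: hom_compose)
  then have "f (\<phi> (word_class S R w)) = eval_word K (\<lambda>x. (f \<circ> \<phi>) (word_class S R [(x, True)])) w"
    if "w \<in> words S" for w
    using hom_presented_group_eval[OF _ assms(3) that] by force
  moreover have "eval_word K (\<lambda>x. (f \<circ> \<phi>) (word_class S R [(x, True)])) w = eval_word K (\<lambda>x. f (e x)) w"
    if "w \<in> words S" for w
    using that by (rule eval_word_cong_generators) (simp add: \<phi>(2))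
  ultimately show ?thesis
    using that[OF \<phi>(1)] by simp
qed

lemma presents_relator:
  assumes "presents S R P e" "f \<in> hom P K" "group K" "r \<in> R" "r \<in> words S"
  shows "eval_word K (\<lambda>x. f (e x)) r = \<one>\<^bsub>K\<^esub>"
proof -
  obtain \<phi> where \<phi>: "\<And>w. w \<in> words S \<Longrightarrow> f (\<phi> (word_class S R w)) = eval_word K (\<lambda>x. f (e x)) w"
    using hom_presents_eval[OF assms(1-3)] by metis
  have "word_eq S R ([] @ r @ []) ([] @ [])"
    using assms(4,5) by (intro word_eq.relator) auto
  then have "word_class S R r = word_class S R []"
    using word_class_eq by force
  then show ?thesis
    using \<phi>[OF assms(5)] \<phi>[of "[]"] by simp
qed

lemma presents_hom_unique:
  assumes "presents S R P e" "f \<in> hom P K" "f' \<in> hom P K" "group K"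
    and "\<And>x. x \<in> S \<Longrightarrow> f (e x) = f' (e x)" and "a \<in> carrier P"
  shows "f a = f' a"
proof -
  obtain \<phi> where \<phi>: "\<phi> \<in> iso (presented_group S R) P" "\<And>x. x \<in> S \<Longrightarrow> \<phi> (word_class S R [(x, True)]) = e x"
    using assms(1) by (auto simp: presents_def)
  have "a \<in> \<phi> ` word_class S R ` words S"
    using \<phi>(1) assms(6) by (auto simp: iso_def bij_betw_def presented_group_def)
  then obtain w where w: "w \<in> words S" "a = \<phi> (word_class S R w)"
    by blast
  have ho: "f \<circ> \<phi> \<in> hom (presented_group S R) K" "f' \<circ> \<phi> \<in> hom (presented_group S R) K"
    using \<phi>(1) assms(2,3) by (auto simp: iso_def intro: hom_compose)
  have "eval_word K (\<lambda>x. (f \<circ> \<phi>) (word_class S R [(x, True)])) w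
      = eval_word K (\<lambda>x. (f' \<circ> \<phi>) (word_class S R [(x, True)])) w"
    using w(1) by (rule eval_word_cong_generators) (simp add: \<phi>(2) assms(5))
  then show ?thesis
    using hom_presented_group_eval[OF ho(1) assms(4) w(1)] hom_presented_group_eval[OF ho(2) assms(4) w(1)]
      w(2) by simp
qed

lemma presents_hom_exists:
  assumes "presents S R P e" "group K" "h \<in> S \<rightarrow> carrier K" "\<And>r. r \<in> R \<Longrightarrow> eval_word K h r = \<one>\<^bsub>K\<^esub>"
  obtains f where "f \<in> hom P K" "\<And>x. x \<in> S \<Longrightarrow> f (e x) = h x"
proof -
  obtain \<phi> where \<phi>: "\<phi> \<in> iso (presented_group S R) P" "\<And>x. x \<in> S \<Longrightarrow> \<phi> (word_class S R [(x, True)]) = e x"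
    using assms(1) by (auto simp: presents_def)
  let ?i = "inv_into (carrier (presented_group S R)) \<phi>"
  have "?i \<in> hom P (presented_group S R)"
    using group.iso_set_sym[OF group_presented_group \<phi>(1)] by (simp add: iso_def)
  then have hom: "presented_hom K h \<circ> ?i \<in> hom P K"
    using presented_hom_hom[OF assms(2-4)] by (blast intro: hom_compose)
  moreover have "(presented_hom K h \<circ> ?i) (e x) = h x" if "x \<in> S" for x
  proof -
    have "?i (e x) = word_class S R [(x, True)]"
      using \<phi> presented_group_generator[OF that, of R True] that
      by (metis (no_types, lifting) bij_betw_inv_into_left iso_def mem_Collect_eq)
    moreover have "h x \<in> carrier K"
      using that assms(3) by auto
    ultimately show ?thesis
      using presented_hom_class[OF assms(2-4), where w = "[(x, True)]"] that group.is_monoid[OF assms(2)]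
      by (simp add: monoid.r_one)
  qed
  ultimately show ?thesis
    by (rule that)
qed

section \<open>Transporting paths along a homomorphism of orbifold groups\<close>

locale covering_action = group G for G (structure) +
  fixes M :: "'m::real_normed_vector set" and \<tau> :: "'a \<Rightarrow> 'm \<Rightarrow> 'm" and p :: "'m \<Rightarrow> 'n::real_normed_vector"
    and m :: 'm and N :: "'n set" and x :: 'n and \<theta> :: "(real \<Rightarrow> 'n) set \<Rightarrow> 'a"
  assumes arises: "arises_from M \<tau> p m N x G \<theta>"
    and \<theta>_hom: "\<theta> \<in> hom (fundamental_group N x) G"
begin

lemma covering: "covering_space M p N" and base: "m \<in> M" "p m = x"
  and free: "free_action G M \<tau>"
  and fibres: "y \<in> M \<Longrightarrow> z \<in> M \<Longrightarrow> p y = p z \<longleftrightarrow> (\<exists>g\<in>carrier G. z = \<tau> g y)"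
  and projection: "\<alpha> \<in> carrier (fundamental_group N x) \<Longrightarrow> action_projection G M \<tau> p m \<alpha> = \<theta> \<alpha>"
  using arises by (simp_all add: arises_from_def)

lemma p_continuous: "continuous_on M p" and p_image: "p ` M = N"
  using covering by (simp_all add: covering_space_imp_continuous covering_space_imp_surjective)

lemma group_action: "group_action G M \<tau>"
  using free by (simp add: free_action_def)

sublocale M: topological_action G M \<tau>
proof
  show "\<tau> \<one> y = y" if "y \<in> M" for y
    using group_action.id_eq_one[OF group_action] that by (metis restrict_apply')
  show "continuous_on M (\<tau> g)" if "g \<in> carrier G" for g
    using free that by (simp add: free_action_def)
  show "\<tau> g y \<in> M" if "g \<in> carrier G" "y \<in> M" for g y
    using group_action.element_image[OF group_action that] by simp
  show "\<tau> (g \<otimes> h) y = \<tau> g (\<tau> h y)" if "g \<in> carrier G" "h \<in> carrier G" "y \<in> M" for g h y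
    by (rule group_action.composition_rule[OF group_action that(3,1,2)])
qed

lemma free_eq:
  assumes "g \<in> carrier G" "h \<in> carrier G" "y \<in> M" "\<tau> g y = \<tau> h y"
  shows "g = h"
proof -
  have "\<tau> (inv g \<otimes> h) y = y"
    using assms by (metis M.act_inv M.act_mult inv_closed)
  then have "inv g \<otimes> h = \<one>"
    using assms free by (auto simp: free_action_def)
  then show ?thesis
    using assms by (metis inv_closed inv_equality inv_inv)
qed

lemma p_invariant: "g \<in> carrier G \<Longrightarrow> y \<in> M \<Longrightarrow> p (\<tau> g y) = p y"
  using fibres[of y "\<tau> g y"] M.act_closed by auto

lemma p_path: "connects M a b \<gamma> \<Longrightarrow> connects N (p a) (p b) (p \<circ> \<gamma>)"
  using connects_compose[OF _ p_continuous] p_image by blast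

lemma lift_path:
  assumes "connects N (p a) c \<gamma>" "a \<in> M"
  obtains \<delta> b where "connects M a b \<delta>" "p b = c" "\<And>t. t \<in> {0..1} \<Longrightarrow> p (\<delta> t) = \<gamma> t"
proof -
  obtain \<delta> where \<delta>: "path \<delta>" "path_image \<delta> \<subseteq> M" "pathstart \<delta> = a" "\<And>t. t \<in> {0..1} \<Longrightarrow> p (\<delta> t) = \<gamma> t"
    using covering_space_lift_path_strong[OF covering assms(2), of \<gamma>] assms(1)
    by (auto simp: connects_def)
  show ?thesis
    using that[of "pathfinish \<delta>" \<delta>] \<delta> connectsD(4)[OF assms(1)]
    by (auto simp: connects_def pathfinish_def)
qed

text \<open>Both paths lift the same path in \<open>N\<close>, so they differ by the deck transformation that moves one
  starting point to the other.\<close>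

lemma translate_of_path:
  assumes "connects M a b \<gamma>" "connects M c d \<delta>" "\<And>t. t \<in> {0..1} \<Longrightarrow> p (\<gamma> t) = p (\<delta> t)"
  obtains g where "g \<in> carrier G" "\<And>t. t \<in> {0..1} \<Longrightarrow> \<delta> t = \<tau> g (\<gamma> t)"
proof -
  note \<gamma> = connectsD[OF assms(1)] and \<delta> = connectsD[OF assms(2)]
  have "p a = p c"
    using assms(3)[of 0] \<gamma>(3) \<delta>(3) by simp
  then obtain g where g: "g \<in> carrier G" "c = \<tau> g a"
    using fibres[of a c] connects_ends[OF assms(1)] connects_ends[OF assms(2)] by auto
  have g\<gamma>: "connects M (\<tau> g a) (\<tau> g b) (\<tau> g \<circ> \<gamma>)"
    by (rule M.act_path[OF g(1) assms(1)])
  have "\<delta> t = (\<tau> g \<circ> \<gamma>) t" if t: "t \<in> {0..1}" for t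
  proof (rule covering_space_lift_unique[OF covering, of \<delta> 0 "\<tau> g \<circ> \<gamma>" "{0..1}" "p \<circ> \<gamma>"])
    show "\<delta> 0 = (\<tau> g \<circ> \<gamma>) 0"
      using \<delta>(3) \<gamma>(3) g(2) by simp
    show "continuous_on {0..1} (p \<circ> \<gamma>)"
      using connectsD(1)[OF p_path[OF assms(1)]] .
    show "p \<circ> \<gamma> \<in> {0..1} \<rightarrow> N"
      using connectsD(2)[OF p_path[OF assms(1)]] by auto
    show "continuous_on {0..1} (\<tau> g \<circ> \<gamma>)"
      using connectsD(1)[OF g\<gamma>] .
  qed (use \<gamma> \<delta> assms(3) g(1) connectsD(2)[OF g\<gamma>] t in \<open>auto simp: p_invariant\<close>)
  with that[OF g(1)] show ?thesis
    by simp
qed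

text \<open>Lifts of homotopic loops end at the same point and the action is free, so the choice of a loop
  in its class and of its lift does not affect the natural projection.\<close>

lemma theta_path:
  assumes g: "g \<in> carrier G" and \<gamma>: "connects M m (\<tau> g m) \<gamma>"
  shows "\<theta> (path_class N (p \<circ> \<gamma>)) = g"
proof -
  have p\<gamma>: "connects N x x (p \<circ> \<gamma>)"
    using p_path[OF \<gamma>] g base by (simp add: p_invariant)
  then have "\<theta> (path_class N (p \<circ> \<gamma>)) = action_projection G M \<tau> p m (path_class N (p \<circ> \<gamma>))"
    by (subst projection) (auto simp: fundamental_group_carrier)
  also have "\<dots> = g"
    unfolding action_projection_def
  proof (rule the_equality, goal_cases)
    case 1
    have "p \<circ> \<gamma> \<in> path_class N (p \<circ> \<gamma>)"
      using p\<gamma> by (simp add: path_class_def connects_def)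
    then show ?case
      using g \<gamma> by (auto simp: connects_def)
  next
    case (2 h)
    then obtain \<delta> where \<delta>: "connects M m (\<tau> h m) \<delta>" "homotopic_paths N (p \<circ> \<gamma>) (p \<circ> \<delta>)" and h: "h \<in> carrier G"
      by (auto simp: connects_def path_class_def)
    have "pathfinish \<gamma> = pathfinish \<delta>"
      by (rule covering_space_monodromy[OF covering _ _ _ _ \<delta>(2)])
        (use \<gamma> \<delta>(1) p_path[OF \<gamma>] p_path[OF \<delta>(1)] in \<open>auto simp: connects_def\<close>)
    then show ?case
      using \<gamma> \<delta>(1) free_eq[OF g h base(1)] by (simp add: connects_def)
  qed
  finally show ?thesis .
qed

end

text \<open>\<open>H\<close> and \<open>\<Psi>\<close> form a functor of fundamental groupoids compatible with the actions, in which every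
  homotopy class of paths in \<open>M\<close> has been given one actual path in \<open>Z\<close>. Concatenation is respected
  up to homotopy only, but equivariance is an equality of functions: this is what allows the paths
  chosen along two edges that are identified in \<open>N\<close> to be used as the values of one map on \<open>M\<close>.
  The function \<open>H\<close> chooses the end points of these paths and is in general not continuous.\<close>

locale equivariant_path_functor = covering_action G M \<tau> p m N x \<theta> + topological_action G Z act
  for G (structure) and M :: "'m::real_normed_vector set" and \<tau> :: "'a \<Rightarrow> 'm \<Rightarrow> 'm"
    and p :: "'m \<Rightarrow> 'n::real_normed_vector" and m N x \<theta>
    and Z :: "'z::topological_space set" and act :: "'a \<Rightarrow> 'z \<Rightarrow> 'z" +
  fixes H :: "'m \<Rightarrow> 'z" and \<Psi> :: "(real \<Rightarrow> 'm) \<Rightarrow> real \<Rightarrow> 'z"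
  assumes H_equivariant: "g \<in> carrier G \<Longrightarrow> y \<in> M \<Longrightarrow> H (\<tau> g y) = act g (H y)"
    and \<Psi>_path: "connects M a b \<gamma> \<Longrightarrow> connects Z (H a) (H b) (\<Psi> \<gamma>)"
    and \<Psi>_homotopic: "homotopic_paths M \<gamma> \<delta> \<Longrightarrow> \<Psi> \<gamma> = \<Psi> \<delta>"
    and \<Psi>_join: "connects M a b \<gamma> \<Longrightarrow> connects M b c \<delta> \<Longrightarrow>
      homotopic_paths Z (\<Psi> (\<gamma> +++ \<delta>)) (\<Psi> \<gamma> +++ \<Psi> \<delta>)"
    and \<Psi>_equivariant: "g \<in> carrier G \<Longrightarrow> connects M a b \<gamma> \<Longrightarrow> t \<in> {0..1} \<Longrightarrow>
      \<Psi> (\<lambda>s. \<tau> g (\<gamma> s)) t = act g (\<Psi> \<gamma> t)"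

text \<open>A homomorphism \<open>\<psi>\<close> that covers \<open>\<theta>\<close> extends to a functor as above. Each point of \<open>N\<close> is joined to
  the base point by a path, lifted to a path \<open>tail\<close> in \<open>M\<close> that starts at \<open>m\<close>. The end points of
  the tails represent the orbits, a point of \<open>M\<close> is determined by its orbit and by its \<open>offset\<close> in
  \<open>G\<close>, and a path in \<open>M\<close> becomes a loop in \<open>N\<close>, to which \<open>\<psi>\<close> applies.\<close>

locale orbifold_hom = covering_action G M \<tau> p m N x \<theta> + topological_action G Z act
  for G (structure) and M :: "'m::real_normed_vector set" and \<tau> :: "'a \<Rightarrow> 'm \<Rightarrow> 'm"
    and p :: "'m \<Rightarrow> 'n::real_normed_vector" and m N x \<theta>
    and Z :: "'z::topological_space set" and act :: "'a \<Rightarrow> 'z \<Rightarrow> 'z" +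
  fixes z :: 'z and \<psi>
  assumes z: "z \<in> Z"
    and \<psi>_hom: "\<psi> \<in> hom (fundamental_group N x) (orbifold_group z)"
    and \<psi>_over: "\<alpha> \<in> carrier (fundamental_group N x) \<Longrightarrow> fst (\<psi> \<alpha>) = \<theta> \<alpha>"
    and connected: "path_connected N"
begin

definition tail :: "'n \<Rightarrow> real \<Rightarrow> 'm" where
  "tail y = (SOME \<gamma>. \<exists>b. connects M m b \<gamma> \<and> p b = y)"

definition tip :: "'n \<Rightarrow> 'm" where
  "tip y = pathfinish (tail y)"

definition offset :: "'m \<Rightarrow> 'a" where
  "offset y = (THE g. g \<in> carrier G \<and> y = \<tau> g (tip (p y)))"

definition loop_of :: "(real \<Rightarrow> 'm) \<Rightarrow> real \<Rightarrow> 'n" where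
  "loop_of \<gamma> = (p \<circ> tail (p (\<gamma> 0))) +++ ((p \<circ> \<gamma>) +++ reversepath (p \<circ> tail (p (\<gamma> 1))))"

definition transport :: "(real \<Rightarrow> 'm) \<Rightarrow> real \<Rightarrow> 'z" where
  "transport \<gamma> t =
    act (offset (\<gamma> 0)) ((SOME \<delta>. \<delta> \<in> snd (\<psi> (path_class N (loop_of \<gamma>)))) t)"

lemma tail:
  assumes "y \<in> N"
  shows "connects M m (tip y) (tail y)" "p (tip y) = y"
proof -
  have "x \<in> N"
    using base p_image by auto
  then obtain \<gamma> where "connects N (p m) y \<gamma>"
    using connected assms base unfolding path_connected_def connects_def by blast
  then obtain \<delta> b where "connects M m b \<delta>" "p b = y"
    using base by (metis lift_path)
  then have "\<exists>b. connects M m b (tail y) \<and> p b = y"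
    unfolding tail_def by (intro someI_ex[of "\<lambda>\<gamma>. \<exists>b. connects M m b \<gamma> \<and> p b = y"]) blast
  then show "connects M m (tip y) (tail y)" "p (tip y) = y"
    by (auto simp: connects_def tip_def)
qed

lemma offset:
  assumes "y \<in> M"
  shows "offset y \<in> carrier G" "y = \<tau> (offset y) (tip (p y))"
proof -
  have N: "p y \<in> N"
    using assms p_image by auto
  have t: "tip (p y) \<in> M"
    using tail(1)[OF N] connects_ends by blast
  then obtain g where g: "g \<in> carrier G" "y = \<tau> g (tip (p y))"
    using fibres[of "tip (p y)" y] tail(2)[OF N] assms by auto
  then have "\<exists>!g. g \<in> carrier G \<and> y = \<tau> g (tip (p y))"
    using free_eq[OF _ _ t] by metis
  from theI'[OF this] show "offset y \<in> carrier G" "y = \<tau> (offset y) (tip (p y))"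
    by (auto simp: offset_def)
qed

lemma offset_translate:
  assumes "g \<in> carrier G" "y \<in> M"
  shows "offset (\<tau> g y) = g \<otimes> offset y"
proof (rule free_eq)
  have N: "p y \<in> N"
    using assms p_image by auto
  show t: "tip (p y) \<in> M"
    using tail(1)[OF N] connects_ends by blast
  show "\<tau> (offset (\<tau> g y)) (tip (p y)) = \<tau> (g \<otimes> offset y) (tip (p y))"
    using offset[OF M.act_closed[OF assms]] offset[OF assms(2)] assms t
    by (simp add: p_invariant M.act_mult)
qed (use assms offset M.act_closed in auto)

lemma loop_of:
  assumes "connects M a b \<gamma>"
  shows "connects N x x (loop_of \<gamma>)"
proof -
  have ab: "a \<in> M" "b \<in> M" "\<gamma> 0 = a" "\<gamma> 1 = b"
    using connects_ends[OF assms] connectsD[OF assms] by auto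
  then have "p a \<in> N" "p b \<in> N"
    using p_image by auto
  note t = p_path[OF tail(1)[OF this(1)]] p_path[OF tail(1)[OF this(2)]]
    and e = tail(2)[OF this(1)] tail(2)[OF this(2)]
  show ?thesis
    unfolding loop_of_def ab
    using connects_join[OF t(1) connects_join[OF _ connects_reverse[OF t(2)]]]
      p_path[OF assms] e base by simp
qed

text \<open>The loop lifts to the path in \<open>M\<close> that runs along the first tail, along a translate of \<open>\<gamma>\<close>, and
  back along a translate of the second tail.\<close>

lemma theta_loop_of:
  assumes "connects M a b \<gamma>"
  shows "\<theta> (path_class N (loop_of \<gamma>)) = inv (offset a) \<otimes> offset b"
proof -
  have ab: "a \<in> M" "b \<in> M" "\<gamma> 0 = a" "\<gamma> 1 = b"
    using connects_ends[OF assms] connectsD[OF assms] by auto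
  then have N: "p a \<in> N" "p b \<in> N"
    using p_image by auto
  let ?g = "inv (offset a)" and ?h = "inv (offset a) \<otimes> offset b"
  have g: "?g \<in> carrier G" "?h \<in> carrier G"
    using offset(1) ab by auto
  have tips: "tip (p a) \<in> M" "tip (p b) \<in> M"
    using tail(1) N connects_ends by blast+
  have ga: "\<tau> ?g a = tip (p a)" and gb: "\<tau> ?g b = \<tau> ?h (tip (p b))"
    using offset[OF ab(1)] offset[OF ab(2)] g tips by (metis M.act_inv, metis M.act_mult inv_closed)
  have g\<gamma>: "connects M (tip (p a)) (\<tau> ?h (tip (p b))) (\<tau> ?g \<circ> \<gamma>)"
    using M.act_path[OF g(1) assms] ga gb by simp
  have ht: "connects M (\<tau> ?h m) (\<tau> ?h (tip (p b))) (\<tau> ?h \<circ> tail (p b))"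
    using M.act_path[OF g(2) tail(1)[OF N(2)]] .
  let ?L = "tail (p a) +++ ((\<tau> ?g \<circ> \<gamma>) +++ reversepath (\<tau> ?h \<circ> tail (p b)))"
  have L: "connects M m (\<tau> ?h m) ?L"
    by (rule connects_join[OF tail(1)[OF N(1)] connects_join[OF g\<gamma> connects_reverse[OF ht]]])
  have "p (?L t) = loop_of \<gamma> t" if "t \<in> {0..1}" for t
    using that connectsD(2)[OF assms] connectsD(2)[OF tail(1)[OF N(2)]] g ab
    by (auto simp: loop_of_def joinpaths_def reversepath_def p_invariant)
  then have "homotopic_paths N (p \<circ> ?L) (loop_of \<gamma>)"
    using p_path[OF L] by (intro homotopic_cong) auto
  then have "path_class N (loop_of \<gamma>) = path_class N (p \<circ> ?L)"
    using path_class_eq_iff[OF p_path[OF L]] by blast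
  then show ?thesis
    using theta_path[OF g(2) L] by simp
qed

lemma loop_of_class:
  assumes "homotopic_paths M \<gamma> \<delta>" "connects M a b \<gamma>"
  shows "path_class N (loop_of \<gamma>) = path_class N (loop_of \<delta>)"
proof -
  have d: "connects M a b \<delta>"
    using connects_homotopic assms by blast
  have e: "\<gamma> 0 = a" "\<gamma> 1 = b" "\<delta> 0 = a" "\<delta> 1 = b" "p a \<in> N" "p b \<in> N"
    using connectsD[OF assms(2)] connectsD[OF d] connects_ends[OF d] p_image by auto
  have pp: "homotopic_paths N (p \<circ> \<gamma>) (p \<circ> \<delta>)"
    using assms(1) by (rule homotopic_paths_continuous_image) (use p_continuous p_image in auto)
  note t = p_path[OF tail(1)[OF e(5)]] p_path[OF tail(1)[OF e(6)]]
  have "homotopic_paths N (loop_of \<gamma>) (loop_of \<delta>)"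
    unfolding loop_of_def e
    using t p_path[OF assms(2)] pp tail(2) e
    by (intro homotopic_join[OF homotopic_refl
        homotopic_join[OF _ homotopic_refl]])
      (auto intro!: connects_join connects_reverse)
  then show ?thesis
    using path_class_eq_iff[OF loop_of[OF assms(2)]] by blast
qed

lemma loop_of_join:
  assumes "connects M a b \<gamma>" "connects M b c \<delta>"
  shows "path_class N (loop_of (\<gamma> +++ \<delta>))
    = path_class N (loop_of \<gamma>) \<otimes>\<^bsub>fundamental_group N x\<^esub> path_class N (loop_of \<delta>)"
proof -
  note j = connects_join[OF assms]
  have e: "\<gamma> 0 = a" "\<gamma> 1 = b" "\<delta> 0 = b" "\<delta> 1 = c" "(\<gamma> +++ \<delta>) 0 = a" "(\<gamma> +++ \<delta>) 1 = c"
    "p a \<in> N" "p b \<in> N" "p c \<in> N"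
    using connectsD[OF assms(1)] connectsD[OF assms(2)] connectsD[OF j]
      connects_ends[OF assms(1)] connects_ends[OF assms(2)] p_image by auto
  have A: "connects N x (p a) (p \<circ> tail (p a))" and B: "connects N x (p b) (p \<circ> tail (p b))"
    and C: "connects N x (p c) (p \<circ> tail (p c))"
    using p_path[OF tail(1)[OF e(7)]] p_path[OF tail(1)[OF e(8)]] p_path[OF tail(1)[OF e(9)]]
      tail(2) e base by simp_all
  note g = p_path[OF assms(1)] and d = p_path[OF assms(2)]
  let ?A = "p \<circ> tail (p a)" and ?B = "p \<circ> tail (p b)" and ?C = "p \<circ> tail (p c)"
  let ?g = "p \<circ> \<gamma>" and ?d = "p \<circ> \<delta>"
  have dC: "connects N (p b) x (?d +++ reversepath ?C)"
    by (rule connects_join[OF d connects_reverse[OF C]])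
  have "homotopic_paths N ((?A +++ (?g +++ reversepath ?B)) +++ (?B +++ (?d +++ reversepath ?C)))
      (((?A +++ ?g) +++ reversepath ?B) +++ (?B +++ (?d +++ reversepath ?C)))"
    by (rule homotopic_join[OF homotopic_assoc[OF A g connects_reverse[OF B]]
          homotopic_refl[OF connects_join[OF B dC]]
          connects_join[OF A connects_join[OF g connects_reverse[OF B]]]
          connects_join[OF B dC]])
  also have "homotopic_paths N \<dots> ((?A +++ ?g) +++ (?d +++ reversepath ?C))"
    by (rule homotopic_paths_insert_cancel[OF connects_join[OF A g] B dC])
  also have "homotopic_paths N \<dots> (?A +++ (?g +++ (?d +++ reversepath ?C)))"
    by (rule homotopic_paths_sym[OF homotopic_assoc[OF A g dC]])
  also have "homotopic_paths N \<dots> (?A +++ ((?g +++ ?d) +++ reversepath ?C))"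
    by (rule homotopic_join[OF homotopic_refl[OF A]
          homotopic_assoc[OF g d connects_reverse[OF C]] A connects_join[OF g dC]])
  finally have "homotopic_paths N (loop_of \<gamma> +++ loop_of \<delta>) (loop_of (\<gamma> +++ \<delta>))"
    by (simp add: loop_of_def e path_compose_join)
  then have "path_class N (loop_of \<gamma> +++ loop_of \<delta>) = path_class N (loop_of (\<gamma> +++ \<delta>))"
    using path_class_eq_iff[OF connects_join[OF loop_of[OF assms(1)] loop_of[OF assms(2)]]] by blast
  then show ?thesis
    using loop_of assms by (simp add: fundamental_group_mult)
qed

lemma transported_representative:
  assumes "connects M a b \<gamma>"
  obtains \<delta> where "connects Z z (act (inv (offset a) \<otimes> offset b) z) \<delta>"
    "\<psi> (path_class N (loop_of \<gamma>)) = (inv (offset a) \<otimes> offset b, path_class Z \<delta>)"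
    "\<delta> = (SOME \<delta>. \<delta> \<in> snd (\<psi> (path_class N (loop_of \<gamma>))))"
    "transport \<gamma> = act (offset a) \<circ> \<delta>"
proof -
  let ?\<alpha> = "path_class N (loop_of \<gamma>)"
  have \<alpha>: "?\<alpha> \<in> carrier (fundamental_group N x)"
    using loop_of[OF assms] by (auto simp: fundamental_group_carrier)
  then have "\<psi> ?\<alpha> \<in> carrier (orbifold_group z)"
    using \<psi>_hom by (auto simp: hom_def)
  then obtain g \<epsilon> where \<epsilon>: "\<psi> ?\<alpha> = (g, path_class Z \<epsilon>)" "connects Z z (act g z) \<epsilon>"
    by (rule orbifold_group_cases)
  have g: "g = inv (offset a) \<otimes> offset b"
    using \<psi>_over[OF \<alpha>] theta_loop_of[OF assms] \<epsilon>(1) by simp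
  define \<delta> where "\<delta> = (SOME \<delta>. \<delta> \<in> path_class Z \<epsilon>)"
  have "\<epsilon> \<in> path_class Z \<epsilon>"
    using \<epsilon>(2) by (simp add: path_class_def connects_def)
  then have "\<delta> \<in> path_class Z \<epsilon>"
    unfolding \<delta>_def by (rule someI[of "\<lambda>\<delta>. \<delta> \<in> path_class Z \<epsilon>"])
  then have h: "homotopic_paths Z \<epsilon> \<delta>"
    by (simp add: path_class_def)
  show ?thesis
  proof (rule that[of \<delta>])
    show "connects Z z (act (inv (offset a) \<otimes> offset b) z) \<delta>"
      using connects_homotopic[OF \<epsilon>(2) h] g by simp
    show "\<psi> ?\<alpha> = (inv (offset a) \<otimes> offset b, path_class Z \<delta>)"
      using \<epsilon>(1) g path_class_eq_iff[OF \<epsilon>(2)] h by simp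
    show "\<delta> = (SOME \<delta>. \<delta> \<in> snd (\<psi> ?\<alpha>))"
      by (simp add: \<epsilon>(1) \<delta>_def)
    show "transport \<gamma> = act (offset a) \<circ> \<delta>"
      using connectsD(3)[OF assms] by (auto simp: transport_def \<epsilon>(1) \<delta>_def)
  qed
qed

text \<open>Equivariance is an equality because \<open>\<gamma>\<close> and its translates project to the same path in \<open>N\<close>, so
  that the same representing path is chosen for all of them and is only translated.\<close>

lemma equivariant_path_functor:
  "equivariant_path_functor G M \<tau> p m N x \<theta> Z act (\<lambda>y. act (offset y) z) transport"
proof
  have finish: "act (offset a) (act (inv (offset a) \<otimes> offset b) u) = act (offset b) u"
    if "a \<in> M" "b \<in> M" "u \<in> Z" for a b u
    using that offset(1) act_inv' act_mult act_closed by (metis inv_closed)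
  show "act (offset (\<tau> g y)) z = act g (act (offset y) z)" if "g \<in> carrier G" "y \<in> M" for g y
    using that z offset(1) by (simp add: offset_translate act_mult)
  show "connects Z (act (offset a) z) (act (offset b) z) (transport \<gamma>)"
    if \<gamma>: "connects M a b \<gamma>" for a b \<gamma>
  proof -
    have ab: "a \<in> M" "b \<in> M"
      using connects_ends[OF \<gamma>] by auto
    obtain \<delta> where "connects Z z (act (inv (offset a) \<otimes> offset b) z) \<delta>"
        "transport \<gamma> = act (offset a) \<circ> \<delta>"
      using transported_representative[OF \<gamma>] by metis
    then show ?thesis
      using act_path[OF offset(1)[OF ab(1)]] finish[OF ab z] by metis
  qed
  note transport = this
  show "transport \<gamma> = transport \<delta>"
    if \<gamma>\<delta>: "homotopic_paths M \<gamma> \<delta>" for \<gamma> \<delta>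
  proof -
    define a b where "a = \<gamma> 0" and "b = \<gamma> 1"
    have \<gamma>: "connects M a b \<gamma>"
      using \<gamma>\<delta> homotopic_paths_imp_path[OF \<gamma>\<delta>] homotopic_paths_imp_subset[OF \<gamma>\<delta>]
      by (auto simp: connects_def pathstart_def pathfinish_def a_def b_def)
    show ?thesis
      using loop_of_class[OF \<gamma>\<delta> \<gamma>] connectsD(3)[OF \<gamma>]
        connectsD(3)[OF connects_homotopic[OF \<gamma> \<gamma>\<delta>]]
      by (auto simp: transport_def)
  qed
  show "homotopic_paths Z (transport (\<gamma> +++ \<delta>)) (transport \<gamma> +++ transport \<delta>)"
    if \<gamma>: "connects M a b \<gamma>" and \<delta>: "connects M b c \<delta>" for a b c \<gamma> \<delta>
  proof -
    have abc: "a \<in> M" "b \<in> M" "c \<in> M"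
      using connects_ends[OF \<gamma>] connects_ends[OF \<delta>] by auto
    note o = offset(1)[OF abc(1)] offset(1)[OF abc(2)] offset(1)[OF abc(3)]
    obtain \<gamma>' where \<gamma>': "connects Z z (act (inv (offset a) \<otimes> offset b) z) \<gamma>'"
        "\<psi> (path_class N (loop_of \<gamma>)) = (inv (offset a) \<otimes> offset b, path_class Z \<gamma>')"
        "transport \<gamma> = act (offset a) \<circ> \<gamma>'"
      using transported_representative[OF \<gamma>] by metis
    obtain \<delta>' where \<delta>': "connects Z z (act (inv (offset b) \<otimes> offset c) z) \<delta>'"
        "\<psi> (path_class N (loop_of \<delta>)) = (inv (offset b) \<otimes> offset c, path_class Z \<delta>')"
        "transport \<delta> = act (offset b) \<circ> \<delta>'"
      using transported_representative[OF \<delta>] by metis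
    obtain \<epsilon> where \<epsilon>: "connects Z z (act (inv (offset a) \<otimes> offset c) z) \<epsilon>"
        "\<psi> (path_class N (loop_of (\<gamma> +++ \<delta>))) = (inv (offset a) \<otimes> offset c, path_class Z \<epsilon>)"
        "transport (\<gamma> +++ \<delta>) = act (offset a) \<circ> \<epsilon>"
      using transported_representative[OF connects_join[OF \<gamma> \<delta>]] by metis
    let ?g = "inv (offset a) \<otimes> offset b" and ?h = "inv (offset b) \<otimes> offset c"
    have gh: "?g \<in> carrier G" "?h \<in> carrier G"
      using o by auto
    have "path_class N (loop_of \<gamma>) \<in> carrier (fundamental_group N x)"
      "path_class N (loop_of \<delta>) \<in> carrier (fundamental_group N x)"
      using loop_of \<gamma> \<delta> by (auto simp: fundamental_group_carrier)
    then have "\<psi> (path_class N (loop_of (\<gamma> +++ \<delta>)))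
        = (?g, path_class Z \<gamma>') \<otimes>\<^bsub>orbifold_group z\<^esub> (?h, path_class Z \<delta>')"
      using \<psi>_hom \<gamma>'(2) \<delta>'(2) by (simp add: loop_of_join[OF \<gamma> \<delta>] hom_mult)
    then have "path_class Z \<epsilon> = path_class Z (\<gamma>' +++ (act ?g \<circ> \<delta>'))"
      using \<epsilon>(2) gh \<gamma>'(1) \<delta>'(1) by (simp add: orbifold_group_mult)
    then have "homotopic_paths Z \<epsilon> (\<gamma>' +++ (act ?g \<circ> \<delta>'))"
      using path_class_eq_iff[OF \<epsilon>(1)] by blast
    from act_homotopic[OF o(1) this]
    have "homotopic_paths Z (transport (\<gamma> +++ \<delta>)) (act (offset a) \<circ> (\<gamma>' +++ (act ?g \<circ> \<delta>')))"
      by (simp add: \<epsilon>(3))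
    also have "homotopic_paths Z \<dots> (transport \<gamma> +++ transport \<delta>)"
    proof (rule homotopic_paths_sym, rule homotopic_cong)
      show "connects Z (act (offset a) z) (act (offset c) z) (transport \<gamma> +++ transport \<delta>)"
        by (rule connects_join[OF transport[OF \<gamma>] transport[OF \<delta>]])
      show "(transport \<gamma> +++ transport \<delta>) t
          = (act (offset a) \<circ> (\<gamma>' +++ (act ?g \<circ> \<delta>'))) t" if "t \<in> {0..1}" for t
        using that finish[OF abc(1,2)] connectsD(2)[OF \<delta>'(1)]
        by (auto simp: joinpaths_def \<gamma>'(3) \<delta>'(3))
    qed
    finally show ?thesis .
  qed
  show "transport (\<lambda>s. \<tau> g (\<gamma> s)) t = act g (transport \<gamma> t)"
    if g: "g \<in> carrier G" and \<gamma>: "connects M a b \<gamma>" and t: "t \<in> {0..1}" for g a b \<gamma> t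
  proof -
    have ab: "a \<in> M" "b \<in> M" "\<gamma> 0 = a" "\<gamma> 1 = b"
      using connects_ends[OF \<gamma>] connectsD[OF \<gamma>] by auto
    have g\<gamma>: "connects M (\<tau> g a) (\<tau> g b) (\<lambda>s. \<tau> g (\<gamma> s))"
      using M.act_path[OF g \<gamma>] by (simp add: comp_def)
    have "homotopic_paths N (loop_of (\<lambda>s. \<tau> g (\<gamma> s))) (loop_of \<gamma>)"
      using loop_of[OF g\<gamma>] connectsD(2)[OF \<gamma>] g
      by (intro homotopic_cong) (auto simp: loop_of_def joinpaths_def reversepath_def p_invariant)
    then have "path_class N (loop_of (\<lambda>s. \<tau> g (\<gamma> s))) = path_class N (loop_of \<gamma>)"
      using path_class_eq_iff[OF loop_of[OF g\<gamma>]] by blast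
    moreover obtain \<delta> where "connects Z z (act (inv (offset a) \<otimes> offset b) z) \<delta>"
        "\<delta> = (SOME \<delta>. \<delta> \<in> snd (\<psi> (path_class N (loop_of \<gamma>))))"
      using transported_representative[OF \<gamma>] by metis
    then have "(SOME \<delta>. \<delta> \<in> snd (\<psi> (path_class N (loop_of \<gamma>)))) t \<in> Z"
      using connectsD(2) t by blast
    ultimately show ?thesis
      using g ab(1,3) offset(1)[OF ab(1)]
      by (simp add: transport_def offset_translate act_mult)
  qed
qed

end

section \<open>Extending a map over a square\<close>

text \<open>A continuous map from a compact space onto a Hausdorff space is a quotient map. This is the way
  in which maps are defined on glued spaces below.\<close>

lemma continuous_on_image_of_compact:
  fixes \<kappa> :: "'a::topological_space \<Rightarrow> 'b::t2_space" and f :: "'a \<Rightarrow> 'c::topological_space"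
  assumes "compact K" "continuous_on K \<kappa>" "continuous_on K f" and g: "\<And>u. u \<in> K \<Longrightarrow> g (\<kappa> u) = f u"
  shows "continuous_on (\<kappa> ` K) g"
  unfolding continuous_on_closed_invariant
proof (intro allI impI)
  fix B :: "'c set"
  assume "closed B"
  then obtain A where A: "closed A" "A \<inter> K = f -` B \<inter> K"
    using assms(3) unfolding continuous_on_closed_invariant by blast
  have "compact (A \<inter> K)"
    using A(1) assms(1) by (rule closed_Int_compact)
  then have "closed (\<kappa> ` (A \<inter> K))"
    by (intro compact_imp_closed compact_continuous_image continuous_on_subset[OF assms(2)]) auto
  moreover have "\<kappa> ` (A \<inter> K) \<inter> \<kappa> ` K = g -` B \<inter> \<kappa> ` K"
    using A(2) g by auto
  ultimately show "\<exists>A. closed A \<and> A \<inter> \<kappa> ` K = g -` B \<inter> \<kappa> ` K"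
    by blast
qed

abbreviation unit_square :: "(real \<times> real) set" where
  "unit_square \<equiv> {0..1} \<times> {0..1}"

text \<open>A homotopy of paths with fixed ends lives on a square with coordinates \<open>(u, s)\<close> whose sides
  \<open>s = 0\<close> and \<open>s = 1\<close> are sent to points. Collapsing these two sides to the corners \<open>(0, 0)\<close> and
  \<open>(1, 1)\<close> gives a square again: level \<open>s\<close> becomes the segment on which the coordinates add up to
  \<open>2 * s\<close>, and the sides \<open>u = 0\<close> and \<open>u = 1\<close> become the two ways around the boundary from one
  corner to the other.\<close>

definition collapse :: "real \<times> real \<Rightarrow> real \<times> real" where
  "collapse = (\<lambda>(u, s). if s \<le> 1/2 then (2 * s * u, 2 * s * (1 - u))
    else (1 - 2 * (1 - s) * (1 - u), 1 - 2 * (1 - s) * u))"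

lemma collapse_continuous: "continuous_on unit_square collapse"
proof -
  have "continuous_on unit_square (\<lambda>v::real \<times> real. if snd v \<le> 1/2 then (2 * snd v * fst v, 2 * snd v * (1 - fst v))
    else (1 - 2 * (1 - snd v) * (1 - fst v), 1 - 2 * (1 - snd v) * fst v))"
  proof (rule continuous_on_cases_le)
    fix v :: "real \<times> real"
    assume v: "snd v = 1/2"
    show "(2 * snd v * fst v, 2 * snd v * (1 - fst v))
        = (1 - 2 * (1 - snd v) * (1 - fst v), 1 - 2 * (1 - snd v) * fst v)"
      unfolding v by simp
  qed (auto intro!: continuous_intros)
  then show ?thesis
    by (simp add: collapse_def case_prod_beta)
qed

lemma collapse_image: "collapse ` unit_square = unit_square"
proof
  have "2 * s * u \<le> 1" if "0 \<le> s" "s \<le> 1/2" "0 \<le> u" "u \<le> 1" for s u :: real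
    using mult_mono[of "2 * s" 1 u 1] that by simp
  note b = this
  have "collapse (u, s) \<in> unit_square" if us: "0 \<le> u" "u \<le> 1" "0 \<le> s" "s \<le> 1" for u s
  proof (cases "s \<le> 1/2")
    case True
    then show ?thesis
      using us b[of s u] b[of s "1 - u"] by (simp add: collapse_def)
  next
    case False
    then show ?thesis
      using us b[of "1 - s" u] b[of "1 - s" "1 - u"] by (simp add: collapse_def)
  qed
  then show "collapse ` unit_square \<subseteq> unit_square"
    unfolding image_subset_iff by (simp del: mem_Times_iff split: prod.split)
  show "unit_square \<subseteq> collapse ` unit_square"
  proof (clarify)
    fix x y :: real
    assume xy: "x \<in> {0..1}" "y \<in> {0..1}"
    show "(x, y) \<in> collapse ` unit_square"
    proof (cases "x + y \<le> 1")
      case True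
      have "collapse (x / (x + y), (x + y) / 2) = (x, y)" if "x + y \<noteq> 0"
        using True that by (simp add: collapse_def field_simps)
      moreover have "collapse (0, 0) = (x, y)" if "x + y = 0"
        using that xy by (simp add: collapse_def)
      moreover have "(0, 0) \<in> unit_square" "(x / (x + y), (x + y) / 2) \<in> unit_square"
        using True xy by (auto simp: divide_simps)
      ultimately show ?thesis
        by (metis imageI)
    next
      case False
      have "collapse ((1 - y) / (2 - x - y), (x + y) / 2) = (x, y)" if "2 - x - y \<noteq> 0"
        using False that by (simp add: collapse_def field_simps)
      moreover have "collapse (0, 1) = (x, y)" if "2 - x - y = 0"
        using that xy by (simp add: collapse_def)
      moreover have "(0, 1) \<in> unit_square" "((1 - y) / (2 - x - y), (x + y) / 2) \<in> unit_square"
        using False xy by (auto simp: divide_simps)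
      ultimately show ?thesis
        by (metis imageI)
    qed
  qed
qed

lemma collapse_eqD:
  assumes "collapse (u, s) = collapse (u', s')" "(u, s) \<in> unit_square" "(u', s') \<in> unit_square"
  shows "s = s'" "s = 0 \<or> s = 1 \<or> u = u'"
proof -
  have "fst (collapse (u, s)) + snd (collapse (u, s)) = 2 * s" for u s
    by (simp add: collapse_def algebra_simps)
  from this[of u s] this[of u' s'] show s: "s = s'"
    using assms(1) by simp
  show "s = 0 \<or> s = 1 \<or> u = u'"
    using assms(1) s by (auto simp: collapse_def split: if_splits)
qed

lemma square_filling:
  assumes l: "connects Z a c l" and t: "connects Z c d t"
    and b: "connects Z a e b" and r: "connects Z e d r"
    and hom: "homotopic_paths Z (l +++ t) (b +++ r)"
  obtains h where "continuous_on unit_square h" "h ` unit_square \<subseteq> Z"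
    "\<And>y. y \<in> {0..1} \<Longrightarrow> h (0, y) = l y" "\<And>y. y \<in> {0..1} \<Longrightarrow> h (1, y) = r y"
    "\<And>x. x \<in> {0..1} \<Longrightarrow> h (x, 0) = b x" "\<And>x. x \<in> {0..1} \<Longrightarrow> h (x, 1) = t x"
proof -
  obtain k where k: "continuous_on unit_square k" "k \<in> unit_square \<rightarrow> Z"
      "\<And>s. s \<in> {0..1} \<Longrightarrow> k (0, s) = (l +++ t) s" "\<And>s. s \<in> {0..1} \<Longrightarrow> k (1, s) = (b +++ r) s"
      "\<And>u. u \<in> {0..1} \<Longrightarrow> k (u, 0) = pathstart (l +++ t)" "\<And>u. u \<in> {0..1} \<Longrightarrow> k (u, 1) = pathfinish (l +++ t)"
    using hom unfolding homotopic_paths by (auto simp: pathstart_def pathfinish_def)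
  define h where "h v = k (SOME w. w \<in> unit_square \<and> collapse w = v)" for v
  have h: "h (collapse w) = k w" if w: "w \<in> unit_square" for w
  proof -
    obtain w' where w': "w' \<in> unit_square" "collapse w' = collapse w" "h (collapse w) = k w'"
      using someI[of "\<lambda>w'. w' \<in> unit_square \<and> collapse w' = collapse w" w] w
      by (auto simp: h_def)
    obtain u s u' s' where us: "w = (u, s)" "w' = (u', s')"
      by (cases w, cases w')
    have "k w' = k w"
      using collapse_eqD[of u' s' u s] w w' k(5,6) us by auto
    then show ?thesis
      using w'(3) by simp
  qed
  show ?thesis
  proof (rule that[of h])
    show "continuous_on unit_square h"
      using continuous_on_image_of_compact[OF _ collapse_continuous k(1) h]
      by (simp add: collapse_image compact_Times)
    show "h ` unit_square \<subseteq> Z"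
    proof
      fix z assume "z \<in> h ` unit_square"
      then obtain w where "w \<in> unit_square" "z = h (collapse w)"
        using collapse_image by (metis (no_types, lifting) imageE)
      then show "z \<in> Z"
        using h k(2) by auto
    qed
    note e = connectsD[OF l] connectsD[OF t] connectsD[OF b] connectsD[OF r]
    fix y :: real
    assume y: "y \<in> {0..1}"
    have "collapse (0, y / 2) = (0, y)" "collapse (1, (1 + y) / 2) = (1, y)"
      "collapse (1, y / 2) = (y, 0)" "collapse (0, (1 + y) / 2) = (y, 1)"
      using y by (auto simp: collapse_def field_simps)
    then have "h (0, y) = k (0, y / 2)" "h (1, y) = k (1, (1 + y) / 2)"
      "h (y, 0) = k (1, y / 2)" "h (y, 1) = k (0, (1 + y) / 2)"
      using y h[of "(0, y / 2)"] h[of "(1, (1 + y) / 2)"] h[of "(1, y / 2)"] h[of "(0, (1 + y) / 2)"]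
      by auto
    then show "h (0, y) = l y" "h (1, y) = r y" "h (y, 0) = b y" "h (y, 1) = t y"
      using y k(3)[of "y / 2"] k(3)[of "(1 + y) / 2"] k(4)[of "y / 2"] k(4)[of "(1 + y) / 2"] e
      by (auto simp: joinpaths_def field_simps)
  qed
qed

section \<open>Equivariant maps out of a surface glued from a square\<close>

text \<open>\<open>N\<close> is the square with its left and right sides identified, and with its top and bottom sides
  folded up by the relations \<open>W\<close> and \<open>V\<close>. There are no other identifications.\<close>

definition square_model ::
  "'n::topological_space set \<Rightarrow> (real \<times> real \<Rightarrow> 'n) \<Rightarrow> (real \<Rightarrow> real \<Rightarrow> bool) \<Rightarrow> (real \<Rightarrow> real \<Rightarrow> bool) \<Rightarrow> bool" where
  "square_model N q W V \<longleftrightarrow>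
    continuous_on unit_square q \<and> q ` unit_square = N \<and>
    (\<forall>t\<in>{0..1}. q (0, t) = q (1, t)) \<and>
    (\<forall>s\<in>{0..1}. \<forall>s'\<in>{0..1}. W s s' \<longrightarrow> q (s, 1) = q (s', 1)) \<and>
    (\<forall>s\<in>{0..1}. \<forall>s'\<in>{0..1}. V s s' \<longrightarrow> q (s, 0) = q (s', 0)) \<and>
    (\<forall>s\<in>{0..1}. \<forall>t\<in>{0..1}. \<forall>s'\<in>{0..1}. \<forall>t'\<in>{0..1}. q (s, t) = q (s', t') \<longrightarrow>
      t = t' \<and> (s = s' \<or> {s, s'} = {0, 1} \<or> (t = 1 \<and> W s s') \<or> (t = 0 \<and> V s s')))"

context equivariant_path_functor
begin

text \<open>Since the constant path is its own square, its image is an idempotent up to homotopy.\<close>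

lemma \<Psi>_const:
  assumes "a \<in> M"
  shows "homotopic_paths Z (\<Psi> (\<lambda>_. a)) (\<lambda>_. H a)"
proof -
  let ?c = "\<Psi> (\<lambda>_. a)"
  have a: "connects M a a (\<lambda>_. a)"
    by (rule connects_const[OF assms])
  have c: "connects Z (H a) (H a) ?c"
    by (rule \<Psi>_path[OF a])
  have "(\<lambda>_. a) +++ (\<lambda>_. a) = (\<lambda>_. a)"
    by (auto simp: joinpaths_def)
  then have i: "homotopic_paths Z ?c (?c +++ ?c)"
    using \<Psi>_join[OF a a] by simp
  have "homotopic_paths Z ?c (?c +++ (\<lambda>_. H a))"
    by (rule homotopic_paths_sym[OF homotopic_paths_join_const[OF c]])
  also have "homotopic_paths Z \<dots> (?c +++ (?c +++ reversepath ?c))"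
    by (rule homotopic_join[OF homotopic_refl[OF c]
          homotopic_paths_sym[OF homotopic_paths_join_reverse[OF c]] c
          connects_const]) (use connects_ends[OF c] in auto)
  also have "homotopic_paths Z \<dots> ((?c +++ ?c) +++ reversepath ?c)"
    by (rule homotopic_assoc[OF c c connects_reverse[OF c]])
  also have "homotopic_paths Z \<dots> (?c +++ reversepath ?c)"
    by (rule homotopic_join[OF homotopic_paths_sym[OF i] homotopic_refl
          connects_join[OF c c] connects_reverse[OF c]]) (rule connects_reverse[OF c])
  also have "homotopic_paths Z \<dots> (\<lambda>_. H a)"
    by (rule homotopic_paths_join_reverse[OF c])
  finally show ?thesis .
qed

lemma \<Psi>_reverse:
  assumes \<gamma>: "connects M a b \<gamma>"
  shows "homotopic_paths Z (\<Psi> (reversepath \<gamma>)) (reversepath (\<Psi> \<gamma>))"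
proof -
  let ?r = "\<Psi> (reversepath \<gamma>)" and ?c = "\<Psi> \<gamma>"
  note r = \<Psi>_path[OF connects_reverse[OF \<gamma>]] and c = \<Psi>_path[OF \<gamma>]
  have bM: "b \<in> M"
    using connects_ends[OF \<gamma>] by simp
  have "homotopic_paths Z ?r (?r +++ (\<lambda>_. H a))"
    by (rule homotopic_paths_sym[OF homotopic_paths_join_const[OF r]])
  also have "homotopic_paths Z \<dots> (?r +++ (?c +++ reversepath ?c))"
    by (rule homotopic_join[OF homotopic_refl[OF r]
          homotopic_paths_sym[OF homotopic_paths_join_reverse[OF c]] r
          connects_const]) (use connects_ends[OF c] in auto)
  also have "homotopic_paths Z \<dots> ((?r +++ ?c) +++ reversepath ?c)"
    by (rule homotopic_assoc[OF r c connects_reverse[OF c]])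
  also have "homotopic_paths Z \<dots> ((\<lambda>_. H b) +++ reversepath ?c)"
  proof (rule homotopic_join[OF _ homotopic_refl connects_join[OF r c] connects_reverse[OF c]])
    have "homotopic_paths Z (?r +++ ?c) (\<Psi> (reversepath \<gamma> +++ \<gamma>))"
      by (rule homotopic_paths_sym[OF \<Psi>_join[OF connects_reverse[OF \<gamma>] \<gamma>]])
    also have "\<Psi> (reversepath \<gamma> +++ \<gamma>) = \<Psi> (\<lambda>_. b)"
      by (rule \<Psi>_homotopic[OF homotopic_paths_reverse_join[OF \<gamma>]])
    also have "homotopic_paths Z \<dots> (\<lambda>_. H b)"
      by (rule \<Psi>_const[OF bM])
    finally show "homotopic_paths Z (?r +++ ?c) (\<lambda>_. H b)" .
  qed (rule connects_reverse[OF c])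
  also have "homotopic_paths Z \<dots> (reversepath ?c)"
    by (rule homotopic_paths_const_join[OF connects_reverse[OF c]])
  finally show ?thesis .
qed

text \<open>The values of an equivariant map at two points of a side of the square that are identified in
  \<open>N\<close> are related by the group element that relates the lifts of these points to \<open>M\<close>. A gluing is
  realizable if the path \<open>\<Psi> T\<close> can always be deformed into one with this property.\<close>

definition compatible :: "(real \<Rightarrow> real \<Rightarrow> bool) \<Rightarrow> (real \<Rightarrow> 'm) \<Rightarrow> (real \<Rightarrow> 'z) \<Rightarrow> bool" where
  "compatible W T \<eta> \<longleftrightarrow> (\<forall>s\<in>{0..1}. \<forall>s'\<in>{0..1}. W s s' \<longrightarrow>
    (\<forall>g\<in>carrier G. T s = \<tau> g (T s') \<longrightarrow> \<eta> s = act g (\<eta> s')))"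

definition realizable :: "(real \<Rightarrow> real \<Rightarrow> bool) \<Rightarrow> bool" where
  "realizable W \<longleftrightarrow> (\<forall>a b T. connects M a b T \<longrightarrow>
    (\<forall>s\<in>{0..1}. \<forall>s'\<in>{0..1}. W s s' \<longrightarrow> p (T s) = p (T s')) \<longrightarrow>
    (\<exists>\<eta>. homotopic_paths Z (\<Psi> T) \<eta> \<and> compatible W T \<eta>))"

text \<open>The square is simply connected, so it lifts to \<open>M\<close>, and its translates cover \<open>M\<close>. Since \<open>M\<close> is
  glued from these translates, an equivariant map is the same as a map \<open>h\<close> on the square whose
  values on the boundary respect the identifications. On the boundary \<open>h\<close> is prescribed by \<open>\<Psi>\<close>;
  the boundary of the square is contractible in \<open>M\<close>, and since \<open>\<Psi>\<close> respects concatenation and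
  homotopy, its image is contractible in \<open>Z\<close>. So \<open>h\<close> extends over the interior. Higher homotopy
  groups of \<open>Z\<close> do not enter, because \<open>N\<close> has dimension two.\<close>

theorem equivariant_map_of_square_model:
  assumes fin: "finite (carrier G)" and model: "square_model N q W V"
    and W: "realizable W" and V: "realizable V"
  obtains F where "continuous_on M F" "F ` M \<subseteq> Z"
    "\<And>g y. g \<in> carrier G \<Longrightarrow> y \<in> M \<Longrightarrow> F (\<tau> g y) = act g (F y)"
proof -
  have q: "continuous_on unit_square q" "q ` unit_square = N"
    and side: "\<And>t. t \<in> {0..1} \<Longrightarrow> q (0, t) = q (1, t)"
    and top: "\<And>s s'. s \<in> {0..1} \<Longrightarrow> s' \<in> {0..1} \<Longrightarrow> W s s' \<Longrightarrow> q (s, 1) = q (s', 1)"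
    and bottom: "\<And>s s'. s \<in> {0..1} \<Longrightarrow> s' \<in> {0..1} \<Longrightarrow> V s s' \<Longrightarrow> q (s, 0) = q (s', 0)"
    and inj: "\<And>s t s' t'. s \<in> {0..1} \<Longrightarrow> t \<in> {0..1} \<Longrightarrow> s' \<in> {0..1} \<Longrightarrow> t' \<in> {0..1} \<Longrightarrow> q (s, t) = q (s', t') \<Longrightarrow>
      t = t' \<and> (s = s' \<or> {s, s'} = {0, 1} \<or> (t = 1 \<and> W s s') \<or> (t = 0 \<and> V s s'))"
    using model unfolding square_model_def by blast+
  have cv: "convex unit_square"
    by (intro convex_Times convex_real_interval)
  obtain k where k: "continuous_on unit_square k" "k \<in> unit_square \<rightarrow> M" "\<And>v. v \<in> unit_square \<Longrightarrow> p (k v) = q v"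
    using covering_space_lift[OF covering convex_imp_simply_connected[OF cv] convex_imp_locally_path_connected[OF cv] q(1)] q(2)
    by blast
  have seg: "connects M (k u) (k v) (\<lambda>r. k (f r))"
    if "continuous_on {0..1} f" "\<And>r. r \<in> {0..1} \<Longrightarrow> f r \<in> unit_square" "f 0 = u" "f 1 = v" for f u v
  proof (rule connectsI)
    show "continuous_on {0..1} (\<lambda>r. k (f r))"
      by (rule continuous_on_compose2[OF k(1) that(1)]) (use that(2) in blast)
  qed (use that k(2) in auto)
  let ?l = "\<lambda>y. k (0, y)" and ?r = "\<lambda>y. k (1, y)" and ?b = "\<lambda>x. k (x, 0)" and ?t = "\<lambda>x. k (x, 1)"
  have l: "connects M (k (0,0)) (k (0,1)) ?l" and r: "connects M (k (1,0)) (k (1,1)) ?r"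
    and b: "connects M (k (0,0)) (k (1,0)) ?b" and t: "connects M (k (0,1)) (k (1,1)) ?t"
    by (rule seg; auto intro!: continuous_intros)+
  obtain \<eta> where \<eta>: "homotopic_paths Z (\<Psi> ?t) \<eta>" "compatible W ?t \<eta>"
  proof -
    have "\<forall>s\<in>{0..1}. \<forall>s'\<in>{0..1}. W s s' \<longrightarrow> p (?t s) = p (?t s')"
      using top k(3) by simp
    then show ?thesis
      using W t that unfolding realizable_def by blast
  qed
  obtain \<epsilon> where \<epsilon>: "homotopic_paths Z (\<Psi> ?b) \<epsilon>" "compatible V ?b \<epsilon>"
  proof -
    have "\<forall>s\<in>{0..1}. \<forall>s'\<in>{0..1}. V s s' \<longrightarrow> p (?b s) = p (?b s')"
      using bottom k(3) by simp
    then show ?thesis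
      using V b that unfolding realizable_def by blast
  qed
  note tl = \<Psi>_path[OF l] and tr = \<Psi>_path[OF r] and tb = \<Psi>_path[OF b] and tt = \<Psi>_path[OF t]
  note eb = connects_homotopic[OF tb \<epsilon>(1)] and et = connects_homotopic[OF tt \<eta>(1)]
  have "homotopic_paths M (k \<circ> ((\<lambda>y. (0, y)) +++ (\<lambda>x. (x, 1)))) (k \<circ> ((\<lambda>x. (x, 0)) +++ (\<lambda>y. (1, y))))"
  proof (rule homotopic_paths_convex_image[OF cv k(1)])
    show "k ` unit_square \<subseteq> M"
      using k(2) by blast
    show "connects unit_square (0, 0) (1, 1) ((\<lambda>y. (0, y)) +++ (\<lambda>x. (x, 1)))"
      by (rule connects_join[of _ _ "(0, 1)"]; rule connectsI; auto intro!: continuous_intros)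
    show "connects unit_square (0, 0) (1, 1) ((\<lambda>x. (x, 0)) +++ (\<lambda>y. (1, y)))"
      by (rule connects_join[of _ _ "(1, 0)"]; rule connectsI; auto intro!: continuous_intros)
  qed
  then have lt: "homotopic_paths M (?l +++ ?t) (?b +++ ?r)"
    unfolding path_compose_join by (simp add: comp_def)
  have "homotopic_paths Z (\<Psi> ?l +++ \<eta>) (\<Psi> ?l +++ \<Psi> ?t)"
    by (rule homotopic_join[OF homotopic_refl[OF tl] homotopic_paths_sym[OF \<eta>(1)] tl et])
  also have "homotopic_paths Z \<dots> (\<Psi> (?l +++ ?t))"
    by (rule homotopic_paths_sym[OF \<Psi>_join[OF l t]])
  also have "\<Psi> (?l +++ ?t) = \<Psi> (?b +++ ?r)"
    by (rule \<Psi>_homotopic[OF lt])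
  also have "homotopic_paths Z \<dots> (\<Psi> ?b +++ \<Psi> ?r)"
    by (rule \<Psi>_join[OF b r])
  also have "homotopic_paths Z \<dots> (\<epsilon> +++ \<Psi> ?r)"
    by (rule homotopic_join[OF \<epsilon>(1) homotopic_refl[OF tr] tb tr])
  finally obtain h where h: "continuous_on unit_square h" "h ` unit_square \<subseteq> Z"
      "\<And>y. y \<in> {0..1} \<Longrightarrow> h (0, y) = \<Psi> ?l y" "\<And>y. y \<in> {0..1} \<Longrightarrow> h (1, y) = \<Psi> ?r y"
      "\<And>x. x \<in> {0..1} \<Longrightarrow> h (x, 0) = \<epsilon> x" "\<And>x. x \<in> {0..1} \<Longrightarrow> h (x, 1) = \<eta> x"
    using square_filling[OF tl et eb tr] by metis
  obtain g\<^sub>0 where g\<^sub>0: "g\<^sub>0 \<in> carrier G" "\<And>y. y \<in> {0..1} \<Longrightarrow> k (1, y) = \<tau> g\<^sub>0 (k (0, y))"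
    using translate_of_path[OF l r] side k(3) by auto
  have hside: "h (1, y) = act g\<^sub>0 (h (0, y))" if y: "y \<in> {0..1}" for y
  proof -
    have "\<Psi> ?r = \<Psi> (\<lambda>y. \<tau> g\<^sub>0 (k (0, y)))"
      by (rule \<Psi>_homotopic[OF homotopic_cong[OF r]]) (simp add: g\<^sub>0(2))
    then show ?thesis
      using h(3,4)[OF y] \<Psi>_equivariant[OF g\<^sub>0(1) l y] by simp
  qed
  have kM: "k v \<in> M" and hZ: "h v \<in> Z" if "v \<in> unit_square" for v
    using k(2) h(2) that by auto
  have compat: "h (s, t) = act g (h (s', t'))"
    if v: "s \<in> {0..1}" "t \<in> {0..1}" "s' \<in> {0..1}" "t' \<in> {0..1}" and g: "g \<in> carrier G"
      and eq: "k (s, t) = \<tau> g (k (s', t'))" for s t s' t' g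
  proof -
    have M: "k (s, t) \<in> M" "k (s', t') \<in> M" and Z: "h (s, t) \<in> Z" "h (s', t') \<in> Z"
      using v by (auto intro!: kM hZ)
    have "q (s, t) = q (s', t')"
      using k(3)[of "(s, t)"] k(3)[of "(s', t')"] v eq p_invariant[OF g M(2)] by simp
    then have t: "t = t'" and "s = s' \<or> {s, s'} = {0, 1} \<or> (t = 1 \<and> W s s') \<or> (t = 0 \<and> V s s')"
      using inj[OF v] by auto
    then consider "s = s'" | "s = 1" "s' = 0" | "s = 0" "s' = 1" | "t = 1" "W s s'" | "t = 0" "V s s'"
      by (auto simp: doubleton_eq_iff)
    then show ?thesis
    proof cases
      case 1
      then have "g = \<one>"
        using free_eq[OF g one_closed M(2)] eq t M by (simp add: M.act_one)
      then show ?thesis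
        using 1 t Z by (simp add: act_one)
    next
      case 2
      then have "g = g\<^sub>0"
        using free_eq[OF g g\<^sub>0(1) M(2)] eq g\<^sub>0(2)[OF v(2)] t by simp
      then show ?thesis
        using hside[OF v(2)] 2 t by simp
    next
      case 3
      then have "\<tau> (g \<otimes> g\<^sub>0) (k (s, t)) = \<tau> g (k (s', t'))"
        using M.act_mult[OF g g\<^sub>0(1) M(1)] g\<^sub>0(2)[OF v(2)] t by metis
      also have "\<dots> = \<tau> \<one> (k (s, t))"
        using eq M.act_one[OF M(1)] by metis
      finally have "g \<otimes> g\<^sub>0 = \<one>"
        by (rule free_eq[OF m_closed[OF g g\<^sub>0(1)] one_closed M(1)])
      then have "act g (act g\<^sub>0 (h (s, t))) = h (s, t)"
        using act_mult[OF g g\<^sub>0(1) Z(1)] act_one[OF Z(1)] by simp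
      then show ?thesis
        using hside[OF v(2)] 3 t by simp
    next
      case 4
      then show ?thesis
        using \<eta>(2) h(6) v g eq t unfolding compatible_def by auto
    next
      case 5
      then show ?thesis
        using \<epsilon>(2) h(5) v g eq t unfolding compatible_def by auto
    qed
  qed
  have cover: "\<exists>g\<in>carrier G. \<exists>v\<in>unit_square. y = \<tau> g (k v)" if "y \<in> M" for y
  proof -
    have "p y \<in> q ` unit_square"
      using q(2) p_image that by auto
    then obtain v where v: "v \<in> unit_square" "p y = q v"
      by blast
    then have "p (k v) = p y"
      using k(3) by simp
    then show ?thesis
      using fibres[OF kM[OF v(1)] that] v(1) by auto
  qed
  \<comment> \<open>independent of the choices by \<open>compat\<close>\<close>
  define F where "F y = (SOME z. \<exists>g\<in>carrier G. \<exists>v\<in>unit_square. y = \<tau> g (k v) \<and> z = act g (h v))" for y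
  have F: "F (\<tau> g (k v)) = act g (h v)" if g: "g \<in> carrier G" and v: "v \<in> unit_square" for g v
  proof -
    have "\<exists>g'\<in>carrier G. \<exists>v'\<in>unit_square. \<tau> g (k v) = \<tau> g' (k v') \<and> F (\<tau> g (k v)) = act g' (h v')"
      unfolding F_def by (rule someI[of _ "act g (h v)"]) (use g v in blast)
    then obtain g' v' where g': "g' \<in> carrier G" "v' \<in> unit_square" "\<tau> g (k v) = \<tau> g' (k v')"
        "F (\<tau> g (k v)) = act g' (h v')"
      by blast
    have "k v = \<tau> (inv g \<otimes> g') (k v')"
      using g'(1,3) g kM[OF v] kM[OF g'(2)] by (metis M.act_inv M.act_mult inv_closed)
    then have "h v = act (inv g \<otimes> g') (h v')"
      using compat[of "fst v" "snd v" "fst v'" "snd v'" "inv g \<otimes> g'"] v g'(1,2) g by auto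
    then have "act g (h v) = act g' (h v')"
      using act_inv'[OF g act_closed[OF g'(1) hZ[OF g'(2)]]] act_mult[OF _ g'(1) hZ[OF g'(2)], of "inv g"] g
      by simp
    then show ?thesis
      using g'(4) by simp
  qed
  show ?thesis
  proof (rule that[of F])
    have "continuous_on ((\<lambda>v. \<tau> g (k v)) ` unit_square) F" and "compact ((\<lambda>v. \<tau> g (k v)) ` unit_square)"
      if g: "g \<in> carrier G" for g
    proof -
      have c: "continuous_on unit_square (\<lambda>v. \<tau> g (k v))"
        by (rule continuous_on_compose2[OF M.act_continuous[OF g] k(1)]) (use kM in auto)
      have ch: "continuous_on unit_square (\<lambda>v. act g (h v))"
        by (rule continuous_on_compose2[OF act_continuous[OF g] h(1)]) (use hZ in auto)
      show "continuous_on ((\<lambda>v. \<tau> g (k v)) ` unit_square) F"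
        by (rule continuous_on_image_of_compact[OF _ c ch F[OF g]]) (simp_all add: compact_Times)
      show "compact ((\<lambda>v. \<tau> g (k v)) ` unit_square)"
        by (rule compact_continuous_image[OF c]) (simp add: compact_Times)
    qed
    then have "continuous_on (\<Union>g\<in>carrier G. (\<lambda>v. \<tau> g (k v)) ` unit_square) F"
      using fin by (intro continuous_on_closed_Union) (auto intro: compact_imp_closed)
    moreover have "(\<Union>g\<in>carrier G. (\<lambda>v. \<tau> g (k v)) ` unit_square) = M"
    proof
      show "(\<Union>g\<in>carrier G. (\<lambda>v. \<tau> g (k v)) ` unit_square) \<subseteq> M"
        using kM by (auto intro: M.act_closed)
      show "M \<subseteq> (\<Union>g\<in>carrier G. (\<lambda>v. \<tau> g (k v)) ` unit_square)"
        using cover by blast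
    qed
    ultimately show "continuous_on M F"
      by simp
    show "F ` M \<subseteq> Z"
    proof
      fix z assume "z \<in> F ` M"
      then obtain g v where "g \<in> carrier G" "v \<in> unit_square" "z = F (\<tau> g (k v))"
        using cover by blast
      then show "z \<in> Z"
        using F act_closed hZ by auto
    qed
    show "F (\<tau> g y) = act g (F y)" if g: "g \<in> carrier G" and y: "y \<in> M" for g y
    proof -
      obtain g' v where v: "g' \<in> carrier G" "v \<in> unit_square" "y = \<tau> g' (k v)"
        using cover[OF y] by blast
      then have "\<tau> g y = \<tau> (g \<otimes> g') (k v)"
        using M.act_mult[OF g v(1) kM[OF v(2)]] by simp
      then show ?thesis
        using v F[of "g \<otimes> g'" v] F[of g' v] g act_mult[OF g v(1) hZ[OF v(2)]] by simp
    qed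
  qed
qed

end

text \<open>The unit interval is wrapped once around a closed curve. For the torus the curve is the boundary
  of a square, traversed from one corner, with opposite sides identified by translation; for the
  projective plane it is a circle with opposite points identified. All corners are listed
  separately because they form a single class that the side pairings only generate.\<close>

definition torus_gluing :: "real \<Rightarrow> real \<Rightarrow> bool" where
  "torus_gluing s s' \<longleftrightarrow> {s, s'} \<subseteq> {0, 1/4, 1/2, 3/4, 1} \<or>
    (\<exists>u\<in>{0..1}. (s, s') \<in> {(u/4, 3/4 - u/4), (3/4 - u/4, u/4), (1/4 + u/4, 1 - u/4), (1 - u/4, 1/4 + u/4)})"

definition antipodal_gluing :: "real \<Rightarrow> real \<Rightarrow> bool" where
  "antipodal_gluing s s' \<longleftrightarrow> {s, s'} \<subseteq> {0, 1/2, 1} \<or>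
    (\<exists>u\<in>{0..1}. (s, s') \<in> {(u/2, 1/2 + u/2), (1/2 + u/2, u/2)})"

context equivariant_path_functor
begin

lemma transport_identified_paths:
  assumes "connects M a b \<gamma>" "connects M c d \<delta>" "\<And>u. u \<in> {0..1} \<Longrightarrow> p (\<gamma> u) = p (\<delta> u)"
    and "u \<in> {0..1}" "g \<in> carrier G" "\<delta> u = \<tau> g (\<gamma> u)"
  shows "\<Psi> \<delta> u = act g (\<Psi> \<gamma> u)"
proof -
  obtain h where h: "h \<in> carrier G" "\<And>t. t \<in> {0..1} \<Longrightarrow> \<delta> t = \<tau> h (\<gamma> t)"
    using translate_of_path[OF assms(1-3)] by blast
  have "g = h"
    using free_eq[OF assms(5) h(1) connectsD(2)[OF assms(1,4)]] assms(6) h(2)[OF assms(4)] by simp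
  moreover have "\<Psi> \<delta> = \<Psi> (\<lambda>t. \<tau> h (\<gamma> t))"
    by (rule \<Psi>_homotopic[OF homotopic_cong[OF assms(2)]]) (simp add: h(2))
  ultimately show ?thesis
    using \<Psi>_equivariant[OF h(1) assms(1,4)] by simp
qed

lemma transport_identified_paths':
  assumes "connects M a b \<gamma>" "connects M c d \<delta>" "\<And>u. u \<in> {0..1} \<Longrightarrow> p (\<gamma> u) = p (\<delta> u)"
    and "u \<in> {0..1}" "g \<in> carrier G" "\<gamma> u = \<tau> g (\<delta> u)"
  shows "\<Psi> \<gamma> u = act g (\<Psi> \<delta> u)"
  by (rule transport_identified_paths[OF assms(2,1) _ assms(4-6)]) (use assms(3) in auto)

lemma subconnects:
  fixes f :: "real \<Rightarrow> real"
  assumes "connects M a b T" "continuous_on {0..1} f" "\<And>u. u \<in> {0..1} \<Longrightarrow> f u \<in> {0..1}"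
  shows "connects M (T (f 0)) (T (f 1)) (\<lambda>u. T (f u))"
  using connectsD[OF assms(1)] assms(2,3)
  by (intro connectsI) (auto intro!: continuous_on_compose2[of "{0..1}" T])

text \<open>The two halves of \<open>T\<close> are lifts of one path, so their images under \<open>\<Psi>\<close> are translates of each
  other. The concatenation of these images is homotopic to \<open>\<Psi> T\<close>.\<close>

lemma realizable_antipodal: "realizable antipodal_gluing"
  unfolding realizable_def
proof (intro allI impI)
  fix a b T
  assume T: "connects M a b T"
    and pT: "\<forall>s\<in>{0..1}. \<forall>s'\<in>{0..1}. antipodal_gluing s s' \<longrightarrow> p (T s) = p (T s')"
  have id: "p (T (u/2)) = p (T (1/2 + u/2))" if u: "u \<in> {0..1}" for u
  proof -
    have "antipodal_gluing (u/2) (1/2 + u/2)"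
      unfolding antipodal_gluing_def using u by blast
    then show ?thesis
      using pT u by simp
  qed
  let ?\<gamma> = "\<lambda>u. T (u/2)" and ?\<delta> = "\<lambda>u. T (1/2 + u/2)"
  have \<gamma>: "connects M (T 0) (T (1/2)) ?\<gamma>" and \<delta>: "connects M (T (1/2)) (T 1) ?\<delta>"
    using subconnects[OF T, of "\<lambda>u. u/2"] subconnects[OF T, of "\<lambda>u. 1/2 + u/2"]
    by (simp_all add: continuous_on_add continuous_on_diff continuous_on_divide)
  let ?\<eta> = "\<Psi> ?\<gamma> +++ \<Psi> ?\<delta>"
  have T_eq: "\<Psi> T = \<Psi> (?\<gamma> +++ ?\<delta>)"
    by (rule \<Psi>_homotopic[OF homotopic_cong[OF T]]) (simp add: joinpaths_def diff_divide_distrib)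
  note h = \<Psi>_join[OF \<gamma> \<delta>, folded T_eq]
  note ends = connectsD(3,4)[OF \<Psi>_path[OF \<gamma>]] connectsD(3,4)[OF \<Psi>_path[OF \<delta>]]
  have eta: "?\<eta> (u/2) = \<Psi> ?\<gamma> u" "?\<eta> (1/2 + u/2) = \<Psi> ?\<delta> u" if "u \<in> {0..1}" for u
    using that ends by (auto simp: joinpaths_def)
  have "?\<eta> 0 = H (T 0)" "?\<eta> (1/2) = H (T (1/2))" "?\<eta> 1 = H (T 1)"
    using ends by (auto simp: joinpaths_def)
  then have corner: "?\<eta> s = H (T s)" if "s \<in> {0, 1/2, 1}" for s
    using that by blast
  have "compatible antipodal_gluing T ?\<eta>"
    unfolding compatible_def
  proof (intro ballI impI)
    fix s s' g
    assume s: "s \<in> {0..1}" "s' \<in> {0..1}" and g: "g \<in> carrier G" "T s = \<tau> g (T s')"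
      and glue: "antipodal_gluing s s'"
    have M: "T s' \<in> M"
      using connectsD(2)[OF T] s by auto
    from glue consider "{s, s'} \<subseteq> {0, 1/2, 1}"
      | u where "u \<in> {0..1}" "s = u/2" "s' = 1/2 + u/2" | u where "u \<in> {0..1}" "s = 1/2 + u/2" "s' = u/2"
      unfolding antipodal_gluing_def by blast
    then show "?\<eta> s = act g (?\<eta> s')"
    proof cases
      case 1
      then show ?thesis
        using corner[of s] corner[of s'] H_equivariant[OF g(1) M] g(2) by simp
    next
      case (2 u)
      show ?thesis
        unfolding 2(2,3) eta[OF 2(1)]
        by (intro transport_identified_paths'[OF \<gamma> \<delta> id 2(1) g(1)]) (use g(2) in \<open>unfold 2(2,3)\<close>)
    next
      case (3 u)
      show ?thesis
        unfolding 3(2,3) eta[OF 3(1)]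
        by (intro transport_identified_paths[OF \<gamma> \<delta> id 3(1) g(1)]) (use g(2) in \<open>unfold 3(2,3)\<close>)
    qed
  qed
  with h show "\<exists>\<eta>. homotopic_paths Z (\<Psi> T) \<eta> \<and> compatible antipodal_gluing T \<eta>"
    by blast
qed

text \<open>The boundary word is a commutator: the third and fourth sides are the first two traversed
  backwards. The corresponding parts of the path in \<open>Z\<close> are therefore taken to be reversed images
  of paths rather than images of reversed paths; the two are homotopic, but only the former are
  pointwise translates of the first two parts, traversed backwards.\<close>

lemma realizable_torus: "realizable torus_gluing"
  unfolding realizable_def
proof (intro allI impI)
  fix a b T
  assume T: "connects M a b T"
    and pT: "\<forall>s\<in>{0..1}. \<forall>s'\<in>{0..1}. torus_gluing s s' \<longrightarrow> p (T s) = p (T s')"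
  have id1: "p (T (u/4)) = p (T (3/4 - u/4))" and id2: "p (T (1/4 + u/4)) = p (T (1 - u/4))"
    if u: "u \<in> {0..1}" for u
  proof -
    have "torus_gluing (u/4) (3/4 - u/4)" "torus_gluing (1/4 + u/4) (1 - u/4)"
      unfolding torus_gluing_def using u by blast+
    then show "p (T (u/4)) = p (T (3/4 - u/4))" "p (T (1/4 + u/4)) = p (T (1 - u/4))"
      using pT u by simp_all
  qed
  let ?a = "\<lambda>u. T (u/4)" and ?b = "\<lambda>u. T (1/4 + u/4)" and ?c = "\<lambda>u. T (3/4 - u/4)" and ?d = "\<lambda>u. T (1 - u/4)"
  have a: "connects M (T 0) (T (1/4)) ?a" and b: "connects M (T (1/4)) (T (1/2)) ?b"
    and c: "connects M (T (3/4)) (T (1/2)) ?c" and d: "connects M (T 1) (T (3/4)) ?d"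
    using subconnects[OF T, of "\<lambda>u. u/4"] subconnects[OF T, of "\<lambda>u. 1/4 + u/4"]
      subconnects[OF T, of "\<lambda>u. 3/4 - u/4"] subconnects[OF T, of "\<lambda>u. 1 - u/4"]
    by (simp_all add: continuous_on_add continuous_on_diff continuous_on_divide)
  note rc = connects_reverse[OF c] and rd = connects_reverse[OF d]
  note ab = connects_join[OF a b] and cd = connects_join[OF rc rd]
  let ?\<eta> = "(\<Psi> ?a +++ \<Psi> ?b) +++ (reversepath (\<Psi> ?c) +++ reversepath (\<Psi> ?d))"
  have T_eq: "\<Psi> T = \<Psi> ((?a +++ ?b) +++ (reversepath ?c +++ reversepath ?d))"
    by (rule \<Psi>_homotopic[OF homotopic_cong[OF T]])
      (auto simp: joinpaths_def reversepath_def algebra_simps diff_divide_distrib)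
  have "homotopic_paths Z (\<Psi> T) (\<Psi> (?a +++ ?b) +++ \<Psi> (reversepath ?c +++ reversepath ?d))"
    unfolding T_eq by (rule \<Psi>_join[OF ab cd])
  also have "homotopic_paths Z \<dots> ?\<eta>"
  proof (rule homotopic_join[OF \<Psi>_join[OF a b] _ \<Psi>_path[OF ab] \<Psi>_path[OF cd]])
    show "homotopic_paths Z (\<Psi> (reversepath ?c +++ reversepath ?d)) (reversepath (\<Psi> ?c) +++ reversepath (\<Psi> ?d))"
      using \<Psi>_join[OF rc rd]
        homotopic_join[OF \<Psi>_reverse[OF c] \<Psi>_reverse[OF d] \<Psi>_path[OF rc] \<Psi>_path[OF rd]]
      by (rule homotopic_paths_trans)
  qed
  finally have h: "homotopic_paths Z (\<Psi> T) ?\<eta>" .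
  note ends = connectsD(3,4)[OF \<Psi>_path[OF a]] connectsD(3,4)[OF \<Psi>_path[OF b]]
    connectsD(3,4)[OF \<Psi>_path[OF c]] connectsD(3,4)[OF \<Psi>_path[OF d]]
  have eta: "?\<eta> (u/4) = \<Psi> ?a u" "?\<eta> (1/4 + u/4) = \<Psi> ?b u" "?\<eta> (3/4 - u/4) = \<Psi> ?c u" "?\<eta> (1 - u/4) = \<Psi> ?d u"
    if "u \<in> {0..1}" for u
    using that ends by (auto simp: joinpaths_def reversepath_def algebra_simps)
  have "?\<eta> 0 = H (T 0)" "?\<eta> (1/4) = H (T (1/4))" "?\<eta> (1/2) = H (T (1/2))"
    "?\<eta> (3/4) = H (T (3/4))" "?\<eta> 1 = H (T 1)"
    using ends by (auto simp: joinpaths_def reversepath_def)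
  then have corner: "?\<eta> s = H (T s)" if "s \<in> {0, 1/4, 1/2, 3/4, 1}" for s
    using that by blast
  have "compatible torus_gluing T ?\<eta>"
    unfolding compatible_def
  proof (intro ballI impI)
    fix s s' g
    assume s: "s \<in> {0..1}" "s' \<in> {0..1}" and g: "g \<in> carrier G" "T s = \<tau> g (T s')"
      and glue: "torus_gluing s s'"
    have M: "T s' \<in> M"
      using connectsD(2)[OF T] s by auto
    from glue consider "{s, s'} \<subseteq> {0, 1/4, 1/2, 3/4, 1}"
      | u where "u \<in> {0..1}" "s = u/4" "s' = 3/4 - u/4" | u where "u \<in> {0..1}" "s = 3/4 - u/4" "s' = u/4"
      | u where "u \<in> {0..1}" "s = 1/4 + u/4" "s' = 1 - u/4" | u where "u \<in> {0..1}" "s = 1 - u/4" "s' = 1/4 + u/4"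
      unfolding torus_gluing_def by blast
    then show "?\<eta> s = act g (?\<eta> s')"
    proof cases
      case 1
      then show ?thesis
        using corner[of s] corner[of s'] H_equivariant[OF g(1) M] g(2) by simp
    next
      case (2 u)
      show ?thesis
        unfolding 2(2,3) eta[OF 2(1)]
        by (intro transport_identified_paths'[OF a c id1 2(1) g(1)]) (use g(2) in \<open>unfold 2(2,3)\<close>)
    next
      case (3 u)
      show ?thesis
        unfolding 3(2,3) eta[OF 3(1)]
        by (intro transport_identified_paths[OF a c id1 3(1) g(1)]) (use g(2) in \<open>unfold 3(2,3)\<close>)
    next
      case (4 u)
      show ?thesis
        unfolding 4(2,3) eta[OF 4(1)]
        by (intro transport_identified_paths'[OF b d id2 4(1) g(1)]) (use g(2) in \<open>unfold 4(2,3)\<close>)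
    next
      case (5 u)
      show ?thesis
        unfolding 5(2,3) eta[OF 5(1)]
        by (intro transport_identified_paths[OF b d id2 5(1) g(1)]) (use g(2) in \<open>unfold 5(2,3)\<close>)
    qed
  qed
  with h show "\<exists>\<eta>. homotopic_paths Z (\<Psi> T) \<eta> \<and> compatible torus_gluing T \<eta>"
    by blast
qed

end

section \<open>The connected sums as quotients of a square\<close>

text \<open>The boundary of \<open>[-1, 1]\<^sup>2\<close>, traversed counterclockwise at constant speed from the corner
  \<open>(1, 1)\<close>. Being piecewise linear it makes the identifications of sides linear; its radial
  projection to the unit circle is used as the parametrization of the circle along which two
  surfaces are glued.\<close>

definition square_x :: "real \<Rightarrow> real" where
  "square_x s = max (-1) (min 1 (8 * \<bar>s - 3/8\<bar> - 2))"

definition square_y :: "real \<Rightarrow> real" where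
  "square_y s = max (-1) (min 1 (8 * \<bar>s - 5/8\<bar> - 2))"

definition square_loop :: "real \<Rightarrow> complex" where
  "square_loop s = Complex (square_x s) (square_y s)"

lemma square_loop_sides:
  "0 \<le> s \<Longrightarrow> s \<le> 1/4 \<Longrightarrow> square_x s = 1 - 8 * s \<and> square_y s = 1"
  "1/4 \<le> s \<Longrightarrow> s \<le> 1/2 \<Longrightarrow> square_x s = -1 \<and> square_y s = 3 - 8 * s"
  "1/2 \<le> s \<Longrightarrow> s \<le> 3/4 \<Longrightarrow> square_x s = 8 * s - 5 \<and> square_y s = -1"
  "3/4 \<le> s \<Longrightarrow> s \<le> 1 \<Longrightarrow> square_x s = 1 \<and> square_y s = 8 * s - 7"
  by (auto simp: square_x_def square_y_def max_def min_def abs_if)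

lemma square_side_cases:
  assumes "s \<in> {0..1}"
  obtains "0 \<le> s" "s \<le> 1/4" "square_x s = 1 - 8 * s" "square_y s = 1"
    | "1/4 \<le> s" "s \<le> 1/2" "square_x s = -1" "square_y s = 3 - 8 * s"
    | "1/2 \<le> s" "s \<le> 3/4" "square_x s = 8 * s - 5" "square_y s = -1"
    | "3/4 \<le> s" "s \<le> 1" "square_x s = 1" "square_y s = 8 * s - 7"
  using assms square_loop_sides[of s] by (metis atLeastAtMost_iff linear)

definition maxnorm :: "complex \<Rightarrow> real" where
  "maxnorm z = max \<bar>Re z\<bar> \<bar>Im z\<bar>"

lemma maxnorm_square_loop: "s \<in> {0..1} \<Longrightarrow> maxnorm (square_loop s) = 1"
  by (erule square_side_cases) (auto simp: maxnorm_def square_loop_def max_def abs_if)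

lemma maxnorm_scale: "0 \<le> r \<Longrightarrow> maxnorm (of_real r * z) = r * maxnorm z"
  by (simp add: maxnorm_def abs_mult max_mult_distrib_left)

lemma maxnorm_le: "maxnorm z \<le> cmod z"
  by (simp add: maxnorm_def abs_Re_le_cmod abs_Im_le_cmod)

lemma square_loop_continuous: "continuous_on S square_loop"
proof -
  have "continuous_on S square_x" "continuous_on S square_y"
    unfolding square_x_def[abs_def] square_y_def[abs_def]
    by (intro continuous_intros)+
  then show ?thesis
    unfolding square_loop_def[abs_def] Complex_eq by (intro continuous_intros)
qed

lemma square_loop_norm: "s \<in> {0..1} \<Longrightarrow> 1 \<le> cmod (square_loop s)"
  using maxnorm_le[of "square_loop s"] by (simp add: maxnorm_square_loop)

lemma square_loop_pos: "s \<in> {0..1} \<Longrightarrow> 0 < cmod (square_loop s)"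
  using square_loop_norm[of s] by linarith

lemma square_loop_ends: "square_loop 0 = square_loop 1"
  by (simp add: square_loop_def square_x_def square_y_def)

lemma square_loop_inj:
  assumes "s \<in> {0..1}" "s' \<in> {0..1}" "square_x s = square_x s'" "square_y s = square_y s'"
  shows "s = s' \<or> {s, s'} = {0, 1}"
proof -
  have "s = s' \<or> s = 0 \<and> s' = 1 \<or> s = 1 \<and> s' = 0"
    by (rule square_side_cases[OF assms(1)]; rule square_side_cases[OF assms(2)]; use assms(3,4) in linarith)
  then show ?thesis
    by auto
qed

lemma square_loop_surj:
  assumes "maxnorm z = 1"
  obtains s where "s \<in> {0..1}" "square_loop s = z"
proof -
  have b: "\<bar>Re z\<bar> \<le> 1" "\<bar>Im z\<bar> \<le> 1"
    using assms by (auto simp: maxnorm_def)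
  have "\<bar>Re z\<bar> = 1 \<or> \<bar>Im z\<bar> = 1"
    using assms by (auto simp: maxnorm_def max_def split: if_splits)
  then consider "Im z = 1" | "Re z = -1" | "Im z = -1" | "Re z = 1"
    by linarith
  then show ?thesis
  proof cases
    case 1
    then show ?thesis
      using b square_loop_sides(1)[of "(1 - Re z) / 8"]
      by (intro that[of "(1 - Re z) / 8"]) (auto simp: square_loop_def complex_eq_iff field_simps)
  next
    case 2
    then show ?thesis
      using b square_loop_sides(2)[of "(3 - Im z) / 8"]
      by (intro that[of "(3 - Im z) / 8"]) (auto simp: square_loop_def complex_eq_iff field_simps)
  next
    case 3
    then show ?thesis
      using b square_loop_sides(3)[of "(Re z + 5) / 8"]
      by (intro that[of "(Re z + 5) / 8"]) (auto simp: square_loop_def complex_eq_iff field_simps)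
  next
    case 4
    then show ?thesis
      using b square_loop_sides(4)[of "(Im z + 7) / 8"]
      by (intro that[of "(Im z + 7) / 8"]) (auto simp: square_loop_def complex_eq_iff field_simps)
  qed
qed

lemma square_sideD:
  assumes "s \<in> {0..1}"
  shows "square_y s = 1 \<Longrightarrow> s \<le> 1/4 \<and> square_x s = 1 - 8 * s \<or> s = 1 \<and> square_x s = 1"
    "square_x s = -1 \<Longrightarrow> 1/4 \<le> s \<and> s \<le> 1/2 \<and> square_y s = 3 - 8 * s"
    "square_y s = -1 \<Longrightarrow> square_x s = 8 * s - 5"
    "square_x s = 1 \<Longrightarrow> square_y s = 8 * s - 7 \<or> s = 0 \<and> square_y s = 1"
    "\<bar>square_x s\<bar> = 1 \<Longrightarrow> \<bar>square_y s\<bar> = 1 \<Longrightarrow> s = 0 \<or> s = 1/4 \<or> s = 1/2 \<or> s = 3/4 \<or> s = 1"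
  by (rule square_side_cases[OF assms]; linarith)+

lemma torus_gluing_sym: "torus_gluing s s' \<Longrightarrow> torus_gluing s' s"
  unfolding torus_gluing_def by blast

lemma torus_gluing_opposite:
  assumes "s \<in> {0..1}" "s' \<in> {0..1}"
  shows "square_x s = square_x s' \<Longrightarrow> square_y s = 1 \<Longrightarrow> square_y s' = -1 \<Longrightarrow> torus_gluing s s'"
    and "square_y s = square_y s' \<Longrightarrow> square_x s = -1 \<Longrightarrow> square_x s' = 1 \<Longrightarrow> torus_gluing s s'"
proof -
  assume "square_x s = square_x s'" "square_y s = 1" "square_y s' = -1"
  then consider "s \<le> 1/4" "s' = 3/4 - s" | "s = 1" "s' = 3/4"
    using square_sideD(1)[OF assms(1)] square_sideD(3)[OF assms(2)] by fastforce
  then show "torus_gluing s s'"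
  proof cases
    case 1
    then show ?thesis
      unfolding torus_gluing_def using assms by (intro disjI2 bexI[of _ "4 * s"]) auto
  qed (simp add: torus_gluing_def)
next
  assume "square_y s = square_y s'" "square_x s = -1" "square_x s' = 1"
  then consider "1/4 \<le> s" "s \<le> 1/2" "s' = 5/4 - s" | "s = 1/4" "s' = 0"
    using square_sideD(2)[OF assms(1)] square_sideD(4)[OF assms(2)] by fastforce
  then show "torus_gluing s s'"
  proof cases
    case 1
    then show ?thesis
      unfolding torus_gluing_def using assms
      by (intro disjI2 bexI[of _ "4 * s - 1"]) (auto simp: diff_divide_distrib)
  qed (simp add: torus_gluing_def)
qed

lemma maxnorm_pos: "z \<noteq> 0 \<Longrightarrow> 0 < maxnorm z"
  by (auto simp: maxnorm_def complex_eq_iff less_max_iff_disj)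

lemma square_loop_direction:
  assumes "z \<noteq> 0"
  obtains s where "s \<in> {0..1}" "z = of_real (maxnorm z) * square_loop s"
proof -
  have "maxnorm (of_real (1 / maxnorm z) * z) = 1"
    using maxnorm_pos[OF assms] by (subst maxnorm_scale) auto
  then obtain s where s: "s \<in> {0..1}" "square_loop s = of_real (1 / maxnorm z) * z"
    using square_loop_surj by blast
  then show ?thesis
    using maxnorm_pos[OF assms] by (intro that[of s]) auto
qed

lemma torus_gluingI:
  assumes "s \<in> {0..1}" "s' \<in> {0..1}"
    and "square_x s = square_x s' \<or> \<bar>square_x s\<bar> = 1 \<and> \<bar>square_x s'\<bar> = 1"
    and "square_y s = square_y s' \<or> \<bar>square_y s\<bar> = 1 \<and> \<bar>square_y s'\<bar> = 1"
  shows "s = s' \<or> torus_gluing s s'"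
proof -
  have abs1: "\<bar>r\<bar> = 1 \<longleftrightarrow> r = 1 \<or> r = -1" for r :: real
    by auto
  consider "square_x s = square_x s'" "square_y s = square_y s'"
    | "\<bar>square_x s\<bar> = 1" "\<bar>square_x s'\<bar> = 1" "\<bar>square_y s\<bar> = 1" "\<bar>square_y s'\<bar> = 1"
    | "square_x s = square_x s'" "square_y s = 1" "square_y s' = -1"
    | "square_x s' = square_x s" "square_y s' = 1" "square_y s = -1"
    | "square_y s = square_y s'" "square_x s = -1" "square_x s' = 1"
    | "square_y s' = square_y s" "square_x s' = -1" "square_x s = 1"
    using assms(3,4) unfolding abs1 by metis
  then show ?thesis
  proof cases
    case 1
    then have "s = s' \<or> {s, s'} = {0, 1}"
      by (rule square_loop_inj[OF assms(1,2)])
    then show ?thesis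
      by (auto simp: torus_gluing_def)
  next
    case 2
    then show ?thesis
      using square_sideD(5)[OF assms(1)] square_sideD(5)[OF assms(2)] by (auto simp: torus_gluing_def)
  qed (use torus_gluing_opposite assms torus_gluing_sym in blast)+
qed

lemma torus_gluingD:
  assumes "torus_gluing s s'"
  shows "(square_x s = square_x s' \<or> \<bar>square_x s\<bar> = 1 \<and> \<bar>square_x s'\<bar> = 1) \<and>
    (square_y s = square_y s' \<or> \<bar>square_y s\<bar> = 1 \<and> \<bar>square_y s'\<bar> = 1)"
proof -
  have corner: "\<bar>square_x s\<bar> = 1 \<and> \<bar>square_y s\<bar> = 1" if "s \<in> {0, 1/4, 1/2, 3/4, 1}" for s
    using that by (auto simp: square_x_def square_y_def)
  have side: "square_x (u/4) = square_x (3/4 - u/4)" "\<bar>square_y (u/4)\<bar> = 1" "\<bar>square_y (3/4 - u/4)\<bar> = 1"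
    "square_y (1/4 + u/4) = square_y (1 - u/4)" "\<bar>square_x (1/4 + u/4)\<bar> = 1" "\<bar>square_x (1 - u/4)\<bar> = 1"
    if "u \<in> {0..1}" for u
    using that square_loop_sides(1)[of "u/4"] square_loop_sides(2)[of "1/4 + u/4"]
      square_loop_sides(3)[of "3/4 - u/4"] square_loop_sides(4)[of "1 - u/4"] by auto
  from assms consider "s \<in> {0, 1/4, 1/2, 3/4, 1}" "s' \<in> {0, 1/4, 1/2, 3/4, 1}"
    | u where "u \<in> {0..1}" "s = u/4" "s' = 3/4 - u/4" | u where "u \<in> {0..1}" "s = 3/4 - u/4" "s' = u/4"
    | u where "u \<in> {0..1}" "s = 1/4 + u/4" "s' = 1 - u/4" | u where "u \<in> {0..1}" "s = 1 - u/4" "s' = 1/4 + u/4"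
    unfolding torus_gluing_def by blast
  then show ?thesis
  proof cases
    case 1
    then show ?thesis
      using corner by blast
  next
    case (2 u)
    show ?thesis
      unfolding 2(2,3) using side[OF 2(1)] by blast
  next
    case (3 u)
    show ?thesis
      unfolding 3(2,3) using side[OF 3(1)] by metis
  next
    case (4 u)
    show ?thesis
      unfolding 4(2,3) using side[OF 4(1)] by blast
  next
    case (5 u)
    show ?thesis
      unfolding 5(2,3) using side[OF 5(1)] by metis
  qed
qed

lemma antipodal_gluingI:
  assumes "s \<in> {0..1}" "s' \<in> {0..1}" "square_x s = - square_x s'" "square_y s = - square_y s'"
  shows "antipodal_gluing s s'"
proof -
  consider "s' = 1/2 + s" | "s = 1/2 + s'" | "s = 1/2" "s' = 0" | "s = 1/2" "s' = 1"
  proof (rule square_side_cases[OF assms(1)], goal_cases)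
    case 1
    then have "square_y s' = -1"
      using assms(4) by simp
    then have "s' = 1/2 + s"
      using square_sideD(3)[OF assms(2)] assms(3) 1 by linarith
    then show ?case
      by (rule 1(1))
  next
    case 2
    then have "square_x s' = 1"
      using assms(3) by simp
    then consider "square_y s' = 8 * s' - 7" | "s' = 0" "square_y s' = 1"
      using square_sideD(4)[OF assms(2)] by blast
    then have "s' = 1/2 + s \<or> s = 1/2 \<and> s' = 0"
      by cases (use assms(4) 2(8) in linarith)+
    then show ?case
      using 2(1,3) by blast
  next
    case 3
    then have "square_y s' = 1"
      using assms(4) by simp
    then consider "square_x s' = 1 - 8 * s'" | "s' = 1" "square_x s' = 1"
      using square_sideD(1)[OF assms(2)] by blast
    then have "s = 1/2 + s' \<or> s = 1/2 \<and> s' = 1"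
      by cases (use assms(3) 3(7) in linarith)+
    then show ?case
      using 3(2,4) by blast
  next
    case 4
    then have "square_x s' = -1"
      using assms(3) by simp
    then have "s = 1/2 + s'"
      using square_sideD(2)[OF assms(2)] assms(4) 4 by linarith
    then show ?case
      by (rule 4(2))
  qed
  then show ?thesis
  proof cases
    case 1
    then show ?thesis
      unfolding antipodal_gluing_def using assms(1,2) by (intro disjI2 bexI[of _ "2 * s"]) auto
  next
    case 2
    then show ?thesis
      unfolding antipodal_gluing_def using assms(1,2) by (intro disjI2 bexI[of _ "2 * s'"]) auto
  qed (simp_all add: antipodal_gluing_def)
qed

lemma antipodal_gluingD:
  assumes "antipodal_gluing s s'"
  shows "square_loop s' = square_loop s \<or> square_loop s' = - square_loop s"
proof -
  have corner: "square_loop s = Complex 1 1 \<or> square_loop s = - Complex 1 1" if "s \<in> {0, 1/2, 1}" for s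
    using that by (auto simp: square_loop_def square_x_def square_y_def complex_eq_iff)
  have side: "square_loop (1/2 + u/2) = - square_loop (u/2)" if u: "u \<in> {0..1}" for u
    using u square_loop_sides(1,2)[of "u/2"] square_loop_sides(3,4)[of "1/2 + u/2"]
    by (cases "u \<le> 1/2") (auto simp: square_loop_def complex_eq_iff)
  from assms consider "s \<in> {0, 1/2, 1}" "s' \<in> {0, 1/2, 1}"
    | u where "u \<in> {0..1}" "s = u/2" "s' = 1/2 + u/2" | u where "u \<in> {0..1}" "s = 1/2 + u/2" "s' = u/2"
    unfolding antipodal_gluing_def by blast
  then show ?thesis
  proof cases
    case 1
    then show ?thesis
      using corner[OF 1(1)] corner[OF 1(2)] by (metis minus_minus)
  next
    case (2 u)
    show ?thesis
      unfolding 2(2,3) using side[OF 2(1)] by blast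
  next
    case (3 u)
    show ?thesis
      unfolding 3(2,3) using side[OF 3(1)] by (metis minus_minus)
  qed
qed

text \<open>Polar coordinates on the part outside the unit disc of a starlike region of the plane: the ray
  through \<open>square_loop s\<close> is parametrized from the unit circle (\<open>t = 0\<close>) to the boundary of the
  region (\<open>t = 1\<close>), where \<open>R s\<close> is the length of the ray in units of \<open>square_loop s\<close>. The torus is
  the square of side \<open>2 * pi\<close> and the projective plane is the disc of radius \<open>2\<close>, both with
  identifications on the boundary only.\<close>

definition radial :: "(real \<Rightarrow> real) \<Rightarrow> real \<times> real \<Rightarrow> real" where
  "radial R = (\<lambda>(s, t). (1 - t) / cmod (square_loop s) + t * R s)"

definition polar :: "(real \<Rightarrow> real) \<Rightarrow> real \<times> real \<Rightarrow> complex" where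
  "polar R v = of_real (radial R v) * square_loop (fst v)"

locale polar_region =
  fixes R :: "real \<Rightarrow> real"
  assumes R_continuous: "continuous_on {0..1} R"
    and R_large: "s \<in> {0..1} \<Longrightarrow> 1 / cmod (square_loop s) < R s"
    and R_ends: "R 0 = R 1"
begin

lemma radial_eq:
  "radial R (s, t) = 1 / cmod (square_loop s) + t * (R s - 1 / cmod (square_loop s))"
  by (simp add: radial_def divide_inverse algebra_simps)

lemma radial_bounds:
  assumes "s \<in> {0..1}" "t \<in> {0..1}"
  shows "1 / cmod (square_loop s) \<le> radial R (s, t)" "radial R (s, t) \<le> R s"
    "radial R (s, t) = R s \<Longrightarrow> t = 1" "0 < radial R (s, t)"
proof -
  let ?a = "1 / cmod (square_loop s)"
  have a: "0 < ?a"
    using square_loop_pos[OF assms(1)] by simp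
  have e: "radial R (s, t) = ?a + t * (R s - ?a)" "R s = radial R (s, t) + (1 - t) * (R s - ?a)"
    by (simp_all add: radial_eq divide_inverse algebra_simps)
  have "0 \<le> t * (R s - ?a)" "0 \<le> (1 - t) * (R s - ?a)"
    using assms R_large[OF assms(1)] by auto
  then show "1 / cmod (square_loop s) \<le> radial R (s, t)" "radial R (s, t) \<le> R s" "0 < radial R (s, t)"
    using e a by linarith+
  show "t = 1" if "radial R (s, t) = R s"
    using e(2) that R_large[OF assms(1)] by simp
qed

lemma radial_inj:
  assumes "s \<in> {0..1}" "radial R (s, t) = radial R (s, t')"
  shows "t = t'"
proof -
  have "radial R (s, t) - radial R (s, t') = (t - t') * (R s - 1 / cmod (square_loop s))"
    by (simp add: radial_eq divide_inverse algebra_simps)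
  then show ?thesis
    using R_large[OF assms(1)] assms(2) by simp
qed

lemma polar_continuous: "continuous_on unit_square (polar R)"
proof -
  have "continuous_on unit_square (\<lambda>v. square_loop (fst v))"
    by (rule continuous_on_compose2[OF square_loop_continuous[of UNIV]]) (auto intro!: continuous_intros)
  moreover have "continuous_on unit_square (\<lambda>v. R (fst v))"
    by (rule continuous_on_compose2[OF R_continuous]) (auto intro!: continuous_intros)
  moreover have "cmod (square_loop (fst v)) \<noteq> 0" if "v \<in> unit_square" for v :: "real \<times> real"
    using square_loop_pos[of "fst v"] that by auto
  ultimately show ?thesis
    unfolding polar_def[abs_def] radial_def case_prod_beta by (intro continuous_intros) auto
qed

lemma polar_start: "s \<in> {0..1} \<Longrightarrow> polar R (s, 0) = sgn (square_loop s)"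
  by (simp add: polar_def radial_def sgn_div_norm scaleR_conv_of_real divide_inverse mult.commute)

lemma polar_end: "polar R (s, 1) = of_real (R s) * square_loop s"
  by (simp add: polar_def radial_def)

lemma polar_ends: "polar R (0, t) = polar R (1, t)"
  by (simp add: polar_def radial_def square_loop_ends R_ends)

lemma maxnorm_polar:
  "s \<in> {0..1} \<Longrightarrow> t \<in> {0..1} \<Longrightarrow> maxnorm (polar R (s, t)) = radial R (s, t)"
  using radial_bounds(4)[of s t] by (simp add: polar_def maxnorm_scale maxnorm_square_loop)

lemma norm_polar:
  assumes "s \<in> {0..1}" "t \<in> {0..1}"
  shows "cmod (polar R (s, t)) = 1 - t + t * R s * cmod (square_loop s)" "1 \<le> cmod (polar R (s, t))"
proof -
  have n: "0 < cmod (square_loop s)"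
    by (rule square_loop_pos[OF assms(1)])
  have "cmod (polar R (s, t)) = radial R (s, t) * cmod (square_loop s)"
    using radial_bounds(4)[OF assms] by (simp add: polar_def norm_mult)
  then show "cmod (polar R (s, t)) = 1 - t + t * R s * cmod (square_loop s)"
    using n by (simp add: radial_def distrib_right)
  show "1 \<le> cmod (polar R (s, t))"
    using radial_bounds(1)[OF assms] n \<open>cmod (polar R (s, t)) = radial R (s, t) * _\<close>
    by (simp add: divide_le_eq)
qed

lemma polar_inj:
  assumes "s \<in> {0..1}" "t \<in> {0..1}" "s' \<in> {0..1}" "t' \<in> {0..1}" "polar R (s, t) = polar R (s', t')"
  shows "t = t'" "s = s' \<or> {s, s'} = {0, 1}"
proof -
  have r: "radial R (s, t) = radial R (s', t')"
    using maxnorm_polar assms by metis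
  then have "square_loop s = square_loop s'"
    using assms(5) radial_bounds(4)[OF assms(1,2)] by (simp add: polar_def)
  then show s: "s = s' \<or> {s, s'} = {0, 1}"
    using square_loop_inj assms(1,3) by (simp add: square_loop_def)
  have "radial R (0, t') = radial R (1, t')"
    by (simp add: radial_def square_loop_ends R_ends)
  then show "t = t'"
    using s r radial_inj[OF assms(1)] by (auto simp: doubleton_eq_iff)
qed

lemma polar_surj:
  assumes "1 \<le> cmod z" "\<And>s. s \<in> {0..1} \<Longrightarrow> z = of_real (maxnorm z) * square_loop s \<Longrightarrow> maxnorm z \<le> R s"
  shows "z \<in> polar R ` unit_square"
proof -
  have "z \<noteq> 0"
    using assms(1) by auto
  then have m: "0 < maxnorm z"
    by (rule maxnorm_pos)
  obtain s where s: "s \<in> {0..1}" and z: "z = of_real (maxnorm z) * square_loop s"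
    using square_loop_direction[OF \<open>z \<noteq> 0\<close>] by blast
  let ?a = "1 / cmod (square_loop s)"
  have "cmod z = maxnorm z * cmod (square_loop s)"
    using m by (subst z) (simp add: norm_mult)
  then have "?a \<le> maxnorm z"
    using assms(1) square_loop_pos[OF s] by (simp add: divide_le_eq)
  moreover have "?a < R s" "maxnorm z \<le> R s"
    using R_large[OF s] assms(2)[OF s z] by auto
  moreover have "(x - a) / (b - a) \<in> {0..1}" if "a \<le> x" "a < b" "x \<le> b" for a b x :: real
    using that by simp
  ultimately have t: "(maxnorm z - ?a) / (R s - ?a) \<in> {0..1}"
    by blast
  have "radial R (s, (maxnorm z - ?a) / (R s - ?a)) = ?a + (maxnorm z - ?a) / (R s - ?a) * (R s - ?a)"
    by (rule radial_eq)
  also have "\<dots> = maxnorm z"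
    using \<open>?a < R s\<close> by simp
  finally have "polar R (s, (maxnorm z - ?a) / (R s - ?a)) = z"
    using z by (simp add: polar_def)
  then show ?thesis
    using s t by (metis (no_types, lifting) SigmaI imageI)
qed

end

text \<open>The surface \<open>X\<close> with the open disc removed is a cylinder \<open>P\<close>, cut open along \<open>s = 0\<close>, whose end
  \<open>t = 0\<close> is the boundary of the disc and whose other end is folded up by \<open>W\<close>.\<close>

definition collar_model ::
  "'a topology \<Rightarrow> (complex \<Rightarrow> 'a) \<Rightarrow> (real \<times> real \<Rightarrow> 'a) \<Rightarrow> (real \<Rightarrow> real \<Rightarrow> bool) \<Rightarrow> bool" where
  "collar_model X d P W \<longleftrightarrow>
    continuous_map (top_of_set unit_square) X P \<and>
    P ` unit_square = topspace X - d ` ball 0 1 \<and>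
    (\<forall>s\<in>{0..1}. P (s, 0) = d (sgn (square_loop s))) \<and>
    (\<forall>t\<in>{0..1}. P (0, t) = P (1, t)) \<and>
    (\<forall>s\<in>{0..1}. \<forall>s'\<in>{0..1}. W s s' \<longrightarrow> P (s, 1) = P (s', 1)) \<and>
    (\<forall>s\<in>{0..1}. \<forall>t\<in>{0..1}. \<forall>s'\<in>{0..1}. \<forall>t'\<in>{0..1}. P (s, t) = P (s', t') \<longrightarrow>
      t = t' \<and> (s = s' \<or> {s, s'} = {0, 1} \<or> (t = 1 \<and> W s s')))"

lemma collar_modelD:
  assumes "collar_model X d P W"
  shows "continuous_map (top_of_set unit_square) X P" "P ` unit_square = topspace X - d ` ball 0 1"
    "\<And>s. s \<in> {0..1} \<Longrightarrow> P (s, 0) = d (sgn (square_loop s))"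
    "\<And>t. t \<in> {0..1} \<Longrightarrow> P (0, t) = P (1, t)"
    "\<And>s s'. s \<in> {0..1} \<Longrightarrow> s' \<in> {0..1} \<Longrightarrow> W s s' \<Longrightarrow> P (s, 1) = P (s', 1)"
    "\<And>s t s' t'. s \<in> {0..1} \<Longrightarrow> t \<in> {0..1} \<Longrightarrow> s' \<in> {0..1} \<Longrightarrow> t' \<in> {0..1} \<Longrightarrow>
      P (s, t) = P (s', t') \<Longrightarrow> t = t' \<and> (s = s' \<or> {s, s'} = {0, 1} \<or> (t = 1 \<and> W s s'))"
  using assms unfolding collar_model_def by blast+

lemma cis_eq_cases:
  assumes "cis a = cis b" "\<bar>a\<bar> \<le> pi" "\<bar>b\<bar> \<le> pi"
  shows "a = b \<or> \<bar>a\<bar> = pi \<and> \<bar>b\<bar> = pi"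
proof -
  have "sin a = sin b \<and> cos a = cos b"
    using assms(1) by (simp add: complex_eq_iff)
  then obtain n :: int where n: "a = b + 2 * pi * n"
    using sin_cos_eq_iff by metis
  have "\<bar>a - b\<bar> \<le> 2 * pi"
    using assms(2,3) by linarith
  then have "2 * pi * \<bar>real_of_int n\<bar> \<le> 2 * pi * 1"
    using n by (simp add: abs_mult)
  then have "\<bar>n\<bar> \<le> 1"
    by simp
  then consider "n = 0" | "n = 1" | "n = -1"
    by linarith
  then show ?thesis
    using n assms(2,3) by cases auto
qed

lemma torus_disc_eq_cases:
  assumes "torus_disc z = torus_disc w" "maxnorm z \<le> pi" "maxnorm w \<le> pi"
  shows "Re z = Re w \<or> \<bar>Re z\<bar> = pi \<and> \<bar>Re w\<bar> = pi" "Im z = Im w \<or> \<bar>Im z\<bar> = pi \<and> \<bar>Im w\<bar> = pi"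
  using assms cis_eq_cases by (auto simp: torus_disc_def maxnorm_def)

lemma cis_eq_of_abs_pi:
  assumes "a = b \<or> \<bar>a\<bar> = pi \<and> \<bar>b\<bar> = pi"
  shows "cis a = cis b"
proof -
  have "a = b \<or> (a = pi \<or> a = - pi) \<and> (b = pi \<or> b = - pi)"
    using assms by linarith
  then show ?thesis
    by (auto simp: complex_eq_iff)
qed

interpretation torus_region: polar_region "\<lambda>_. pi"
proof
  show "1 / cmod (square_loop s) < pi" if "s \<in> {0..1}" for s
  proof -
    have "1 / cmod (square_loop s) \<le> 1"
      using square_loop_norm[OF that] square_loop_pos[OF that] by (simp add: divide_le_eq)
    then show ?thesis
      using pi_gt3 by linarith
  qed
qed auto

text \<open>\<open>torus_disc\<close> is defined on the whole plane, and it is injective on the square \<open>[-pi, pi]\<^sup>2\<close> up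
  to the identification of opposite sides; the disc lies in the interior of this square.\<close>

lemma torus_collar_model: "collar_model torus torus_disc (torus_disc \<circ> polar (\<lambda>_. pi)) torus_gluing"
  unfolding collar_model_def
proof (intro conjI ballI impI)
  let ?p = "polar (\<lambda>_. pi)"
  have m: "maxnorm (?p (s, t)) \<le> pi" if "s \<in> {0..1}" "t \<in> {0..1}" for s t
    using torus_region.maxnorm_polar[OF that] torus_region.radial_bounds(2)[OF that] by simp
  have "continuous_on UNIV torus_disc"
    unfolding torus_disc_def[abs_def] by (intro continuous_intros)
  then have "continuous_on unit_square (torus_disc \<circ> ?p)"
    by (intro continuous_on_compose torus_region.polar_continuous) (auto intro: continuous_on_subset)
  then show "continuous_map (top_of_set unit_square) torus (torus_disc \<circ> ?p)"
    by (auto simp: torus_def torus_disc_def)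
  show "(torus_disc \<circ> ?p) ` unit_square = topspace torus - torus_disc ` ball 0 1"
  proof (intro equalityI subsetI)
    fix y assume "y \<in> (torus_disc \<circ> ?p) ` unit_square"
    then obtain s t where st: "s \<in> {0..1}" "t \<in> {0..1}" "y = torus_disc (?p (s, t))"
      by auto
    have "y \<noteq> torus_disc w" if w: "w \<in> ball 0 1" for w
    proof
      assume "y = torus_disc w"
      have "maxnorm w < 1"
        using w maxnorm_le[of w] by simp
      then have "maxnorm w < pi" and re: "\<bar>Re w\<bar> < pi" "\<bar>Im w\<bar> < pi"
        using pi_gt3 by (auto simp: maxnorm_def)
      then have "?p (s, t) = w"
        using torus_disc_eq_cases[of "?p (s, t)" w] \<open>y = torus_disc w\<close> st m[OF st(1,2)]
        by (auto simp: complex_eq_iff)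
      then show False
        using torus_region.norm_polar(2)[OF st(1,2)] w by simp
    qed
    moreover have "y \<in> topspace torus"
      by (simp add: st(3) torus_def torus_disc_def)
    ultimately show "y \<in> topspace torus - torus_disc ` ball 0 1"
      by blast
  next
    fix y assume y: "y \<in> topspace torus - torus_disc ` ball 0 1"
    let ?z = "Complex (Arg (fst y)) (Arg (snd y))"
    have "cis (Arg a) = a" if "cmod a = 1" for a
    proof -
      have "a \<noteq> 0"
        using that by auto
      then show ?thesis
        using cis_Arg[of a] that by (simp add: sgn_div_norm)
    qed
    then have y_eq: "y = torus_disc ?z"
      using y by (cases y) (auto simp: torus_def torus_disc_def)
    then have "1 \<le> cmod ?z"
      using y by (force simp: not_less[symmetric])
    moreover have "maxnorm ?z \<le> pi"
      using Arg_bounded[of "fst y"] Arg_bounded[of "snd y"] by (auto simp: maxnorm_def)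
    ultimately have "?z \<in> ?p ` unit_square"
      by (intro torus_region.polar_surj) auto
    then show "y \<in> (torus_disc \<circ> ?p) ` unit_square"
      using y_eq by (metis image_comp imageI)
  qed
  show "(torus_disc \<circ> ?p) (s, 0) = torus_disc (sgn (square_loop s))" if "s \<in> {0..1}" for s
    using torus_region.polar_start[OF that] by simp
  show "(torus_disc \<circ> ?p) (0, t) = (torus_disc \<circ> ?p) (1, t)" for t
    using torus_region.polar_ends by simp
  show "(torus_disc \<circ> ?p) (s, 1) = (torus_disc \<circ> ?p) (s', 1)"
    if "s \<in> {0..1}" "s' \<in> {0..1}" "torus_gluing s s'" for s s'
    using torus_gluingD[OF that(3)]
    by (auto simp: torus_region.polar_end torus_disc_def square_loop_def abs_mult intro!: cis_eq_of_abs_pi)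
  fix s t s' t'
  assume st: "s \<in> {0..1}" "t \<in> {0..1}" "s' \<in> {0..1}" "t' \<in> {0..1}"
    and eq: "(torus_disc \<circ> ?p) (s, t) = (torus_disc \<circ> ?p) (s', t')"
  note c = torus_disc_eq_cases[of "?p (s, t)" "?p (s', t')", OF _ m[OF st(1,2)] m[OF st(3,4)]]
  have top: "t = 1" if "maxnorm (?p (s, t)) = pi" "s \<in> {0..1}" "t \<in> {0..1}" for s t
    using torus_region.maxnorm_polar[OF that(2,3)] torus_region.radial_bounds(3)[OF that(2,3)] that(1) by simp
  have "t = t' \<and> (s = s' \<or> {s, s'} = {0, 1})" if "?p (s, t) = ?p (s', t')"
    using torus_region.polar_inj[OF st that] by simp
  moreover have "t = 1 \<and> t' = 1 \<and> (s = s' \<or> torus_gluing s s')" if "?p (s, t) \<noteq> ?p (s', t')"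
  proof -
    have "maxnorm (?p (s, t)) = pi \<and> maxnorm (?p (s', t')) = pi"
      using c eq that m[OF st(1,2)] m[OF st(3,4)] by (auto simp: maxnorm_def complex_eq_iff max_def split: if_splits)
    then have t: "t = 1" "t' = 1"
      using top st by auto
    then show ?thesis
      using c eq by (intro conjI torus_gluingI st)
        (auto simp: torus_region.polar_end square_loop_def abs_mult)
  qed
  ultimately show "t = t'" "s = s' \<or> {s, s'} = {0, 1} \<or> t = 1 \<and> torus_gluing s s'"
    by blast+
qed


interpretation disc_region: polar_region "\<lambda>s. 2 / cmod (square_loop s)"
proof
  show "continuous_on {0..1} (\<lambda>s. 2 / cmod (square_loop s))"
    using square_loop_pos by (intro continuous_intros square_loop_continuous) fastforce
  show "1 / cmod (square_loop s) < 2 / cmod (square_loop s)" if "s \<in> {0..1}" for s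
    using square_loop_pos[OF that] by (simp add: divide_strict_right_mono)
qed (simp add: square_loop_ends)

lemma projective_disc_eq_cases:
  assumes "projective_disc z = projective_disc w" "cmod z \<le> 2" "cmod w \<le> 2"
  shows "z = w \<or> z = - w \<and> cmod z = 2"
proof -
  let ?h = "\<lambda>z::complex. sqrt (1 - (cmod z / 2)\<^sup>2)"
  have nonneg: "0 \<le> ?h z" "0 \<le> ?h w"
    using assms(2,3) power_le_one[of "cmod z / 2" 2] power_le_one[of "cmod w / 2" 2] by simp_all
  from assms(1) consider "(z / 2, ?h z) = (w / 2, ?h w)" | "(z / 2, ?h z) = - (w / 2, ?h w)"
    by (auto simp: projective_disc_def Let_def doubleton_eq_iff)
  then show ?thesis
  proof cases
    case 2
    then have "z = - w" and "?h z = 0"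
      using nonneg by auto
    then have "(cmod z / 2)\<^sup>2 = 1\<^sup>2"
      by simp
    then have "cmod z / 2 = 1"
      by (subst (asm) power2_eq_iff_nonneg) auto
    then show ?thesis
      using \<open>z = - w\<close> by simp
  qed simp
qed

lemma projective_disc_antipodal: "cmod z = 2 \<Longrightarrow> projective_disc (- z) = projective_disc z"
  by (auto simp: projective_disc_def Let_def)

text \<open>\<open>projective_disc z\<close> is the pair represented by the point of the upper hemisphere above \<open>z / 2\<close>.
  The upper hemisphere meets every pair of antipodal points, and only its boundary, the equator,
  contains both members of a pair.\<close>

lemma projective_collar_model:
  "collar_model projective_plane projective_disc
    (projective_disc \<circ> polar (\<lambda>s. 2 / cmod (square_loop s))) antipodal_gluing"
  unfolding collar_model_def
proof (intro conjI ballI impI)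
  let ?p = "polar (\<lambda>s. 2 / cmod (square_loop s))"
  let ?S = "sphere 0 1 :: (complex \<times> real) set"
  let ?v = "\<lambda>z::complex. (z / 2, sqrt (1 - (cmod z / 2)\<^sup>2))"
  have disc: "projective_disc z = {?v z, - ?v z}" for z
    by (simp add: projective_disc_def Let_def)
  have n: "cmod (?p (s, t)) = 1 + t" if "s \<in> {0..1}" "t \<in> {0..1}" for s t
    using disc_region.norm_polar(1)[OF that] square_loop_pos[OF that(1)] by simp
  have n2: "cmod (?p v) \<le> 2" if "v \<in> unit_square" for v
    using n[of "fst v" "snd v"] that by auto
  have sphere: "?v z \<in> ?S" if "cmod z \<le> 2" for z
  proof -
    have "(cmod z / 2)\<^sup>2 \<le> 1"
      using that power_le_one[of "cmod z / 2" 2] by simp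
    then show ?thesis
      by (simp add: norm_Pair power_divide)
  qed
  have quotient: "continuous_map (top_of_set ?S) projective_plane (\<lambda>v. {v, - v})"
    and top: "topspace projective_plane = (\<lambda>v. {v, - v}) ` ?S"
    using quotient_map_quotient_topology[of "top_of_set ?S" "\<lambda>v. {v, - v}"]
    by (auto simp: projective_plane_def quotient_map_def intro: quotient_imp_continuous_map[OF quotient_map_quotient_topology])
  have "continuous_on unit_square (\<lambda>v. ?v (?p v))"
    by (intro continuous_intros disc_region.polar_continuous) auto
  then have "continuous_map (top_of_set unit_square) (top_of_set ?S) (\<lambda>v. ?v (?p v))"
    using sphere[OF n2] by (simp only: continuous_map_subtopology_eu) blast
  then have "continuous_map (top_of_set unit_square) projective_plane ((\<lambda>v. {v, - v}) \<circ> (\<lambda>v. ?v (?p v)))"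
    using quotient by (rule continuous_map_compose)
  then show "continuous_map (top_of_set unit_square) projective_plane (projective_disc \<circ> ?p)"
    by (simp add: comp_def disc)
  show "(projective_disc \<circ> ?p) ` unit_square = topspace projective_plane - projective_disc ` ball 0 1"
  proof (intro equalityI subsetI)
    fix y assume "y \<in> (projective_disc \<circ> ?p) ` unit_square"
    then obtain s t where st: "s \<in> {0..1}" "t \<in> {0..1}" "y = projective_disc (?p (s, t))"
      by auto
    have "y \<noteq> projective_disc w" if w: "w \<in> ball 0 1" for w
    proof
      assume "y = projective_disc w"
      then have "?p (s, t) = w \<or> ?p (s, t) = - w"
        using projective_disc_eq_cases[of "?p (s, t)" w] n2[of "(s, t)"] st w by auto
      then have "cmod (?p (s, t)) = cmod w"
        by auto
      then show False
        using n[OF st(1,2)] w st(2) by simp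
    qed
    moreover have "y \<in> topspace projective_plane"
      unfolding top st(3) disc using sphere[OF n2[of "(s, t)"]] st(1,2) by blast
    ultimately show "y \<in> topspace projective_plane - projective_disc ` ball 0 1"
      by blast
  next
    fix y assume y: "y \<in> topspace projective_plane - projective_disc ` ball 0 1"
    then obtain a where a: "a \<in> ?S" "y = {a, - a}"
      by (auto simp: top)
    define b where "b = (if 0 \<le> snd a then a else - a)"
    have b: "norm b = 1" "y = {b, - b}" "0 \<le> snd b"
      using a by (auto simp: b_def)
    let ?z = "2 * fst b"
    have "(cmod (fst b))\<^sup>2 + (snd b)\<^sup>2 = 1"
      using b(1) by (cases b) (simp add: norm_Pair real_sqrt_eq_1_iff)
    then have sq: "1 - (cmod (fst b))\<^sup>2 = (snd b)\<^sup>2"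
      by simp
    then have "?v ?z = b"
      using b(3) by (cases b) (simp add: norm_mult)
    then have y_eq: "y = projective_disc ?z"
      using b(2) disc[of ?z] by metis
    have "(cmod (fst b))\<^sup>2 \<le> 1"
      using sq zero_le_power2[of "snd b"] by linarith
    then have z2: "cmod ?z \<le> 2"
      using power2_le_imp_le[of "cmod (fst b)" 1] by (simp add: norm_mult)
    have "1 \<le> cmod ?z"
      using y y_eq by (force simp: not_less[symmetric])
    moreover have "maxnorm ?z \<le> 2 / cmod (square_loop s)"
      if "s \<in> {0..1}" "?z = of_real (maxnorm ?z) * square_loop s" for s
    proof -
      have "0 \<le> maxnorm ?z"
        by (simp add: maxnorm_def)
      then have "cmod ?z = maxnorm ?z * cmod (square_loop s)"
        by (subst that(2)) (simp add: norm_mult)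
      then show ?thesis
        using z2 square_loop_pos[OF that(1)] by (simp add: le_divide_eq)
    qed
    ultimately have "?z \<in> ?p ` unit_square"
      by (rule disc_region.polar_surj)
    then show "y \<in> (projective_disc \<circ> ?p) ` unit_square"
      using y_eq by (metis image_comp imageI)
  qed
  show "(projective_disc \<circ> ?p) (s, 0) = projective_disc (sgn (square_loop s))" if "s \<in> {0..1}" for s
    using disc_region.polar_start[OF that] by simp
  show "(projective_disc \<circ> ?p) (0, t) = (projective_disc \<circ> ?p) (1, t)" for t
    using disc_region.polar_ends by simp
  show "(projective_disc \<circ> ?p) (s, 1) = (projective_disc \<circ> ?p) (s', 1)"
    if s: "s \<in> {0..1}" "s' \<in> {0..1}" "antipodal_gluing s s'" for s s'
  proof -
    have "?p (s', 1) = ?p (s, 1) \<or> ?p (s', 1) = - ?p (s, 1)"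
      using antipodal_gluingD[OF s(3)] by (auto simp: disc_region.polar_end)
    moreover have "cmod (?p (s, 1)) = 2"
      using n[OF s(1), of 1] by simp
    ultimately show ?thesis
      using projective_disc_antipodal[of "?p (s, 1)"] by (metis comp_apply)
  qed
  fix s t s' t'
  assume st: "s \<in> {0..1}" "t \<in> {0..1}" "s' \<in> {0..1}" "t' \<in> {0..1}"
    and eq: "(projective_disc \<circ> ?p) (s, t) = (projective_disc \<circ> ?p) (s', t')"
  have "?p (s, t) = ?p (s', t') \<or> ?p (s, t) = - ?p (s', t') \<and> cmod (?p (s, t)) = 2"
    using eq n2[of "(s, t)"] n2[of "(s', t')"] st by (intro projective_disc_eq_cases) auto
  then consider "?p (s, t) = ?p (s', t')" | "?p (s, t) = - ?p (s', t')" "cmod (?p (s, t)) = 2"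
    by blast
  then have "t = t' \<and> (s = s' \<or> {s, s'} = {0, 1} \<or> t = 1 \<and> antipodal_gluing s s')"
  proof cases
    case 1
    then show ?thesis
      using disc_region.polar_inj[OF st] by blast
  next
    case 2
    then have "t = 1" "t' = 1"
      using n[OF st(1,2)] n[OF st(3,4)] by auto
    have m: "maxnorm (- z) = maxnorm z" for z
      by (simp add: maxnorm_def)
    have "radial (\<lambda>s. 2 / cmod (square_loop s)) (s, t) = radial (\<lambda>s. 2 / cmod (square_loop s)) (s', t')"
      using disc_region.maxnorm_polar[OF st(1,2)] disc_region.maxnorm_polar[OF st(3,4)] 2(1) m
      by simp
    then have "of_real (radial (\<lambda>s. 2 / cmod (square_loop s)) (s, t)) * (square_loop s + square_loop s') = 0"
      using 2(1) by (simp add: polar_def distrib_left)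
    then have "square_loop s + square_loop s' = 0"
      using disc_region.radial_bounds(4)[OF st(1,2)] by simp
    then have "antipodal_gluing s s'"
      by (intro antipodal_gluingI st) (auto simp: square_loop_def complex_eq_iff eq_neg_iff_add_eq_0)
    then show ?thesis
      using \<open>t = 1\<close> \<open>t' = 1\<close> by simp
  qed
  then show "t = t'" "s = s' \<or> {s, s'} = {0, 1} \<or> t = 1 \<and> antipodal_gluing s s'"
    by blast+
qed

text \<open>The two cylinders are joined along the common circle, with the first in the upper half of the
  square and the second, turned upside down, in the lower half. Both parametrize the circle by the
  same \<open>square_loop\<close>, so the gluing of the surfaces is the identity along \<open>t = 1/2\<close>.\<close>

lemma square_model_of_connected_sum:
  fixes N :: "'c::topological_space set"
  assumes sum: "connected_sum X d Y e (top_of_set N)"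
    and X: "collar_model X d P W" and Y: "collar_model Y e Q V"
  obtains q where "square_model N q W V"
proof -
  define X' Y' where "X' = topspace X - d ` ball 0 1" and "Y' = topspace Y - e ` ball 0 1"
  obtain i j where i: "embedding_map (subtopology X X') (top_of_set N) i"
      and j: "embedding_map (subtopology Y Y') (top_of_set N) j" and N: "i ` X' \<union> j ` Y' = N"
      and ij: "\<And>x y. x \<in> X' \<Longrightarrow> y \<in> Y' \<Longrightarrow> i x = j y \<longleftrightarrow> (\<exists>z\<in>sphere 0 1. x = d z \<and> y = e z)"
    using sum unfolding connected_sum_def Let_def X'_def[symmetric] Y'_def[symmetric] by auto
  note P = collar_modelD[OF X, folded X'_def] and Q = collar_modelD[OF Y, folded Y'_def]
  have PX: "P (s, t) \<in> X'" and QY: "Q (s, t) \<in> Y'" if "s \<in> {0..1}" "t \<in> {0..1}" for s t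
    using P(2) Q(2) that by blast+
  have top: "topspace (subtopology X X') = X'" "topspace (subtopology Y Y') = Y'"
    by (auto simp: X'_def Y'_def)
  have i_inj: "inj_on i X'" and j_inj: "inj_on j Y'"
    using i j top by (auto simp: embedding_map_def homeomorphic_imp_injective_map dest: homeomorphic_imp_injective_map)
  have ic: "continuous_map (subtopology X X') (top_of_set N) i"
    and jc: "continuous_map (subtopology Y Y') (top_of_set N) j"
    using i j by (auto simp: embedding_map_def continuous_map_in_subtopology dest!: homeomorphic_imp_continuous_map)
  have "continuous_map (top_of_set unit_square) (subtopology X X') P"
    and "continuous_map (top_of_set unit_square) (subtopology Y Y') Q"
    using P(1,2) Q(1,2) by (auto simp: continuous_map_in_subtopology)
  then have iP: "continuous_on unit_square (i \<circ> P)" and jQ: "continuous_on unit_square (j \<circ> Q)"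
    using continuous_map_compose ic jc by (metis continuous_map_subtopology_eu)+
  have seam: "i (P (s, 0)) = j (Q (s, 0))" if s: "s \<in> {0..1}" for s
  proof -
    have "sgn (square_loop s) \<in> sphere 0 1"
      using square_loop_pos[OF s] by (simp add: norm_sgn)
    then show ?thesis
      using ij[OF PX QY, of s 0 s 0] s P(3)[OF s] Q(3)[OF s] by auto
  qed
  have zero: "0 \<in> {0..1::real}"
    by simp
  have seamD: "t = 0 \<and> t' = 0 \<and> (s = s' \<or> {s, s'} = {0, 1})"
    if st: "s \<in> {0..1}" "t \<in> {0..1}" "s' \<in> {0..1}" "t' \<in> {0..1}" and eq: "i (P (s, t)) = j (Q (s', t'))"
    for s t s' t'
  proof -
    obtain z where z: "z \<in> sphere 0 1" "P (s, t) = d z" "Q (s', t') = e z"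
      using ij[OF PX[OF st(1,2)] QY[OF st(3,4)]] eq by blast
    have "z \<noteq> 0"
      using z(1) by auto
    then have m: "0 < maxnorm z"
      by (rule maxnorm_pos)
    obtain r where r: "r \<in> {0..1}" "z = of_real (maxnorm z) * square_loop r"
      using square_loop_direction[OF \<open>z \<noteq> 0\<close>] by blast
    have "sgn z = sgn (square_loop r)"
      using m by (subst r(2)) (simp add: sgn_mult sgn_of_real)
    then have "sgn (square_loop r) = z"
      using z(1) by (simp add: sgn_div_norm)
    then have "P (s, t) = P (r, 0)" "Q (s', t') = Q (r, 0)"
      using z(2,3) P(3)[OF r(1)] Q(3)[OF r(1)] by auto
    then have "t = 0 \<and> (s = r \<or> {s, r} = {0, 1})" "t' = 0 \<and> (s' = r \<or> {s', r} = {0, 1})"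
      using P(6)[OF st(1,2) r(1) zero] Q(6)[OF st(3,4) r(1) zero] by (metis zero_neq_one)+
    then show ?thesis
      by (metis doubleton_eq_iff)
  qed
  define q where "q v = (if snd v \<le> 1/2 then j (Q (fst v, 1 - 2 * snd v)) else i (P (fst v, 2 * snd v - 1)))"
    for v :: "real \<times> real"
  have lower: "q (s, t) = j (Q (s, 1 - 2 * t))" if "t \<le> 1/2" for s t
    using that by (simp add: q_def)
  have upper: "q (s, t) = i (P (s, 2 * t - 1))" if "1/2 \<le> t" "s \<in> {0..1}" for s t
  proof (cases "t = 1/2")
    case True
    show ?thesis
      unfolding True using seam[OF that(2)] by (simp add: q_def)
  qed (use that in \<open>simp add: q_def\<close>)
  have "square_model N q W V"
    unfolding square_model_def
  proof (intro conjI ballI impI)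
    have "continuous_on unit_square
        (\<lambda>v. if snd v \<le> 1/2 then (j \<circ> Q) (fst v, 1 - 2 * snd v) else (i \<circ> P) (fst v, 2 * snd v - 1))"
    proof (rule continuous_on_cases_le)
      show "continuous_on {v \<in> unit_square. snd v \<le> 1/2} (\<lambda>v. (j \<circ> Q) (fst v, 1 - 2 * snd v))"
        by (rule continuous_on_compose2[OF jQ]) (auto intro!: continuous_intros)
      show "continuous_on {v \<in> unit_square. 1/2 \<le> snd v} (\<lambda>v. (i \<circ> P) (fst v, 2 * snd v - 1))"
        by (rule continuous_on_compose2[OF iP]) (auto intro!: continuous_intros)
      show "(j \<circ> Q) (fst v, 1 - 2 * snd v) = (i \<circ> P) (fst v, 2 * snd v - 1)"
        if v: "v \<in> unit_square" "snd v = 1/2" for v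
        unfolding v(2) using seam[of "fst v"] v(1) by auto
    qed (auto intro!: continuous_intros)
    then show "continuous_on unit_square q"
      by (simp add: q_def[abs_def] comp_def cong: if_cong)
    show "q ` unit_square = N"
    proof (intro equalityI subsetI)
      fix y assume "y \<in> q ` unit_square"
      then obtain s t where st: "s \<in> {0..1}" "t \<in> {0..1}" "y = q (s, t)"
        by auto
      show "y \<in> N"
      proof (cases "1/2 \<le> t")
        case True
        then show ?thesis
          using upper[OF True, of s] PX[OF st(1), of "2 * t - 1"] st N by auto
      next
        case False
        then show ?thesis
          using lower[of t s] QY[OF st(1), of "1 - 2 * t"] st N by auto
      qed
    next
      fix y assume "y \<in> N"
      then consider s t where "s \<in> {0..1}" "t \<in> {0..1}" "y = i (P (s, t))"
        | s t where "s \<in> {0..1}" "t \<in> {0..1}" "y = j (Q (s, t))"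
        using N P(2) Q(2) by (auto simp: image_iff)
      then show "y \<in> q ` unit_square"
      proof cases
        case (1 s t)
        then show ?thesis
          using upper[of "(1 + t) / 2" s] by (intro image_eqI[of _ _ "(s, (1 + t) / 2)"]) (auto simp: add_divide_distrib)
      next
        case (2 s t)
        then show ?thesis
          using lower[of "(1 - t) / 2" s] by (intro image_eqI[of _ _ "(s, (1 - t) / 2)"]) (auto simp: diff_divide_distrib)
      qed
    qed
    show "q (0, t) = q (1, t)" if "t \<in> {0..1}" for t
      using that P(4)[of "2 * t - 1"] Q(4)[of "1 - 2 * t"] by (auto simp: q_def)
    show "q (s, 1) = q (s', 1)" if "s \<in> {0..1}" "s' \<in> {0..1}" "W s s'" for s s'
      using P(5)[OF that] by (simp add: q_def)
    show "q (s, 0) = q (s', 0)" if "s \<in> {0..1}" "s' \<in> {0..1}" "V s s'" for s s'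
      using Q(5)[OF that] by (simp add: q_def)
    fix s t s' t'
    assume st: "s \<in> {0..1}" "t \<in> {0..1}" "s' \<in> {0..1}" "t' \<in> {0..1}" and eq: "q (s, t) = q (s', t')"
    consider "1/2 \<le> t" "1/2 \<le> t'" | "t \<le> 1/2" "t' \<le> 1/2" | "1/2 \<le> t" "t' \<le> 1/2" | "t \<le> 1/2" "1/2 \<le> t'"
      by linarith
    then have "t = t' \<and> (s = s' \<or> {s, s'} = {0, 1} \<or> t = 1 \<and> W s s' \<or> t = 0 \<and> V s s')"
    proof cases
      case 1
      have u: "2 * t - 1 \<in> {0..1}" "2 * t' - 1 \<in> {0..1}"
        using st 1 by auto
      have "P (s, 2 * t - 1) = P (s', 2 * t' - 1)"
        using inj_onD[OF i_inj _ PX[OF st(1) u(1)] PX[OF st(3) u(2)]] eq upper[OF 1(1) st(1)] upper[OF 1(2) st(3)] by simp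
      then show ?thesis
        using P(6)[OF st(1) u(1) st(3) u(2)] by auto
    next
      case 2
      have u: "1 - 2 * t \<in> {0..1}" "1 - 2 * t' \<in> {0..1}"
        using st 2 by auto
      have "Q (s, 1 - 2 * t) = Q (s', 1 - 2 * t')"
        using inj_onD[OF j_inj _ QY[OF st(1) u(1)] QY[OF st(3) u(2)]] eq lower[OF 2(1)] lower[OF 2(2)] by simp
      then show ?thesis
        using Q(6)[OF st(1) u(1) st(3) u(2)] by auto
    next
      case 3
      have u: "2 * t - 1 \<in> {0..1}" "1 - 2 * t' \<in> {0..1}"
        using st 3 by auto
      have "i (P (s, 2 * t - 1)) = j (Q (s', 1 - 2 * t'))"
        using eq upper[OF 3(1) st(1)] lower[OF 3(2)] by simp
      then show ?thesis
        using seamD[OF st(1) u(1) st(3) u(2)] by auto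
    next
      case 4
      have u: "1 - 2 * t \<in> {0..1}" "2 * t' - 1 \<in> {0..1}"
        using st 4 by auto
      have "i (P (s', 2 * t' - 1)) = j (Q (s, 1 - 2 * t))"
        using eq lower[OF 4(1)] upper[OF 4(2) st(3)] by simp
      then show ?thesis
        using seamD[OF st(3) u(2) st(1) u(1)] by auto
    qed
    then show "t = t'" "s = s' \<or> {s, s'} = {0, 1} \<or> t = 1 \<and> W s s' \<or> t = 0 \<and> V s s'"
      by blast+
  qed
  then show ?thesis
    by (rule that)
qed

section \<open>Labellings of a finite group which separate cosets\<close>

context group
begin

text \<open>Labellings of the elements of \<open>G\<close> by complex numbers are permuted by the translations of \<open>G\<close>.
  Outside the carrier the translations are the identity, so that they are bijections of the whole
  type. The right cosets of \<open>K\<close> are permuted by right translations, so that a translation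
  preserves injectivity on each of them. For \<open>K = carrier G\<close> the separating labellings are the
  ordered configurations of distinct points.\<close>

definition right_shift :: "'a \<Rightarrow> 'a \<Rightarrow> 'a" where
  "right_shift g h = (if h \<in> carrier G then h \<otimes> g else h)"

definition translate :: "'a \<Rightarrow> ('a \<Rightarrow> complex) \<Rightarrow> 'a \<Rightarrow> complex" where
  "translate g z = z \<circ> right_shift g"

definition separating :: "'a set \<Rightarrow> ('a \<Rightarrow> complex) set" where
  "separating K = {z. \<forall>g\<in>carrier G. inj_on (\<lambda>k. z (k \<otimes> g)) K}"

lemma right_shift_permutes:
  assumes "g \<in> carrier G"
  shows "right_shift g permutes carrier G"
proof (rule bij_imp_permutes)
  show "bij_betw (right_shift g) (carrier G) (carrier G)"
  proof (rule bij_betw_byWitness[where f' = "right_shift (inv g)"])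
    show "\<forall>h\<in>carrier G. right_shift (inv g) (right_shift g h) = h"
      "\<forall>h\<in>carrier G. right_shift g (right_shift (inv g) h) = h"
      using assms by (auto simp: right_shift_def m_assoc)
  qed (use assms in \<open>auto simp: right_shift_def\<close>)
qed (simp add: right_shift_def)

lemma topological_action_separating:
  assumes K: "K \<subseteq> carrier G"
  shows "topological_action G (separating K) translate"
proof
  show "continuous_on (separating K) (translate g)" for g
    unfolding translate_def comp_def
    by (intro continuous_on_coordinatewise_then_product)
      (rule continuous_on_product_then_coordinatewise[OF continuous_on_id])
  show "translate \<one> z = z" for z
    by (auto simp: translate_def right_shift_def)
  show "translate (g \<otimes> h) z = translate g (translate h z)" if "g \<in> carrier G" "h \<in> carrier G" for g h z
    using that by (auto simp: translate_def right_shift_def fun_eq_iff m_assoc)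
  show "translate g z \<in> separating K" if g: "g \<in> carrier G" and z: "z \<in> separating K" for g z
  proof -
    have "inj_on (\<lambda>k. translate g z (k \<otimes> h)) K" if h: "h \<in> carrier G" for h
    proof -
      have "translate g z (k \<otimes> h) = z (k \<otimes> (h \<otimes> g))" if "k \<in> K" for k
        using K that g h by (auto simp: translate_def right_shift_def m_assoc)
      moreover have "inj_on (\<lambda>k. z (k \<otimes> (h \<otimes> g))) K"
        using z g h by (simp add: separating_def)
      ultimately show ?thesis
        by (simp add: inj_on_def)
    qed
    then show ?thesis
      by (simp add: separating_def)
  qed
qed

lemma inj_imp_separating:
  assumes "inj_on z (carrier G)" "K \<subseteq> carrier G"
  shows "z \<in> separating K"
proof -
  have "inj_on (\<lambda>k. z (k \<otimes> g)) K" if g: "g \<in> carrier G" for g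
  proof (rule inj_onI)
    fix k k' assume "k \<in> K" "k' \<in> K" "z (k \<otimes> g) = z (k' \<otimes> g)"
    then show "k = k'"
      using inj_onD[OF assms(1), of "k \<otimes> g" "k' \<otimes> g"] assms(2) g by (simp add: subset_iff)
  qed
  then show ?thesis
    by (simp add: separating_def)
qed

end

lemma continuous_on_fun_upd:
  fixes z :: "'a \<Rightarrow> 'b::topological_space"
  assumes "continuous_on S \<gamma>"
  shows "continuous_on S (\<lambda>t. z(a := \<gamma> t))"
proof (rule continuous_on_coordinatewise_then_product)
  fix i
  show "continuous_on S (\<lambda>t. (z(a := \<gamma> t)) i)"
    using assms by (cases "i = a") simp_all
qed

lemma inj_on_relabel_point:
  assumes "inj_on z A" "w \<notin> z ` (A - {a})"
  shows "inj_on (z(a := w)) A"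
proof (rule inj_onI)
  fix x y assume xy: "x \<in> A" "y \<in> A" "(z(a := w)) x = (z(a := w)) y"
  show "x = y"
    by (cases "x = a"; cases "y = a") (use xy assms(2) inj_onD[OF assms(1) _ xy(1,2)] in \<open>simp_all; blast\<close>)+
qed

text \<open>The complement of finitely many points of the plane is path-connected, so a point can be moved
  anywhere without meeting the others.\<close>

lemma path_component_relabel_point:
  fixes z :: "'a \<Rightarrow> complex"
  assumes A: "finite A" "inj_on z A" and w: "w \<notin> z ` (A - {a})"
  shows "path_component {z. inj_on z A} z (z(a := w))"
proof (cases "a \<in> A")
  case True
  let ?S = "- (z ` (A - {a}))"
  have "path_connected ?S"
    using A(1) by (intro path_connected_complement_countable) (auto intro: countable_finite)
  moreover have "z a \<in> ?S"
    using A(2) True by (auto simp: inj_on_def)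
  ultimately obtain \<gamma> where \<gamma>: "path \<gamma>" "path_image \<gamma> \<subseteq> ?S" "pathstart \<gamma> = z a" "pathfinish \<gamma> = w"
    using w unfolding path_connected_def by blast
  have "path (\<lambda>t. z(a := \<gamma> t))"
    using \<gamma>(1) unfolding path_def by (rule continuous_on_fun_upd)
  moreover have "inj_on (z(a := \<gamma> t)) A" if "t \<in> {0..1}" for t
  proof -
    have "\<gamma> t \<notin> z ` (A - {a})"
      using \<gamma>(2) that unfolding path_image_def by blast
    then show ?thesis
      by (rule inj_on_relabel_point[OF A(2)])
  qed
  moreover have "z(a := \<gamma> 0) = z" "z(a := \<gamma> 1) = z(a := w)"
    using \<gamma>(3,4) by (auto simp: pathstart_def pathfinish_def)
  ultimately have "connects {z. inj_on z A} z (z(a := w)) (\<lambda>t. z(a := \<gamma> t))"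
    by (intro connectsI) (simp_all add: path_def)
  then show ?thesis
    unfolding path_component_def connects_def by blast
next
  case False
  have "inj_on (z(a := v)) A" for v
    using A(2) by (rule inj_on_cong[THEN iffD1, rotated]) (use False in auto)
  then have "connects {z. inj_on z A} z (z(a := w)) (\<lambda>t. z(a := (1 - of_real t) * z a + of_real t * w))"
    by (intro connectsI continuous_on_fun_upd continuous_intros) simp_all
  then show ?thesis
    unfolding path_component_def connects_def by blast
qed

text \<open>A transposition is carried out in three moves, one of the two points being parked at an unused
  place.\<close>

lemma path_component_permuted_labels:
  fixes z :: "'a \<Rightarrow> complex"
  assumes "p permutes A" "finite A" "inj_on z A"
  shows "path_component {z. inj_on z A} z (z \<circ> p)"
  using assms
proof (induction p arbitrary: z rule: permutes_induct)
  case id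
  then show ?case
    by (simp add: path_component_refl)
next
  case (swap a b p)
  let ?I = "{z. inj_on z A}"
  note inj = swap.prems
  obtain s where s: "s \<notin> z ` A"
    using ex_new_if_finite[OF infinite_UNIV_char_0] assms(2) by blast
  let ?z1 = "z(a := s)" and ?z2 = "z(a := s, b := z a)" and ?z3 = "z(a := s, b := z a, a := z b)"
  have "path_component ?I z ?z1"
    by (rule path_component_relabel_point) (use s assms(2) inj in auto)
  moreover have "path_component ?I ?z1 ?z2"
    by (rule path_component_relabel_point) (use s assms(2) swap.hyps inj in \<open>auto simp: inj_on_def\<close>)
  moreover have "path_component ?I ?z2 ?z3"
    by (rule path_component_relabel_point) (use s assms(2) swap.hyps inj in \<open>auto simp: inj_on_def\<close>)
  moreover have eq: "?z3 = z \<circ> Transposition.transpose a b"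
    by (auto simp: fun_eq_iff Transposition.transpose_def)
  ultimately have 1: "path_component ?I z (z \<circ> Transposition.transpose a b)"
    by (metis path_component_trans)
  then have "inj_on (z \<circ> Transposition.transpose a b) A"
    using path_component_mem by fastforce
  from swap.IH[OF this] 1
  show ?case
    by (metis comp_assoc path_component_trans)
qed

context group
begin

text \<open>The labels \<open>\<kappa>\<close> need not be distinct, but pushing them into the plane by distinct imaginary parts
  makes them so without creating coincidences within a coset; after that the labels can be
  permuted freely.\<close>

lemma path_component_separating_translate:
  assumes fin: "finite (carrier G)" and K: "K \<subseteq> carrier G" and g: "g \<in> carrier G"
    and z: "\<And>h. z h = of_nat (\<kappa> h)" "z \<in> separating K"
  shows "path_component (separating K) z (translate g z)"
proof -
  interpret topological_action G "separating K" translate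
    by (rule topological_action_separating[OF K])
  obtain l :: "'a \<Rightarrow> nat" where l: "inj_on l (carrier G)"
    using finite_imp_inj_to_nat_seg[OF fin] by blast
  \<comment> \<open>the real parts keep the elements of a coset apart for every \<open>t\<close>\<close>
  define y where "y t h = Complex (of_nat (\<kappa> h)) (t * of_nat (l h))" for t h
  have sep: "y t \<in> separating K" for t
    using z by (auto simp: separating_def y_def inj_on_def)
  have "path y"
    unfolding path_def y_def[abs_def] Complex_eq
    by (intro continuous_on_coordinatewise_then_product continuous_intros)
  moreover have "y 0 = z"
    by (simp add: y_def fun_eq_iff z(1) complex_eq_iff)
  ultimately have 1: "path_component (separating K) z (y 1)"
    unfolding path_component_def using sep
    by (intro exI[of _ y]) (auto simp: path_image_def pathstart_def pathfinish_def)
  have "inj_on (y 1) (carrier G)"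
    using l by (auto simp: y_def inj_on_def)
  then have "path_component {z. inj_on z (carrier G)} (y 1) (translate g (y 1))"
    unfolding translate_def by (intro path_component_permuted_labels right_shift_permutes[OF g] fin)
  then have 2: "path_component (separating K) (y 1) (translate g (y 1))"
    by (rule path_component_of_subset[rotated]) (use inj_imp_separating K in blast)
  obtain \<gamma> where "path \<gamma>" "path_image \<gamma> \<subseteq> separating K" "pathstart \<gamma> = z" "pathfinish \<gamma> = y 1"
    using 1 by (auto simp: path_component_def)
  then have "connects (separating K) (translate g z) (translate g (y 1)) (translate g \<circ> \<gamma>)"
    by (intro act_path[OF g]) (simp add: connects_def)
  then have "path_component (separating K) (translate g z) (translate g (y 1))"
    unfolding path_component_def connects_def by blast
  then show ?thesis
    using 1 2 path_component_sym path_component_trans by metis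
qed

text \<open>The label of \<open>h\<close> encodes the coset \<open>{h, h \<otimes> t}\<close>. Two elements \<open>k \<otimes> g\<close> and \<open>k' \<otimes> g\<close> of one right
  coset of \<open>K\<close> could share it only if a conjugate of \<open>t\<close> were \<open>inv k \<otimes> k'\<close>, an element of \<open>K\<close>.\<close>

lemma invariant_separating_labelling:
  assumes fin: "finite (carrier G)" and K: "subgroup K G" and t: "t \<in> carrier G" "t \<otimes> t = \<one>"
    and conj: "\<And>g. g \<in> carrier G \<Longrightarrow> g \<otimes> t \<otimes> inv g \<notin> K"
  obtains \<kappa> :: "'a \<Rightarrow> nat" where "(\<lambda>h. of_nat (\<kappa> h)) \<in> separating K"
    "translate t (\<lambda>h. of_nat (\<kappa> h)) = (\<lambda>h. of_nat (\<kappa> h))"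
proof -
  obtain \<nu> :: "'a set \<Rightarrow> nat" where \<nu>: "inj_on \<nu> (Pow (carrier G))"
    using finite_imp_inj_to_nat_seg[of "Pow (carrier G)"] fin by auto
  define \<kappa> where "\<kappa> h = \<nu> {h, h \<otimes> t}" for h
  have KG: "k \<in> carrier G" if "k \<in> K" for k
    using subgroup.mem_carrier[OF K that] .
  have "inj_on (\<lambda>k. \<kappa> (k \<otimes> g)) K" if g: "g \<in> carrier G" for g
  proof (rule inj_onI)
    fix k k' assume k: "k \<in> K" "k' \<in> K" and eq: "\<kappa> (k \<otimes> g) = \<kappa> (k' \<otimes> g)"
    have "{k \<otimes> g, k \<otimes> g \<otimes> t} = {k' \<otimes> g, k' \<otimes> g \<otimes> t}"
      using eq unfolding \<kappa>_def by (rule inj_onD[OF \<nu>]) (use KG k g t in auto)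
    then consider "k \<otimes> g = k' \<otimes> g" | "k \<otimes> g \<otimes> t = k' \<otimes> g"
      by (auto simp: doubleton_eq_iff)
    then show "k = k'"
    proof cases
      case 1
      then show ?thesis
        using KG[OF k(1)] KG[OF k(2)] g by simp
    next
      case 2
      have "g \<otimes> t \<otimes> inv g = inv k \<otimes> (k \<otimes> g \<otimes> t) \<otimes> inv g"
        using KG[OF k(1)] g t by (simp add: m_assoc inv_solve_left)
      also have "\<dots> = inv k \<otimes> k'"
        using 2 KG[OF k(1)] KG[OF k(2)] g by (simp add: m_assoc)
      finally show ?thesis
        using conj[OF g] K k by (simp add: subgroup.m_closed subgroup.m_inv_closed)
    qed
  qed
  then have "(\<lambda>h. of_nat (\<kappa> h)) \<in> separating K"
    by (simp add: separating_def inj_on_def)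
  moreover have "\<kappa> (right_shift t h) = \<kappa> h" for h
    using t by (auto simp: \<kappa>_def right_shift_def m_assoc insert_commute)
  ultimately show ?thesis
    by (intro that[of \<kappa>]) (auto simp: translate_def)
qed

end

section \<open>From lifts to the failure of the Borsuk-Ulam property\<close>

text \<open>Evaluating an equivariant map \<open>F\<close> into the separating labellings at \<open>\<one>\<close> gives the
  counterexample: its values on the \<open>K\<close>-orbit of \<open>y\<close>, with \<open>K = carrier G'\<close>, are the labels
  \<open>F y k\<close> of the elements \<open>k\<close> of \<open>K\<close>, which are distinct.\<close>

theorem not_borsuk_ulam_of_orbifold_lift:
  fixes G :: "('g, 'b) monoid_scheme" and G' :: "('g, 'c) monoid_scheme"
    and M :: "'m::real_normed_vector set" and N :: "'n::real_normed_vector set" and z :: "'g \<Rightarrow> complex"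
  defines "\<Gamma> \<equiv> topological_action.orbifold_group G (group.separating G (carrier G')) (group.translate G) z"
  assumes cover: "covering_action G M \<tau> p m N x \<theta>" and fin: "finite (carrier G)"
    and pres: "presents S R (fundamental_group N x) e"
    and model: "square_model N q W V"
    and patterns: "W \<in> {torus_gluing, antipodal_gluing}" "V \<in> {torus_gluing, antipodal_gluing}"
    and K: "carrier G' \<subseteq> carrier G" and z: "z \<in> group.separating G (carrier G')"
    and h: "h \<in> S \<rightarrow> carrier \<Gamma>"
    and over: "\<And>s. s \<in> S \<Longrightarrow> fst (h s) = \<theta> (e s)"
    and relators: "\<And>r. r \<in> R \<Longrightarrow> eval_word \<Gamma> h r = \<one>\<^bsub>\<Gamma>\<^esub>"
  shows "\<not> borsuk_ulam M G' \<tau> (UNIV :: (real^2) set)"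
proof -
  interpret covering_action G M \<tau> p m N x \<theta>
    by (rule cover)
  let ?Z = "separating (carrier G')"
  interpret Z: topological_action G ?Z translate
    by (rule topological_action_separating[OF K])
  let ?\<Gamma> = "Z.orbifold_group z"
  have \<Gamma>: "group ?\<Gamma>"
    by (rule Z.group_orbifold_group[OF z])
  obtain \<psi> where \<psi>: "\<psi> \<in> hom (fundamental_group N x) ?\<Gamma>" "\<And>s. s \<in> S \<Longrightarrow> \<psi> (e s) = h s"
    using presents_hom_exists[OF pres \<Gamma>] h relators unfolding \<Gamma>_def by blast
  have "fst \<circ> \<psi> \<in> hom (fundamental_group N x) G"
    using \<psi>(1) Z.fst_orbifold_group_hom by (rule Group.hom_compose)
  then have \<psi>_over: "fst (\<psi> \<alpha>) = \<theta> \<alpha>" if "\<alpha> \<in> carrier (fundamental_group N x)" for \<alpha>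
    using presents_hom_unique[OF pres _ \<theta>_hom is_group _ that, of "fst \<circ> \<psi>"] \<psi>(2) over by simp
  have "path_connected unit_square"
    by (intro convex_imp_path_connected convex_Times convex_real_interval)
  then have "path_connected N"
    using model path_connected_continuous_image[of unit_square q] by (auto simp: square_model_def)
  then interpret orbifold_hom G M \<tau> p m N x \<theta> ?Z translate z \<psi>
    by unfold_locales (use z \<psi>(1) \<psi>_over in auto)
  interpret F: equivariant_path_functor G M \<tau> p m N x \<theta> ?Z translate
      "\<lambda>y. translate (offset y) z" transport
    by (rule equivariant_path_functor)
  have "F.realizable W" "F.realizable V"
    using patterns F.realizable_torus F.realizable_antipodal by auto
  then obtain F where F: "continuous_on M F" "F ` M \<subseteq> ?Z"
      "\<And>g y. g \<in> carrier G \<Longrightarrow> y \<in> M \<Longrightarrow> F (\<tau> g y) = translate g (F y)"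
    using F.equivariant_map_of_square_model[OF fin model] by metis
  define f :: "'m \<Rightarrow> real^2" where "f y = (\<chi> i. if i = 1 then Re (F y \<one>\<^bsub>G\<^esub>) else Im (F y \<one>\<^bsub>G\<^esub>))" for y
  have "continuous_on M (\<lambda>y. F y \<one>\<^bsub>G\<^esub>)"
    by (rule continuous_on_product_then_coordinatewise[OF F(1)])
  then have "continuous_on M (\<lambda>y. if i = 1 then Re (F y \<one>\<^bsub>G\<^esub>) else Im (F y \<one>\<^bsub>G\<^esub>))" for i :: 2
    by (cases "i = 1") (simp_all add: continuous_on_Re continuous_on_Im)
  then have "continuous_on M f"
    unfolding f_def[abs_def] by (intro continuous_on_vec_lambda)
  moreover have "f (\<tau> g\<^sub>1 y) \<noteq> f (\<tau> g\<^sub>2 y)"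
    if g: "g\<^sub>1 \<in> carrier G'" "g\<^sub>2 \<in> carrier G'" "g\<^sub>1 \<noteq> g\<^sub>2" and y: "y \<in> M" for g\<^sub>1 g\<^sub>2 y
  proof
    assume "f (\<tau> g\<^sub>1 y) = f (\<tau> g\<^sub>2 y)"
    then have "F (\<tau> g\<^sub>1 y) \<one>\<^bsub>G\<^esub> = F (\<tau> g\<^sub>2 y) \<one>\<^bsub>G\<^esub>"
      by (simp add: f_def vec_eq_iff forall_2 complex_eq_iff)
    then have "F y g\<^sub>1 = F y g\<^sub>2"
      using F(3)[OF subsetD[OF K g(1)] y] F(3)[OF subsetD[OF K g(2)] y] g K
      by (auto simp: translate_def right_shift_def subset_iff)
    moreover have "inj_on (\<lambda>k. F y (k \<otimes>\<^bsub>G\<^esub> \<one>\<^bsub>G\<^esub>)) (carrier G')"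
      using F(2) y by (auto simp: separating_def)
    ultimately show False
      using g K by (auto simp: inj_on_def subset_iff)
  qed
  ultimately have cont: "continuous_on M f" and distinct: "\<And>g\<^sub>1 g\<^sub>2 y. g\<^sub>1 \<in> carrier G' \<Longrightarrow> g\<^sub>2 \<in> carrier G' \<Longrightarrow>
      g\<^sub>1 \<noteq> g\<^sub>2 \<Longrightarrow> y \<in> M \<Longrightarrow> f (\<tau> g\<^sub>1 y) \<noteq> f (\<tau> g\<^sub>2 y)"
    by blast+
  define \<beta> where "\<beta> = {k. homotopic_with_canon (\<lambda>_. True) M (UNIV :: (real^2) set) f k}"
  have "\<beta> \<in> homotopy_classes M UNIV"
    unfolding homotopy_classes_def \<beta>_def using cont subset_UNIV by blast
  moreover have "f \<in> \<beta>"
    using cont by (simp add: \<beta>_def)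
  then have "\<not> borsuk_ulam_class M G' \<tau> \<beta>"
    unfolding borsuk_ulam_class_def using distinct by blast
  ultimately show ?thesis
    unfolding borsuk_ulam_def by blast
qed

section \<open>The symmetric group\<close>

lemma carrier_symmetric_group: "p \<in> carrier (symmetric_group n) \<longleftrightarrow> p permutes {1..n}"
  and mult_symmetric_group: "p \<otimes>\<^bsub>symmetric_group n\<^esub> q = q \<circ> p"
  and one_symmetric_group: "\<one>\<^bsub>symmetric_group n\<^esub> = id"
  by (simp_all add: symmetric_group_def sym_group_def)

lemma finite_symmetric_group: "finite (carrier (symmetric_group n))"
  by (simp add: symmetric_group_def sym_group_def finite_permutations)

lemma inv_symmetric_group:
  "p permutes {1..n} \<Longrightarrow> inv\<^bsub>symmetric_group n\<^esub> p = inv_into UNIV p"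
  by (intro group.inv_equality[OF group_symmetric_group])
    (simp_all add: carrier_symmetric_group mult_symmetric_group one_symmetric_group permutes_inv permutes_inv_o)

lemma long_cycle_apply:
  assumes "n > 2"
  shows "long_cycle n permutes {1..n}" "long_cycle n 1 = n" "1 < j \<Longrightarrow> j \<le> n \<Longrightarrow> long_cycle n j = j - 1"
proof -
  let ?l = "1 # rev [2..<Suc n]"
  have d: "distinct ?l"
    by auto
  have s: "set ?l = {1..n}"
    using assms by auto
  show "long_cycle n permutes {1..n}"
    using cycle_permutes[of ?l] unfolding s long_cycle_def .
  have l: "length ?l = n"
    using assms by simp
  have nth: "?l ! i = (if i = 0 then 1 else n + 1 - i)" if "i < n" for i
    using that by (auto simp: nth_Cons rev_nth split: nat.split)
  have step: "long_cycle n (?l ! i) = ?l ! ((i + 1) mod n)" if "i < n" for i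
  proof -
    have "map (cycle_of_list cs) cs = rotate1 cs" if "distinct cs" for cs :: "nat list"
      using cyclic_rotation[OF that, of 1] by simp
    from this[OF d] have "cycle_of_list ?l (?l ! i) = rotate1 ?l ! i"
      using that l by (metis nth_map)
    then show ?thesis
      using that l nth_rotate1[of i ?l] by (simp add: long_cycle_def)
  qed
  show "long_cycle n 1 = n"
    using step[of 0] nth[of 0] nth[of 1] assms by simp
  show "long_cycle n j = j - 1" if "1 < j" "j \<le> n" for j
    using step[of "n + 1 - j"] nth[of "n + 1 - j"] nth[of "(n + 2 - j) mod n"] that assms
    by (cases "j = 2") (auto simp: Suc_diff_le numeral_2_eq_2)
qed

text \<open>The fixed points of \<open>k\<close> are permuted among themselves by the long cycle, which is transitive.\<close>

lemma commutes_long_cycle_fixed_point: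
  assumes n: "n > 2" and k: "k \<circ> long_cycle n = long_cycle n \<circ> k" and c: "c \<in> {1..n}" "k c = c"
    and j: "j \<in> {1..n}"
  shows "k j = j"
proof -
  have closed: "k (long_cycle n i) = long_cycle n i" if "k i = i" for i
    using fun_cong[OF k, of i] that by simp
  have down: "k (i - d) = i - d" if "k i = i" "i \<le> n" "d < i" for i d
    using that(3)
  proof (induction d)
    case (Suc d)
    then show ?case
      using closed[of "i - d"] long_cycle_apply(3)[OF n, of "i - d"] that(2) by simp
  qed (use that(1) in simp)
  have "k 1 = 1"
    using down[OF c(2), of "c - 1"] c(1) by simp
  then have "k n = n"
    using closed[of 1] long_cycle_apply(2)[OF n] by simp
  then show ?thesis
    using down[of n "n - j"] j by simp
qed

lemma generate_commutes:
  assumes "group G" "a \<in> carrier G" "k \<in> generate G {a}"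
  shows "k \<otimes>\<^bsub>G\<^esub> a = a \<otimes>\<^bsub>G\<^esub> k"
proof -
  interpret group G by fact
  have sub: "generate G {a} \<subseteq> carrier G"
    using generate_incl assms(2) by simp
  show ?thesis
    using assms(3)
  proof (induction rule: generate.induct)
    case (eng h1 h2)
    have h: "h1 \<in> carrier G" "h2 \<in> carrier G"
      using eng.hyps sub by auto
    have "h1 \<otimes>\<^bsub>G\<^esub> h2 \<otimes>\<^bsub>G\<^esub> a = h1 \<otimes>\<^bsub>G\<^esub> (a \<otimes>\<^bsub>G\<^esub> h2)"
      using eng.IH(2) h assms(2) by (simp add: m_assoc)
    also have "\<dots> = a \<otimes>\<^bsub>G\<^esub> (h1 \<otimes>\<^bsub>G\<^esub> h2)"
      using eng.IH(1) h assms(2) by (metis m_assoc)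
    finally show ?case .
  qed (use assms(2) in auto)
qed

text \<open>As \<open>n > 2\<close>, a transposition fixes a point without being the identity, and so does every
  conjugate of it. A power of the long cycle with a fixed point is the identity, because it
  commutes with the long cycle.\<close>

lemma conjugate_transposition_notin_generate:
  assumes n: "n > 2" and g: "g permutes {1..n}"
  shows "g \<otimes>\<^bsub>symmetric_group n\<^esub> cycle_of_list [1, 2] \<otimes>\<^bsub>symmetric_group n\<^esub> inv\<^bsub>symmetric_group n\<^esub> g
    \<notin> generate (symmetric_group n) {long_cycle n}" (is "?c \<notin> ?K")
proof
  let ?k = "inv_into UNIV g \<circ> (Transposition.transpose 1 2 \<circ> g)"
  assume "?c \<in> ?K"
  then have k: "?k \<in> ?K"
    by (simp add: mult_symmetric_group inv_symmetric_group[OF g])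
  then have comm: "?k \<circ> long_cycle n = long_cycle n \<circ> ?k"
    using generate_commutes[OF group_symmetric_group _ k] long_cycle_apply(1)[OF n]
    by (simp add: carrier_symmetric_group mult_symmetric_group)
  have inv: "inv_into UNIV g y \<in> {1..n} \<and> g (inv_into UNIV g y) = y" if "y \<in> {1..n}" for y
    using permutes_in_image[OF permutes_inv[OF g], of y] permutes_inverses(1)[OF g, of y] that by simp
  have "3 \<in> {1..n}" "1 \<in> {1..n}" "2 \<in> {1..n}"
    using n by auto
  note i = inv[OF this(1)] inv[OF this(2)] inv[OF this(3)]
  have "?k (inv_into UNIV g 3) = inv_into UNIV g 3"
    using i(1) by simp
  then have "?k (inv_into UNIV g 1) = inv_into UNIV g 1"
    using commutes_long_cycle_fixed_point[OF n comm] i(1,2) by blast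
  then have "inv_into UNIV g 2 = inv_into UNIV g 1"
    using i(2) by simp
  then show False
    using i(2,3) by (metis numeral_One numeral_eq_iff semiring_norm(85))
qed

section \<open>Lifts to the braid group\<close>

definition exponent_sum :: "nat word set \<Rightarrow> int" where
  "exponent_sum = presented_hom integer_group (\<lambda>_. 1)"

lemma exponent_sum_relators:
  "r \<in> braid_relators n \<Longrightarrow> eval_word integer_group (\<lambda>_. 1) r = \<one>\<^bsub>integer_group\<^esub>"
  by (auto simp: braid_relators_def commutator_word_def inverse_word_def)

lemma exponent_sum_hom: "exponent_sum \<in> hom (braid_group n) integer_group"
  unfolding exponent_sum_def braid_group_def
  by (rule presented_hom_hom) (auto simp: exponent_sum_relators)

text \<open>Every generator of the braid group has exponent sum \<open>1\<close> and is sent to an odd permutation.\<close>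

lemma evenperm_braid_permutation:
  assumes "\<beta> \<in> carrier (braid_group n)"
  shows "evenperm (braid_permutation n \<beta>) \<longleftrightarrow> even (exponent_sum \<beta>)"
proof -
  let ?t = "\<lambda>i. cycle_of_list [i, i + 1]"
  interpret group "symmetric_group n"
    by (rule group_symmetric_group)
  obtain w where w: "w \<in> words {1..<n}" "\<beta> = word_class {1..<n} (braid_relators n) w"
    using assms by (auto simp: braid_group_def presented_group_def)
  have b: "braid_permutation n \<beta> = eval_word (symmetric_group n) ?t w"
    unfolding braid_permutation_def w(2)
    by (rule presented_hom_class) (use w group_symmetric_group braid_permutation_wd in auto)
  have e: "exponent_sum \<beta> = eval_word integer_group (\<lambda>_. 1) w"
    unfolding exponent_sum_def w(2)
    by (rule presented_hom_class) (use w exponent_sum_relators in auto)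
  let ?p = "eval_word (symmetric_group n) ?t" and ?e = "eval_word integer_group (\<lambda>_. 1) :: nat word \<Rightarrow> int"
  have "?p w permutes {1..n} \<and> (evenperm (?p w) \<longleftrightarrow> even (?e w))"
    using w(1)
  proof (induction w)
    case Nil
    show ?case
      by (simp only: eval_word.simps one_symmetric_group one_integer_group permutes_id evenperm_id
          dvd_0_right simp_thms)
  next
    case (Cons a w)
    obtain i s where a: "a = (i, s)"
      by force
    let ?s = "Transposition.transpose i (Suc i)"
    have i: "?s permutes {1..n}"
      using Cons.prems a by (intro permutes_swap_id) auto
    have "inv\<^bsub>symmetric_group n\<^esub> ?s = ?s"
      by (simp add: inv_symmetric_group[OF i])
    then have ev: "?p (a # w) = ?p w \<circ> ?s"
      by (simp add: a mult_symmetric_group)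
    have IH: "?p w permutes {1..n}" "evenperm (?p w) \<longleftrightarrow> even (?e w)"
      using Cons by auto
    then have "permutation (?p w)"
      by (auto simp: permutation_permutes)
    then have "evenperm (?p (a # w)) \<longleftrightarrow> \<not> evenperm (?p w)"
      unfolding ev by (simp add: evenperm_comp permutation_swap_id evenperm_swap)
    moreover have "even (?e (a # w)) \<longleftrightarrow> odd (?e w)"
      by (simp add: a)
    moreover have "?p (a # w) permutes {1..n}"
      unfolding ev by (rule permutes_compose[OF i IH(1)])
    ultimately show ?case
      using IH(2) by blast
  qed
  then show ?thesis
    using b e by simp
qed

text \<open>The exponent sum is a homomorphism to the integers, under which the relator
  \<open>c\<^sup>2 [a\<^sub>1, b\<^sub>1]\<close> becomes \<open>2 c = 0\<close>; so the image of \<open>c\<close> has exponent sum \<open>0\<close>.\<close>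

lemma braid_lift_evenperm:
  assumes pres: "presents {Cgen, Agen 1, Bgen 1}
      {[(Cgen, True), (Cgen, True)] @ commutator_word (Agen 1) (Bgen 1)} P e"
    and \<psi>: "\<psi> \<in> hom P (braid_group n)"
  shows "evenperm (braid_permutation n (\<psi> (e Cgen)))" "e Cgen \<in> carrier P"
proof -
  show c: "e Cgen \<in> carrier P"
    by (rule presents_generator[OF pres]) simp
  have "exponent_sum \<circ> \<psi> \<in> hom P integer_group"
    using \<psi> exponent_sum_hom by (rule Group.hom_compose)
  from presents_relator[OF pres this group_integer_group singletonI]
  have "2 * exponent_sum (\<psi> (e Cgen)) = 0"
    by (simp add: commutator_word_def)
  then have "exponent_sum (\<psi> (e Cgen)) = 0"
    by simp
  then show "evenperm (braid_permutation n (\<psi> (e Cgen)))"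
    using evenperm_braid_permutation[of "\<psi> (e Cgen)" n] \<psi> c by (auto simp: hom_def)
qed

section \<open>The Borsuk-Ulam property for the two surfaces\<close>

lemma (in group) eval_word_commutator_self:
  assumes "h x = a" "h y = a" "a \<in> carrier G"
  shows "eval_word G h (commutator_word x y) = \<one>"
  using assms by (simp add: commutator_word_def m_assoc[symmetric])

theorem proposition5p1:
  fixes n :: nat
    and N\<^sub>1 :: "'a::real_normed_vector set" and x\<^sub>1 :: 'a
    and N\<^sub>2 :: "'b::real_normed_vector set" and x\<^sub>2 :: 'b
    and e\<^sub>1 :: "surface_generator \<Rightarrow> (real \<Rightarrow> 'a) set"
    and e\<^sub>2 :: "surface_generator \<Rightarrow> (real \<Rightarrow> 'b) set"
    and \<theta>\<^sub>1 :: "(real \<Rightarrow> 'a) set \<Rightarrow> (nat \<Rightarrow> nat)"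
    and \<theta>\<^sub>2 :: "(real \<Rightarrow> 'b) set \<Rightarrow> (nat \<Rightarrow> nat)"
    and M\<^sub>1 :: "'c::real_normed_vector set" and p\<^sub>1 :: "'c \<Rightarrow> 'a" and m\<^sub>1 :: 'c
    and M\<^sub>2 :: "'d::real_normed_vector set" and p\<^sub>2 :: "'d \<Rightarrow> 'b" and m\<^sub>2 :: 'd
    and \<tau>\<^sub>1 :: "(nat \<Rightarrow> nat) \<Rightarrow> 'c \<Rightarrow> 'c"
    and \<tau>\<^sub>2 :: "(nat \<Rightarrow> nat) \<Rightarrow> 'd \<Rightarrow> 'd"
  assumes "n > 2"
    and "connected_sum torus torus_disc torus torus_disc (top_of_set N\<^sub>1)" and "x\<^sub>1 \<in> N\<^sub>1"
    and "connected_sum projective_plane projective_disc torus torus_disc (top_of_set N\<^sub>2)" and "x\<^sub>2 \<in> N\<^sub>2"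
    and "presents {Agen 1, Bgen 1, Agen 2, Bgen 2}
           {commutator_word (Agen 1) (Bgen 1) @ commutator_word (Agen 2) (Bgen 2)}
           (fundamental_group N\<^sub>1 x\<^sub>1) e\<^sub>1"
    and "presents {Cgen, Agen 1, Bgen 1}
           {[(Cgen, True), (Cgen, True)] @ commutator_word (Agen 1) (Bgen 1)}
           (fundamental_group N\<^sub>2 x\<^sub>2) e\<^sub>2"
    and "\<theta>\<^sub>1 \<in> epi (fundamental_group N\<^sub>1 x\<^sub>1) (symmetric_group n)"
    and "\<theta>\<^sub>1 (e\<^sub>1 (Agen 1)) = cycle_of_list [1, 2]" and "\<theta>\<^sub>1 (e\<^sub>1 (Bgen 1)) = cycle_of_list [1, 2]"
    and "\<theta>\<^sub>1 (e\<^sub>1 (Agen 2)) = long_cycle n" and "\<theta>\<^sub>1 (e\<^sub>1 (Bgen 2)) = long_cycle n"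
    and "\<theta>\<^sub>2 \<in> epi (fundamental_group N\<^sub>2 x\<^sub>2) (symmetric_group n)"
    and "\<theta>\<^sub>2 (e\<^sub>2 Cgen) = cycle_of_list [1, 2]"
    and "\<theta>\<^sub>2 (e\<^sub>2 (Agen 1)) = long_cycle n" and "\<theta>\<^sub>2 (e\<^sub>2 (Bgen 1)) = long_cycle n"
    and "arises_from M\<^sub>1 \<tau>\<^sub>1 p\<^sub>1 m\<^sub>1 N\<^sub>1 x\<^sub>1 (symmetric_group n) \<theta>\<^sub>1"
    and "arises_from M\<^sub>2 \<tau>\<^sub>2 p\<^sub>2 m\<^sub>2 N\<^sub>2 x\<^sub>2 (symmetric_group n) \<theta>\<^sub>2"
  shows "\<not> borsuk_ulam M\<^sub>1 (symmetric_group n) \<tau>\<^sub>1 (UNIV :: (real^2) set) \<and>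
    \<not> (\<exists>\<psi> \<in> hom (fundamental_group N\<^sub>2 x\<^sub>2) (braid_group n).
          \<forall>\<alpha> \<in> carrier (fundamental_group N\<^sub>2 x\<^sub>2).
            braid_permutation n (\<psi> \<alpha>) = action_projection (symmetric_group n) M\<^sub>2 \<tau>\<^sub>2 p\<^sub>2 m\<^sub>2 \<alpha>) \<and>
    \<not> borsuk_ulam M\<^sub>2 (subgroup_generated (symmetric_group n) {long_cycle n}) \<tau>\<^sub>2
          (UNIV :: (real^2) set)"
proof -
  let ?G = "symmetric_group n" and ?t = "cycle_of_list [1, 2] :: nat \<Rightarrow> nat" and ?L = "long_cycle n"
  note n = assms(1)
  interpret G: group ?G
    by (rule group_symmetric_group)
  interpret C1: covering_action ?G M\<^sub>1 \<tau>\<^sub>1 p\<^sub>1 m\<^sub>1 N\<^sub>1 x\<^sub>1 \<theta>\<^sub>1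
    by unfold_locales (use assms(8,17) in \<open>auto simp: epi_def\<close>)
  interpret C2: covering_action ?G M\<^sub>2 \<tau>\<^sub>2 p\<^sub>2 m\<^sub>2 N\<^sub>2 x\<^sub>2 \<theta>\<^sub>2
    by unfold_locales (use assms(13,18) in \<open>auto simp: epi_def\<close>)
  have t: "?t \<in> carrier ?G" "?t \<otimes>\<^bsub>?G\<^esub> ?t = \<one>\<^bsub>?G\<^esub>"
    using n by (auto simp: carrier_symmetric_group mult_symmetric_group one_symmetric_group intro!: permutes_swap_id)
  have L: "?L \<in> carrier ?G"
    using long_cycle_apply(1)[OF n] by (simp add: carrier_symmetric_group)
  have a: "\<not> borsuk_ulam M\<^sub>1 ?G \<tau>\<^sub>1 (UNIV :: (real^2) set)"
  proof -
    let ?Z = "G.separating (carrier ?G)"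
    interpret Z: topological_action ?G ?Z G.translate
      by (rule G.topological_action_separating[OF subset_refl])
    obtain \<kappa> :: "(nat \<Rightarrow> nat) \<Rightarrow> nat" where \<kappa>: "inj_on \<kappa> (carrier ?G)"
      using finite_imp_inj_to_nat_seg[OF finite_symmetric_group] by blast
    define z where "z h = (of_nat (\<kappa> h) :: complex)" for h
    have z: "z \<in> ?Z"
      by (rule G.inj_imp_separating) (use \<kappa> in \<open>auto simp: z_def inj_on_def\<close>)
    let ?\<Gamma> = "Z.orbifold_group z"
    interpret \<Gamma>: group ?\<Gamma>
      by (rule Z.group_orbifold_group[OF z])
    \<comment> \<open>any choice of lifts works, because both generators of a handle get the same lift\<close>
    have "\<exists>c \<in> carrier ?\<Gamma>. fst c = g" if "g \<in> carrier ?G" for g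
      using G.path_component_separating_translate[OF finite_symmetric_group subset_refl that z_def z]
        Z.orbifold_group_mem[OF that] by (force simp: path_component_def connects_def)
    then obtain c d where cd: "c \<in> carrier ?\<Gamma>" "fst c = ?t"
        "d \<in> carrier ?\<Gamma>" "fst d = ?L"
      using t(1) L by metis
    obtain q where q: "square_model N\<^sub>1 q torus_gluing torus_gluing"
      using square_model_of_connected_sum[OF assms(2) torus_collar_model torus_collar_model] by blast
    define h where "h s = (if s \<in> {Agen 1, Bgen 1} then c else d)" for s
    have "eval_word ?\<Gamma> h (commutator_word (Agen 1) (Bgen 1)) = \<one>\<^bsub>?\<Gamma>\<^esub>"
      "eval_word ?\<Gamma> h (commutator_word (Agen 2) (Bgen 2)) = \<one>\<^bsub>?\<Gamma>\<^esub>"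
      by (rule \<Gamma>.eval_word_commutator_self; use cd in \<open>simp add: h_def\<close>)+
    then have rel: "eval_word ?\<Gamma> h
        (commutator_word (Agen 1) (Bgen 1) @ commutator_word (Agen 2) (Bgen 2)) = \<one>\<^bsub>?\<Gamma>\<^esub>"
      using cd by (simp add: commutator_word_def h_def \<Gamma>.m_assoc)
    show ?thesis
      by (rule not_borsuk_ulam_of_orbifold_lift[OF C1.covering_action_axioms finite_symmetric_group assms(6) q, where h = h and z = z])
        (use z cd rel assms(9-12) in \<open>auto simp: h_def\<close>)
  qed
  have b: "\<not> (\<exists>\<psi> \<in> hom (fundamental_group N\<^sub>2 x\<^sub>2) (braid_group n).
      \<forall>\<alpha> \<in> carrier (fundamental_group N\<^sub>2 x\<^sub>2).
        braid_permutation n (\<psi> \<alpha>) = action_projection ?G M\<^sub>2 \<tau>\<^sub>2 p\<^sub>2 m\<^sub>2 \<alpha>)" (is "\<not> ?lift")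
  proof
    assume ?lift
    then obtain \<psi> where \<psi>: "\<psi> \<in> hom (fundamental_group N\<^sub>2 x\<^sub>2) (braid_group n)"
        "\<And>\<alpha>. \<alpha> \<in> carrier (fundamental_group N\<^sub>2 x\<^sub>2) \<Longrightarrow>
          braid_permutation n (\<psi> \<alpha>) = action_projection ?G M\<^sub>2 \<tau>\<^sub>2 p\<^sub>2 m\<^sub>2 \<alpha>"
      by blast
    note c = braid_lift_evenperm[OF assms(7) \<psi>(1)]
    have "evenperm ?t"
      using c(1) \<psi>(2)[OF c(2)] C2.projection[OF c(2)] assms(14) by simp
    then show False
      by (simp add: evenperm_swap)
  qed
  have c: "\<not> borsuk_ulam M\<^sub>2 (subgroup_generated ?G {?L}) \<tau>\<^sub>2 (UNIV :: (real^2) set)"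
  proof -
    let ?K = "carrier (subgroup_generated ?G {?L})"
    have K: "?K = generate ?G {?L}"
      using L by (simp add: carrier_subgroup_generated)
    have sub: "subgroup ?K ?G"
      unfolding K by (rule G.generate_is_subgroup) (use L in simp)
    then have KG: "?K \<subseteq> carrier ?G"
      by (rule subgroup.subset)
    let ?Z = "G.separating ?K"
    interpret Z: topological_action ?G ?Z G.translate
      by (rule G.topological_action_separating[OF KG])
    have conj: "g \<otimes>\<^bsub>?G\<^esub> ?t \<otimes>\<^bsub>?G\<^esub> inv\<^bsub>?G\<^esub> g \<notin> ?K" if "g \<in> carrier ?G" for g
      unfolding K by (rule conjugate_transposition_notin_generate[OF n]) (use that in \<open>simp add: carrier_symmetric_group\<close>)
    obtain \<kappa> :: "(nat \<Rightarrow> nat) \<Rightarrow> nat" where \<kappa>: "(\<lambda>h. of_nat (\<kappa> h)) \<in> ?Z"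
        "G.translate ?t (\<lambda>h. of_nat (\<kappa> h)) = (\<lambda>h. of_nat (\<kappa> h))"
      using G.invariant_separating_labelling[OF finite_symmetric_group sub t conj] by blast
    define z where "z h = (of_nat (\<kappa> h) :: complex)" for h
    have z: "z \<in> ?Z" "G.translate ?t z = z"
      using \<kappa> by (simp_all add: z_def[abs_def])
    let ?\<Gamma> = "Z.orbifold_group z"
    interpret \<Gamma>: group ?\<Gamma>
      by (rule Z.group_orbifold_group[OF z(1)])
    have "\<exists>d \<in> carrier ?\<Gamma>. fst d = ?L"
      using G.path_component_separating_translate[OF finite_symmetric_group KG L z_def z(1)]
        Z.orbifold_group_mem[OF L] by (force simp: path_component_def connects_def)
    then obtain d where d: "d \<in> carrier ?\<Gamma>" "fst d = ?L"
      by blast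
    \<comment> \<open>the constant path is a lift of order two, since \<open>z\<close> is invariant under the transposition\<close>
    define c where "c = (?t, path_class ?Z (\<lambda>_. z))"
    have const: "connects ?Z z (G.translate ?t z) (\<lambda>_. z)"
      using connects_const[OF z(1)] z(2) by simp
    have c: "c \<in> carrier ?\<Gamma>"
      unfolding c_def by (rule Z.orbifold_group_mem[OF t(1) const])
    have "(\<lambda>_. z) +++ (G.translate ?t \<circ> (\<lambda>_. z)) = (\<lambda>_. z)"
      using z(2) by (auto simp: joinpaths_def)
    then have cc: "c \<otimes>\<^bsub>?\<Gamma>\<^esub> c = \<one>\<^bsub>?\<Gamma>\<^esub>"
      unfolding c_def Z.orbifold_group_mult[OF t(1) t(1) const const] Z.orbifold_group_one t(2) by simp
    obtain q where q: "square_model N\<^sub>2 q antipodal_gluing torus_gluing"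
      using square_model_of_connected_sum[OF assms(4) projective_collar_model torus_collar_model] by blast
    define h where "h s = (if s = Cgen then c else d)" for s
    have "eval_word ?\<Gamma> h (commutator_word (Agen 1) (Bgen 1)) = \<one>\<^bsub>?\<Gamma>\<^esub>"
      by (rule \<Gamma>.eval_word_commutator_self; use d in \<open>simp add: h_def\<close>)
    then have rel: "eval_word ?\<Gamma> h
        ([(Cgen, True), (Cgen, True)] @ commutator_word (Agen 1) (Bgen 1)) = \<one>\<^bsub>?\<Gamma>\<^esub>"
      using c cc by (simp add: h_def)
    show ?thesis
      by (rule not_borsuk_ulam_of_orbifold_lift[OF C2.covering_action_axioms finite_symmetric_group assms(7) q, where h = h and z = z])
        (use z KG c d rel assms(14-16) in \<open>auto simp: h_def c_def\<close>)
  qed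
  show ?thesis
    using a b c by blast
qed

end
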